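(* Let $k$ be an odd integer with $k>3$. Then the generating function $\sum_{n\geq 0}|\operatorname{Av}_n(A_{k,k})|z^n$ is not algebraic.
   Context: A permutation $p=p_1\cdots p_n$ contains a pattern $q=q_1\cdots q_k$ if there are indices $i_1<\cdots<i_k$ with $p_{i_r}<p_{i_s}$ iff $q_r<q_s$; otherwise $p$ avoids $q$. $\operatorname{Av}_n(S)$ is the set of permutations of length $n$ avoiding every pattern in the set $S$. $A_{k,k}$ is the set of the $k-1$ permutations of length $k$ whose first $k-1$ entries are increasing and whose last entry is less than $k$. A power series $A(z)$ is algebraic if there are polynomials $P_0(z),\dots,P_d(z)$, not all identically zero, with $\sum_{j=0}^d P_j(z)A(z)^j=0$. *)

theory Defs
  imports
    Complex_Main
    "HOL-Combinatorics.Multiset_Permutations"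
    "HOL-Computational_Algebra.Polynomial_FPS"
begin

text \<open>
  A permutation of length \<open>n\<close> is the list of its values, that is, an element of
  \<^term>\<open>permutations_of_set {1..n}\<close>. Positions in lists count from 0, values from 1.
\<close>

definition contains_pattern :: "nat list \<Rightarrow> nat list \<Rightarrow> bool" where
  "contains_pattern p q \<longleftrightarrow>
     (\<exists>f. strict_mono_on {..<length q} f \<and> (\<forall>r<length q. f r < length p) \<and>
          (\<forall>r<length q. \<forall>s<length q. p ! f r < p ! f s \<longleftrightarrow> q ! r < q ! s))"

definition Av :: "nat \<Rightarrow> nat list set \<Rightarrow> nat list set" where
  "Av n S = {p \<in> permutations_of_set {1..n}. \<forall>q\<in>S. \<not> contains_pattern p q}"

definition A_patterns :: "nat \<Rightarrow> nat list set" where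
  "A_patterns k =
     {q \<in> permutations_of_set {1..k}. sorted_wrt (<) (butlast q) \<and> last q < k}"

definition algebraic_fps :: "'a::comm_ring_1 fps \<Rightarrow> bool" where
  "algebraic_fps A \<longleftrightarrow>
     (\<exists>(d::nat) (P :: nat \<Rightarrow> 'a poly).
        (\<exists>j\<le>d. P j \<noteq> 0) \<and> (\<Sum>j\<le>d. fps_of_poly (P j) * A ^ j) = 0)"

end

theory Submission
  imports
    Defs
    "HOL-Library.Sublist"
    "HOL-Analysis.FPS_Convergence"
    "HOL-Real_Asymp.Real_Asymp"
begin

text \<open>
  Put \<open>d = k - 2\<close>. A permutation lies in the class iff it splits into a prefix without an increasing
  subsequence of length \<open>d + 1\<close> followed by an increasing suffix, and it has at most \<open>d + 1\<close> such
  splittings. Hence up to a bounded factor the class is counted by the binomial transform of the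
  number \<open>a n\<close> of permutations of length \<open>n\<close> without an increasing subsequence of length \<open>d + 1\<close>.

  The Robinson--Schensted correspondence turns \<open>a n\<close> into the sum of \<open>(f c)\<^sup>2\<close> over all partitions \<open>c\<close>
  of \<open>n\<close> into at most \<open>d\<close> parts, where \<open>f c\<close> counts standard tableaux, encoded as ballot words.
  With \<open>l i = c i + d - 1 - i\<close> one has \<open>f c = n! \<Prod>\<^bsub>i<j\<^esub> (l i - l j) / \<Prod>\<^bsub>i\<^esub> (l i)!\<close>, and estimating this product
  shows that \<open>a n\<close> is, up to bounded factors, \<open>d\<^bsup>2n\<^esup> / n\<^sup>r\<close> with \<open>r = (d\<^sup>2 - 1) / 2\<close>; the class then
  grows like \<open>(d\<^sup>2 + 1)\<^bsup>n\<^esup> / n\<^sup>r\<close>.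

  For odd \<open>d\<close> the exponent \<open>r\<close> is a positive integer. Rescale the generating function to radius of
  convergence 1. Passing from \<open>A(z)\<close> to \<open>(A(1) - A(z)) / (1 - z)\<close> preserves algebraicity and lowers the
  exponent by one, so one arrives at coefficients of order \<open>1 / n\<close>. That function grows like a
  logarithm at 1, which no nontrivial polynomial relation allows.
\<close>

section \<open>Robinson--Schensted insertion on ballot words\<close>

text \<open>Only bounds up to constant factors are needed, never an asymptotic constant, so every
  estimate is a product or telescoping inequality. With B = d (d - 1) / 2 and s = (d - 1) / 2, f c
  is n! / (n + B)! times a multinomial coefficient times a Vandermonde product. In the square, the
  first factor gives n^(-2 B), the squared Vandermonde product averaged over random words gives n^B,
  and the surplus multinomial coefficient is of order at most d^n / n^s. This leaves n^(-(B + s)),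
  and B + s = (d^2 - 1) / 2. Powers n^(-r) are replaced throughout by n! / (n + r)!, whose tail sums
  telescope and which passes exactly through binomial coefficients. For even d the exponent would be
  a half-integer, and such a singularity is compatible with algebraicity, so lowering the exponent
  could not end in a logarithm.\<close>

definition is_part :: "(nat \<Rightarrow> nat) \<Rightarrow> bool" where
  "is_part c \<longleftrightarrow> (\<forall>i. c (Suc i) \<le> c i)"

text \<open>
  A standard tableau is stored as the word of the rows of its entries, with the largest entry at the
  head of the list. Rows are numbered from 0. In \<open>row_ins x w\<close> the new entry has exactly \<open>x\<close> smaller
  ones, and bumping an entry out of row \<open>r\<close> replaces its letter \<open>r\<close> by \<open>r + 1\<close>; the second
  component is the row in which the shape grows.
\<close>

fun ballot :: "nat list \<Rightarrow> bool" where
  "ballot [] = True"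
| "ballot (y # ys) = (ballot ys \<and> is_part (count_list (y # ys)))"

fun row_ins :: "nat \<Rightarrow> nat list \<Rightarrow> nat list \<times> nat" where
  "row_ins x [] = ([0], 0)"
| "row_ins x (y # ys) =
     (if x > length ys then (0 # y # ys, 0)
      else let (zs, r) = row_ins x ys in if y = r then (Suc r # zs, Suc r) else (y # zs, r))"

text \<open>Reverse bumping, decided by the largest entry. If it ends row 0 and that row shrinks, it
  is the inserted entry itself; if it ends a shrinking row \<open>r > 0\<close>, it was bumped from
  row \<open>r - 1\<close>, so the smaller tableau is undone from there; in any other row it was not
  moved. The second component recovers \<open>x\<close>; the empty word gets a dummy value.\<close>

fun row_del :: "nat \<Rightarrow> nat list \<Rightarrow> nat list \<times> nat" where
  "row_del r [] = ([], 0)"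
| "row_del r (z # zs) =
     (if z = r then
        if r = 0 then (zs, length zs)
        else let (ys, x) = row_del (r - 1) zs in ((r - 1) # ys, x)
      else let (ys, x) = row_del r zs in (z # ys, x))"

lemma ballot_is_part: "ballot w \<Longrightarrow> is_part (count_list w)"
  by (cases w) (auto simp: is_part_def)

text \<open>Partitions are closed under pointwise maximum, and for \<open>i \<noteq> j\<close> the
  maximum of the two enlarged shapes contains both new cells.\<close>

lemma is_part_add:
  assumes "is_part c" "is_part (c(i := Suc (c i)))" "is_part (c(j := Suc (c j)))" "i \<noteq> j"
  shows "is_part (c(i := Suc (c i), j := Suc (c j)))"
  unfolding is_part_def
proof
  fix k
  show "(c(i := Suc (c i), j := Suc (c j))) (Suc k) \<le> (c(i := Suc (c i), j := Suc (c j))) k"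
    using assms(1)[unfolded is_part_def, rule_format, of k]
      assms(2)[unfolded is_part_def, rule_format, of k]
      assms(3)[unfolded is_part_def, rule_format, of k] assms(4)
    by (auto split: if_splits)
qed

lemma count_list_Cons: "count_list (y # ys) = (count_list ys)(y := Suc (count_list ys y))"
  by (auto simp: fun_eq_iff)

lemma row_ins_count:
  "row_ins x w = (w', r) \<Longrightarrow> count_list w' = (count_list w)(r := Suc (count_list w r))"
proof (induction w arbitrary: w' r)
  case (Cons y ys)
  obtain zs s where zs: "row_ins x ys = (zs, s)" by force
  have c: "count_list zs = (count_list ys)(s := Suc (count_list ys s))"
    using Cons.IH[OF zs] .
  show ?case using Cons.prems c zs by (auto simp: fun_eq_iff split: if_splits)
qed auto

lemma row_ins_length: "row_ins x w = (w', r) \<Longrightarrow> length w' = Suc (length w)"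
  by (induction w arbitrary: w' r) (auto split: if_splits prod.splits)

text \<open>By induction the smaller entries already form a tableau, so only the cell of the largest
  entry matters. Either this cell was just taken, in row \<open>s\<close>, and the entry moves to
  the end of row \<open>s + 1\<close>, or it is a different addable cell and
  \<open>is_part_add\<close> applies.\<close>

lemma row_ins_ballot:
  "ballot w \<Longrightarrow> row_ins x w = (w', r) \<Longrightarrow> ballot w'"
proof (induction w arbitrary: w' r)
  case Nil
  then show ?case by (auto simp: is_part_def)
next
  case (Cons y ys)
  have b: "ballot ys" and p: "is_part (count_list (y # ys))" using Cons.prems(1) by auto
  obtain zs s where zs: "row_ins x ys = (zs, s)" by force
  have bz: "ballot zs" using Cons.IH[OF b zs] .
  note c = row_ins_count[OF zs]
  note py = ballot_is_part[OF b] and pz = ballot_is_part[OF bz]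
  show ?case
  proof (cases "x > length ys")
    case True
    then have "w' = 0 # y # ys" using Cons.prems by simp
    moreover have "is_part (count_list (0 # y # ys))"
      using p unfolding is_part_def by (auto split: if_splits simp: le_Suc_eq)
    ultimately show ?thesis using Cons.prems(1) by simp
  next
    case nx: False
    show ?thesis
    proof (cases "y = s")
      case True
      then have "w' = Suc s # zs" using Cons.prems(2) nx zs by auto
      moreover have "is_part (count_list (Suc s # zs))"
        unfolding is_part_def
      proof
        fix i
        show "count_list (Suc s # zs) (Suc i) \<le> count_list (Suc s # zs) i"
          using pz[unfolded is_part_def, rule_format, of i] py[unfolded is_part_def, rule_format, of i] c
          by (auto split: if_splits)
      qed
      ultimately show ?thesis using bz by simp
    next
      case False
      then have "w' = y # zs" using Cons.prems nx zs by simp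
      moreover have "is_part (count_list (y # zs))"
        using is_part_add[OF py, of s y] pz p c False unfolding count_list_Cons by simp
      ultimately show ?thesis using bz by simp
    qed
  qed
qed

lemma row_del_row_ins:
  "x \<le> length w \<Longrightarrow> row_ins x w = (w', r) \<Longrightarrow> row_del r w' = (w, x)"
proof (induction w arbitrary: w' r)
  case (Cons y ys)
  obtain zs s where zs: "row_ins x ys = (zs, s)" by force
  show ?case
  proof (cases "x > length ys")
    case True
    then show ?thesis using Cons.prems by auto
  next
    case False
    then show ?thesis using Cons.prems Cons.IH[OF _ zs] zs by (auto split: if_splits)
  qed
qed auto

text \<open>The hypotheses on \<open>count_list w'\<close> say that row \<open>r\<close> ends in a
  removable corner. The recursive call needs the same for the tableau without its largest entry, in
  row \<open>r - 1\<close> if that entry was bumped; this is what \<open>pos\<close> and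
  \<open>pd\<close> establish.\<close>

lemma row_del_correct:
  assumes "ballot w'" "count_list w' r > 0" "is_part ((count_list w')(r := count_list w' r - 1))"
    "row_del r w' = (w, x)"
  shows "ballot w \<and> x \<le> length w \<and> row_ins x w = (w', r) \<and> length w' = Suc (length w)"
  using assms
proof (induction w' arbitrary: r w)
  case (Cons z zs)
  have b: "ballot zs" and p: "is_part (count_list (z # zs))" using Cons.prems(1) by auto
  have pz: "is_part (count_list zs)" using ballot_is_part[OF b] .
  let ?c = "count_list zs"
  have P: "\<And>i. ?c (Suc i) \<le> ?c i" using pz by (simp add: is_part_def)
  have Q: "\<And>i. count_list (z # zs) (Suc i) \<le> count_list (z # zs) i" using p by (simp only: is_part_def)
  have R: "\<And>i. ((count_list (z # zs))(r := count_list (z # zs) r - 1)) (Suc i)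
     \<le> ((count_list (z # zs))(r := count_list (z # zs) r - 1)) i"
    using Cons.prems(3) by (simp only: is_part_def)
  show ?case
  proof (cases "z = r")
    case True
    show ?thesis
    proof (cases "r = 0")
      case r0: True
      then have "w = zs" "x = length zs" using Cons.prems True by auto
      then show ?thesis using b True r0 by (cases zs) auto
    next
      case False
      obtain ys x' where ys: "row_del (r - 1) zs = (ys, x')" by force
      have w: "w = (r - 1) # ys" "x' = x" using Cons.prems True False ys by auto
      obtain t where t: "r = Suc t" using False by (cases r) auto
      have pos: "?c (r - 1) > 0" using Q[of t] True t by simp
      have pd: "is_part (?c(r - 1 := ?c (r - 1) - 1))"
        unfolding is_part_def
      proof
        fix i
        show "(?c(r - 1 := ?c (r - 1) - 1)) (Suc i) \<le> (?c(r - 1 := ?c (r - 1) - 1)) i"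
          using P[of i] Q[of i] True t by (auto split: if_splits)
      qed
      have IH: "ballot ys \<and> x \<le> length ys \<and> row_ins x ys = (zs, r - 1) \<and> length zs = Suc (length ys)"
        using Cons.IH[OF b pos pd] ys w(2) by simp
      then have c: "?c = (count_list ys)(r - 1 := Suc (count_list ys (r - 1)))"
        using row_ins_count by blast
      have "ballot w" using IH pz c unfolding w(1) by (simp add: count_list_Cons)
      then show ?thesis using IH w True t by auto
    qed
  next
    case False
    obtain ys x' where ys: "row_del r zs = (ys, x')" by force
    have w: "w = z # ys" "x' = x" using Cons.prems False ys by auto
    have pos: "?c r > 0" using Cons.prems(2) False by simp
    have pd: "is_part (?c(r := ?c r - 1))"
      unfolding is_part_def
    proof
      fix i
      show "(?c(r := ?c r - 1)) (Suc i) \<le> (?c(r := ?c r - 1)) i"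
        using P[of i] Q[of i] R[of i] pos False by (auto split: if_splits)
    qed
    have IH: "ballot ys \<and> x \<le> length ys \<and> row_ins x ys = (zs, r) \<and> length zs = Suc (length ys)"
      using Cons.IH[OF b pos pd] ys w(2) by simp
    then have c: "?c = (count_list ys)(r := Suc (count_list ys r))"
      using row_ins_count by blast
    have "count_list (z # ys) = (count_list (z # zs))(r := count_list (z # zs) r - 1)"
      using c False by (auto simp: fun_eq_iff)
    then have "is_part (count_list (z # ys))" using Cons.prems(3) by (simp only:)
    then have "ballot w" using IH unfolding w(1) by simp
    then show ?thesis using IH w False by auto
  qed
qed auto

text \<open>The suffix \<open>drop (length w - x) w\<close> is the subtableau of the
  \<open>x\<close> entries below the new one. The new entry goes into row 0 right after those of
  them that lie there: it extends the row if nothing larger follows and replaces an entry otherwise.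
  The disjunction also records whether the shape grows in row 0, which the induction needs.\<close>

lemma row_ins_zeros:
  assumes "ballot w" "x \<le> length w" "row_ins x w = (w', r)"
  shows "count_list w' 0 = max (count_list w 0) (Suc (count_list (drop (length w - x) w) 0))"
proof -
  have "(r = 0 \<and> count_list w' 0 = Suc (count_list w 0) \<and> count_list (drop (length w - x) w) 0 = count_list w 0)
      \<or> (r > 0 \<and> count_list w' 0 = count_list w 0 \<and> count_list (drop (length w - x) w) 0 < count_list w 0)"
    using assms
  proof (induction w arbitrary: w' r)
    case (Cons y ys)
    obtain zs s where zs: "row_ins x ys = (zs, s)" by force
    show ?case
    proof (cases "x > length ys")
      case True
      then show ?thesis using Cons.prems by auto
    next
      case False
      then have "Suc (length ys) - x = Suc (length ys - x)" by simp
      then show ?thesis using Cons.prems Cons.IH[OF _ _ zs] zs False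
        by (auto split: if_splits)
    qed
  qed auto
  then show ?thesis by auto
qed

text \<open>Dropping from the head forgets the largest entries, and larger entries never influence
  the movement of smaller ones. The bound on \<open>i\<close> ensures that only entries above the
  new one are forgotten.\<close>

lemma row_ins_drop:
  "x \<le> length w \<Longrightarrow> i \<le> length w - x \<Longrightarrow> fst (row_ins x (drop i w)) = drop i (fst (row_ins x w))"
proof (induction w arbitrary: i)
  case (Cons y ys)
  show ?case
  proof (cases i)
    case (Suc j)
    then have "j \<le> length ys - x" "\<not> x > length ys" using Cons.prems by auto
    then show ?thesis using Cons.IH[of j] Suc by (auto split: prod.splits if_splits)
  qed simp
qed simp

text \<open>Entries below the new one never move. The shift from \<open>i\<close> to
  \<open>i - 1\<close> accounts for the new entry, which is itself among the dropped ones.\<close>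

lemma row_ins_drop_after:
  "x \<le> length w \<Longrightarrow> i > length w - x \<Longrightarrow> drop i (fst (row_ins x w)) = drop (i - 1) w"
proof (induction w arbitrary: i)
  case (Cons y ys)
  obtain j where j: "i = Suc j" using Cons.prems by (cases i) auto
  show ?case
  proof (cases "x > length ys")
    case True
    then show ?thesis using j by simp
  next
    case False
    then have "j > length ys - x" using Cons.prems j by auto
    then show ?thesis using Cons.IH[of j] j False by (cases j) (auto split: prod.splits if_splits)
  qed
qed auto

definition ballot_pairs :: "nat \<Rightarrow> (nat list \<times> nat list) set" where
  "ballot_pairs n = {(w, q). ballot w \<and> ballot q \<and> length w = n \<and> length q = n \<and> count_list w = count_list q}"

text \<open>The second word is the recording tableau.\<close>

definition rsk_step :: "(nat list \<times> nat list) \<times> nat \<Rightarrow> nat list \<times> nat list" where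
  "rsk_step = (\<lambda>((w, q), x). (fst (row_ins x w), snd (row_ins x w) # q))"

lemma rsk_step_bij: "bij_betw rsk_step (ballot_pairs n \<times> {..n}) (ballot_pairs (Suc n))"
proof (rule bij_betw_byWitness[where f' = "\<lambda>(w', q'). (((fst (row_del (hd q') w')), tl q'), snd (row_del (hd q') w'))"])
  show "rsk_step ` (ballot_pairs n \<times> {..n}) \<subseteq> ballot_pairs (Suc n)"
  proof (rule image_subsetI, clarify)
    fix w q x assume "(w, q) \<in> ballot_pairs n" "x \<le> n"
    then have h: "ballot w" "ballot q" "length w = n" "length q = n" "count_list w = count_list q"
      by (auto simp: ballot_pairs_def)
    obtain w' r where r: "row_ins x w = (w', r)" by force
    have "ballot w'" using row_ins_ballot[OF h(1) r] .
    moreover have "count_list w' = count_list (r # q)"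
      using row_ins_count[OF r] h(5) by (simp add: count_list_Cons)
    moreover have "ballot (r # q)" using h calculation ballot_is_part[of w'] by simp
    ultimately show "rsk_step ((w, q), x) \<in> ballot_pairs (Suc n)"
      using h r row_ins_length[OF r] by (simp add: ballot_pairs_def rsk_step_def)
  qed
  have key: "\<exists>w x. row_del r w' = (w, x) \<and> ballot w \<and> ballot q \<and> x \<le> n \<and> length w = n \<and> length q = n \<and>
      count_list w = count_list q \<and> row_ins x w = (w', r)"
    if "(w', r # q) \<in> ballot_pairs (Suc n)" for w' r q
  proof -
    obtain w x where w: "row_del r w' = (w, x)" by force
    have h: "ballot w'" "ballot q" "length w' = Suc n" "length q = n" "count_list w' = count_list (r # q)"
      using that by (auto simp: ballot_pairs_def)
    have e: "(count_list w')(r := count_list w' r - 1) = count_list q"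
      unfolding h(5) by (auto simp: fun_eq_iff)
    have "ballot w \<and> x \<le> length w \<and> row_ins x w = (w', r) \<and> length w' = Suc (length w)"
      using row_del_correct[OF h(1) _ _ w] e h(5) ballot_is_part[OF h(2)] by auto
    moreover from this have "count_list w = count_list q"
      using row_ins_count[of x w w' r] e by auto
    ultimately show ?thesis using w h by auto
  qed
  have ne: "\<exists>r q. q' = r # q" if "(w', q') \<in> ballot_pairs (Suc n)" for w' q'
    using that by (cases q') (auto simp: ballot_pairs_def)
  show "(\<lambda>(w', q'). ((fst (row_del (hd q') w'), tl q'), snd (row_del (hd q') w'))) ` ballot_pairs (Suc n) \<subseteq> ballot_pairs n \<times> {..n}"
  proof safe
    fix w' q' assume a: "(w', q') \<in> ballot_pairs (Suc n)"
    then obtain r q where "q' = r # q" using ne by blast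
    then show "(fst (row_del (hd q') w'), tl q') \<in> ballot_pairs n" "snd (row_del (hd q') w') \<le> n"
      using key[of w' r q] a by (auto simp: ballot_pairs_def)
  qed
  show "\<forall>a\<in>ballot_pairs (Suc n). rsk_step ((\<lambda>(w', q'). ((fst (row_del (hd q') w'), tl q'), snd (row_del (hd q') w'))) a) = a"
  proof safe
    fix w' q' assume a: "(w', q') \<in> ballot_pairs (Suc n)"
    then obtain r q where "q' = r # q" using ne by blast
    then show "rsk_step ((fst (row_del (hd q') w'), tl q'), snd (row_del (hd q') w')) = (w', q')"
      using key[of w' r q] a by (auto simp: rsk_step_def)
  qed
  show "\<forall>a\<in>ballot_pairs n \<times> {..n}. (\<lambda>(w', q'). ((fst (row_del (hd q') w'), tl q'), snd (row_del (hd q') w'))) (rsk_step a) = a"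
  proof safe
    fix w q x assume "(w, q) \<in> ballot_pairs n" "x \<le> n"
    then show "(\<lambda>(w', q'). ((fst (row_del (hd q') w'), tl q'), snd (row_del (hd q') w'))) (rsk_step ((w, q), x)) = ((w, q), x)"
      using row_del_row_ins[of x w "fst (row_ins x w)" "snd (row_ins x w)"]
      by (auto simp: rsk_step_def ballot_pairs_def)
  qed
qed

section \<open>Decreasing subsequences and the first row of the insertion tableau\<close>

definition has_dec :: "nat list \<Rightarrow> nat \<Rightarrow> bool" where
  "has_dec p l \<longleftrightarrow> (\<exists>xs. subseq xs p \<and> sorted_wrt (>) xs \<and> length xs = l)"

lemma set_subseq: "subseq xs ys \<Longrightarrow> set xs \<subseteq> set ys"
  by (auto elim: list_emb_set)

text \<open>A decreasing subsequence through the maximum must start there, so its remainder lies in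
  \<open>v\<close>.\<close>

lemma has_dec_insert_max:
  assumes "\<forall>y\<in>set (u @ v). y < n"
  shows "has_dec (u @ n # v) l \<longleftrightarrow> has_dec (u @ v) l \<or> (\<exists>l'. l = Suc l' \<and> has_dec v l')"
proof
  assume "has_dec (u @ n # v) l"
  then obtain xs where xs: "subseq xs (u @ n # v)" "sorted_wrt (>) xs" "length xs = l"
    by (auto simp: has_dec_def)
  then obtain a b where ab: "xs = a @ b" "subseq a u" "subseq b (n # v)"
    by (auto simp: subseq_append_iff)
  show "has_dec (u @ v) l \<or> (\<exists>l'. l = Suc l' \<and> has_dec v l')"
  proof (cases "subseq b v")
    case True
    then have "subseq xs (u @ v)" using ab by (auto intro: list_emb_append_mono)
    then show ?thesis using xs by (auto simp: has_dec_def)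
  next
    case False
    then obtain b' where b': "b = n # b'" "subseq b' v"
      using ab(3) by (cases b) (auto split: if_splits)
    have "a = []"
    proof (rule ccontr)
      assume "a \<noteq> []"
      then obtain y where "y \<in> set a" by fastforce
      then have "y > n" "y \<in> set u" using xs(2) ab b' set_subseq by (auto simp: sorted_wrt_append)
      then show False using assms by (metis UnCI less_asym set_append)
    qed
    then have "l = Suc (length b')" "sorted_wrt (>) b'" using xs ab b' by auto
    then show ?thesis using b' by (auto simp: has_dec_def)
  qed
next
  assume "has_dec (u @ v) l \<or> (\<exists>l'. l = Suc l' \<and> has_dec v l')"
  then show "has_dec (u @ n # v) l"
  proof
    assume "has_dec (u @ v) l"
    moreover have "subseq (u @ v) (u @ n # v)" by (simp add: subseq_append' list_emb_Cons)
    ultimately show ?thesis unfolding has_dec_def using subseq_order.trans by blast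
  next
    assume "\<exists>l'. l = Suc l' \<and> has_dec v l'"
    then obtain xs where xs: "subseq xs v" "sorted_wrt (>) xs" "l = Suc (length xs)"
      by (auto simp: has_dec_def)
    have "subseq (n # xs) (u @ n # v)" using xs by (intro subseq_drop_many) auto
    moreover have "sorted_wrt (>) (n # xs)" using xs set_subseq[OF xs(1)] assms by auto
    ultimately show ?thesis unfolding has_dec_def using xs(3) by (intro exI[of _ "n # xs"]) auto
  qed
qed

text \<open>Permutations grow by their values: the new maximum is placed with \<open>x\<close>
  entries to its right. As an insertion sequence, the value is the time and the position counted
  from the right is the inserted number, so \<open>x\<close> is the number of smaller entries in
  \<open>row_ins\<close> and nothing has to be relabelled. Increasing subsequences of inserted
  numbers are decreasing subsequences of the permutation, and forgetting the \<open>i\<close>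
  largest tableau entries means dropping the first \<open>i\<close> positions.\<close>

definition perm_ins :: "nat list \<times> nat \<Rightarrow> nat list" where
  "perm_ins = (\<lambda>(p, x). take (length p - x) p @ length p # drop (length p - x) p)"

text \<open>Injectivity comes from the unique occurrence of the maximum, surjectivity from counting
  both sides.\<close>

lemma perm_ins_bij:
  "bij_betw perm_ins (permutations_of_set {..<n} \<times> {..n}) (permutations_of_set {..<Suc n})"
proof -
  have inj: "inj_on perm_ins (permutations_of_set {..<n} \<times> {..n})"
  proof (rule inj_onI, clarify)
    fix p x q y assume p: "p \<in> permutations_of_set {..<n}" "x \<le> n" and q: "q \<in> permutations_of_set {..<n}" "y \<le> n"
      and e: "perm_ins (p, x) = perm_ins (q, y)"
    have l: "length p = n" "length q = n" using p q length_finite_permutations_of_set by fastforce+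
    have s: "set p = {..<n}" "set q = {..<n}" using p q by (auto simp: permutations_of_set_def)
    have "n \<notin> set (take (n - x) p)" "n \<notin> set (take (n - y) q)"
      "n \<notin> set (drop (n - x) p)" "n \<notin> set (drop (n - y) q)"
      using s set_take_subset[of "n-x" p] set_take_subset[of "n-y" q]
        set_drop_subset[of "n-x" p] set_drop_subset[of "n-y" q] by auto
    then have t: "take (n - x) p = take (n - y) q" "drop (n - x) p = drop (n - y) q"
      using e l by (auto simp: perm_ins_def append_Cons_eq_iff)
    then have "length (take (n - x) p) = length (take (n - y) q)" by simp
    then have "x = y" using p q l by simp
    moreover have "p = q" using t append_take_drop_id by metis
    ultimately show "p = q \<and> x = y" by simp
  qed
  have sub: "perm_ins ` (permutations_of_set {..<n} \<times> {..n}) \<subseteq> permutations_of_set {..<Suc n}"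
  proof (rule image_subsetI, clarify)
    fix p x assume p: "p \<in> permutations_of_set {..<n}" "x \<le> n"
    then have l: "length p = n" "set p = {..<n}" "distinct p"
      using length_finite_permutations_of_set[OF p(1)] by (auto simp: permutations_of_set_def)
    have "mset (perm_ins (p, x)) = mset (n # p)"
      using l by (simp add: perm_ins_def) (metis append_take_drop_id mset_append)
    then have "set (perm_ins (p, x)) = set (n # p)" "distinct (perm_ins (p, x)) = distinct (n # p)"
      by (metis mset_eq_setD, metis mset_eq_imp_distinct_iff)
    then show "perm_ins (p, x) \<in> permutations_of_set {..<Suc n}"
      using l by (auto simp: permutations_of_set_def)
  qed
  have "card (perm_ins ` (permutations_of_set {..<n} \<times> {..n})) = card (permutations_of_set {..<Suc n})"
    by (subst card_image[OF inj]) (simp add: card_cartesian_product algebra_simps)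
  then have "perm_ins ` (permutations_of_set {..<n} \<times> {..n}) = permutations_of_set {..<Suc n}"
    using sub by (intro card_subset_eq) auto
  then show ?thesis using inj by (simp add: bij_betw_def)
qed

text \<open>The first row of the insertion tableau records the lengths of longest decreasing subsequences of all suffixes.\<close>

definition rsk_related :: "nat list \<Rightarrow> nat list \<Rightarrow> bool" where
  "rsk_related p w \<longleftrightarrow> length p = length w \<and> (\<forall>i l. has_dec (drop i p) l \<longleftrightarrow> l \<le> count_list (drop i w) 0)"

lemma ballot_drop: "ballot w \<Longrightarrow> ballot (drop i w)"
  by (induction w arbitrary: i) (auto simp: drop_Cons split: nat.splits)

text \<open>For a suffix that contains the new maximum, \<open>has_dec_insert_max\<close> and
  \<open>row_ins_zeros\<close>, applied to the restricted tableau, produce the same maximum of two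
  lengths. Suffixes behind the maximum are unchanged, and so are the corresponding
  subtableaux.\<close>

lemma rsk_related_step:
  assumes "rsk_related p w" "set p = {..<length p}" "ballot w" "x \<le> length p"
  shows "rsk_related (perm_ins (p, x)) (fst (row_ins x w))"
proof -
  define n where "n = length p"
  have n: "length w = n" and R: "\<And>i l. has_dec (drop i p) l \<longleftrightarrow> l \<le> count_list (drop i w) 0"
    using assms(1) by (auto simp: rsk_related_def n_def)
  obtain w' r where w': "row_ins x w = (w', r)" by force
  have len: "length w' = Suc n" using row_ins_length[OF w'] n by simp
  have pi: "perm_ins (p, x) = take (n - x) p @ n # drop (n - x) p" by (simp add: perm_ins_def n_def)
  have "has_dec (drop i (perm_ins (p, x))) l \<longleftrightarrow> l \<le> count_list (drop i w') 0" for i l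
  proof (cases "i \<le> n - x")
    case True
    have d: "drop i (perm_ins (p, x)) = drop i (take (n - x) p) @ n # drop (n - x) p"
      using True by (simp add: pi n_def)
    have d2: "drop i (take (n - x) p) @ drop (n - x) p = drop i p"
      using True by (metis append_take_drop_id drop_append drop_drop drop_eq_Nil2 drop_take
          le_add_diff_inverse2 n_def)
    have lt: "\<forall>y\<in>set (drop i (take (n - x) p) @ drop (n - x) p). y < n"
      unfolding d2 using assms(2) set_drop_subset[of i p] n_def by auto
    have "has_dec (drop i (perm_ins (p, x))) l \<longleftrightarrow>
        has_dec (drop i p) l \<or> (\<exists>l'. l = Suc l' \<and> has_dec (drop (n - x) p) l')"
      unfolding d using has_dec_insert_max[OF lt] d2 by simp
    also have "\<dots> \<longleftrightarrow> l \<le> count_list (drop i w) 0 \<or> (\<exists>l'. l = Suc l' \<and> l' \<le> count_list (drop (n - x) w) 0)"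
      using R by simp
    also have "\<dots> \<longleftrightarrow> l \<le> max (count_list (drop i w) 0) (Suc (count_list (drop (n - x) w) 0))"
      by (cases l) auto
    also have "\<dots> \<longleftrightarrow> l \<le> count_list (drop i w') 0"
    proof -
      have "x \<le> length (drop i w)" using assms(4) True n n_def by auto
      moreover have "row_ins x (drop i w) = (drop i w', snd (row_ins x (drop i w)))"
        using row_ins_drop[of x w i] True assms(4) n n_def w' by (metis fst_conv prod.collapse)
      ultimately have "count_list (drop i w') 0 = max (count_list (drop i w) 0)
          (Suc (count_list (drop (length (drop i w) - x) (drop i w)) 0))"
        using row_ins_zeros[OF ballot_drop[OF assms(3)]] by blast
      moreover have "drop (length (drop i w) - x) (drop i w) = drop (n - x) w"
        using True n assms(4) n_def by simp
      ultimately show ?thesis by simp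
    qed
    finally show ?thesis .
  next
    case False
    then obtain t where t: "i = Suc (n - x + t)" by (metis less_iff_Suc_add not_le)
    have "drop i (perm_ins (p, x)) = drop (i - 1) p"
      using assms(4) by (simp add: pi t n_def add.commute)
    moreover have "drop i w' = drop (i - 1) w"
      using row_ins_drop_after[of x w i] False assms(4) n n_def w' by simp
    ultimately show ?thesis using R by simp
  qed
  then show ?thesis using len w' assms(4) by (simp add: rsk_related_def perm_ins_def n_def)
qed

theorem rsk_correspondence:
  "\<exists>\<Phi>. bij_betw \<Phi> (permutations_of_set {..<n}) (ballot_pairs n) \<and>
     (\<forall>p\<in>permutations_of_set {..<n}. rsk_related p (fst (\<Phi> p)))"
proof (induction n)
  case 0
  have 0: "ballot_pairs 0 = {([], [])}" by (auto simp: ballot_pairs_def)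
  have "bij_betw (\<lambda>_. ([], [])) (permutations_of_set {..<0::nat}) (ballot_pairs 0)"
    unfolding 0 by (rule bij_betwI[where g = "\<lambda>_. []"]) (auto simp: lessThan_0)
  moreover have "rsk_related [] []"
    by (auto simp: rsk_related_def has_dec_def dest: list_emb_length)
  ultimately show ?case by (intro exI[of _ "\<lambda>_. ([], [])"]) (auto simp: lessThan_0)
next
  case (Suc n)
  let ?P = "\<lambda>n. permutations_of_set {..<n::nat}"
  obtain \<Phi> where \<Phi>: "bij_betw \<Phi> (?P n) (ballot_pairs n)" "\<forall>p\<in>?P n. rsk_related p (fst (\<Phi> p))"
    using Suc.IH by auto
  have b: "bij_betw (map_prod \<Phi> id) (?P n \<times> {..n}) (ballot_pairs n \<times> {..n})"
    using \<Phi>(1) by (intro bij_betw_map_prod) auto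
  define \<Psi> where "\<Psi> = rsk_step \<circ> (map_prod \<Phi> id \<circ> inv_into (?P n \<times> {..n}) perm_ins)"
  have i: "bij_betw (inv_into (?P n \<times> {..n}) perm_ins) (?P (Suc n)) (?P n \<times> {..n})"
    by (rule bij_betw_inv_into) (rule perm_ins_bij)
  have "bij_betw (map_prod \<Phi> id \<circ> inv_into (?P n \<times> {..n}) perm_ins) (?P (Suc n)) (ballot_pairs n \<times> {..n})"
    using i b by (rule bij_betw_trans)
  then have "bij_betw \<Psi> (?P (Suc n)) (ballot_pairs (Suc n))"
    unfolding \<Psi>_def using rsk_step_bij by (rule bij_betw_trans)
  moreover have "rsk_related p' (fst (\<Psi> p'))" if "p' \<in> ?P (Suc n)" for p'
  proof -
    have "\<exists>p x. p \<in> ?P n \<and> x \<le> n \<and> p' = perm_ins (p, x)"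
    proof -
      have "p' \<in> perm_ins ` (?P n \<times> {..n})"
        using that perm_ins_bij[of n] by (simp only: bij_betw_def)
      then show ?thesis by (elim imageE SigmaE) (auto simp only: atMost_iff)
    qed
    then obtain p x where px: "p \<in> ?P n" "x \<le> n" "p' = perm_ins (p, x)" by blast
    obtain w q where wq: "\<Phi> p = (w, q)" by force
    have "inv_into (?P n \<times> {..n}) perm_ins p' = (p, x)"
      unfolding px(3) using px perm_ins_bij[of n] by (intro inv_into_f_f) (auto simp: bij_betw_def)
    then have "\<Psi> p' = rsk_step ((w, q), x)" by (simp add: \<Psi>_def wq)
    then have e: "fst (\<Psi> p') = fst (row_ins x w)" by (simp add: rsk_step_def)
    have "(w, q) \<in> ballot_pairs n" using \<Phi>(1) px(1) wq by (metis bij_betwE)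
    then have "ballot w" by (simp add: ballot_pairs_def)
    moreover have "rsk_related p w" using \<Phi>(2) px(1) wq by force
    moreover have "set p = {..<length p}" "x \<le> length p"
      using px length_finite_permutations_of_set[OF px(1)] by (auto simp: permutations_of_set_def)
    ultimately show ?thesis using rsk_related_step e px(3) by simp
  qed
  ultimately show ?case by blast
qed

text \<open>Records the columns of the entries instead of the rows.\<close>

fun transpose_word :: "nat list \<Rightarrow> nat list" where
  "transpose_word [] = []"
| "transpose_word (y # ys) = count_list ys y # transpose_word ys"

lemma is_part_antimono: "is_part c \<Longrightarrow> i \<le> j \<Longrightarrow> c j \<le> c i"
  unfolding is_part_def by (metis lift_Suc_antimono_le)

lemma length_transpose_word [simp]: "length (transpose_word w) = length w"
  by (induction w) auto

text \<open>The count functions of a word and of its transpose are conjugate partitions. In the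
  induction the new cell lies in row \<open>y\<close> and column \<open>c y\<close>. The height of
  that column was \<open>y\<close> before, so both counts gain the same cell.\<close>

lemma transpose_word_count:
  "ballot w \<Longrightarrow> i < count_list (transpose_word w) j \<longleftrightarrow> j < count_list w i"
proof (induction w arbitrary: i j)
  case (Cons y ys)
  define c where "c = count_list ys"
  have IH: "\<And>i j. i < count_list (transpose_word ys) j \<longleftrightarrow> j < c i"
    using Cons by (auto simp: c_def)
  have b: "ballot ys" "is_part (count_list (y # ys))" using Cons.prems by auto
  have hi: "c i \<le> c y" if "i \<ge> y" for i
    using is_part_antimono[OF ballot_is_part[OF b(1)] that] by (simp add: c_def)
  have lo: "c y < c i" if "i < y" for i
    using is_part_antimono[OF b(2), of i y] that by (simp add: c_def)
  have *: "count_list (transpose_word ys) (c y) = y"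
    using IH[of _ "c y"] hi lo by (metis leD leI linorder_neqE_nat order_refl)
  show ?case
  proof (cases "j = c y")
    case True
    then have "i < count_list (transpose_word (y # ys)) j \<longleftrightarrow> i \<le> y" using * by (auto simp: c_def)
    also have "\<dots> \<longleftrightarrow> j < count_list (y # ys) i"
      using True hi[of i] lo[of i] by (cases i y rule: linorder_cases) (auto simp: c_def[symmetric])
    finally show ?thesis .
  next
    case False
    then show ?thesis using IH[of i j] by (auto simp: c_def)
  qed
qed auto

lemma nat_eqI_less: "(\<And>i::nat. i < a \<longleftrightarrow> i < b) \<Longrightarrow> a = b"
  by (metis linorder_neqE_nat order_less_irrefl)

lemma transpose_word_ballot: "ballot w \<Longrightarrow> ballot (transpose_word w)"
proof (induction w)
  case (Cons y ys)
  have "is_part (count_list (transpose_word (y # ys)))"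
    unfolding is_part_def
  proof
    fix i show "count_list (transpose_word (y # ys)) (Suc i) \<le> count_list (transpose_word (y # ys)) i"
      using transpose_word_count[OF Cons.prems] by (metis Suc_lessD leI order_less_irrefl)
  qed
  then show ?case using Cons by simp
qed auto

lemma transpose_word_idem: "ballot w \<Longrightarrow> transpose_word (transpose_word w) = w"
proof (induction w)
  case (Cons y ys)
  have b: "ballot ys" "is_part (count_list (y # ys))" using Cons.prems by auto
  have "count_list (transpose_word ys) (count_list ys y) = y"
  proof (rule nat_eqI_less)
    fix i
    have "i < count_list (transpose_word ys) (count_list ys y) \<longleftrightarrow> count_list ys y < count_list ys i"
      using transpose_word_count[OF b(1)] .
    also have "\<dots> \<longleftrightarrow> i < y"
      using is_part_antimono[OF ballot_is_part[OF b(1)], of y i] is_part_antimono[OF b(2), of i y]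
      by (cases "i < y") auto
    finally show "i < count_list (transpose_word ys) (count_list ys y) \<longleftrightarrow> i < y" .
  qed
  then show ?case using Cons.IH b by simp
qed auto

lemma transpose_word_content:
  assumes "ballot w" "ballot q"
  shows "count_list (transpose_word w) = count_list (transpose_word q) \<longleftrightarrow> count_list w = count_list q"
proof -
  have "count_list (transpose_word w) = count_list (transpose_word q)" if "ballot w" "ballot q" "count_list w = count_list q" for w q
  proof
    fix j show "count_list (transpose_word w) j = count_list (transpose_word q) j"
      by (rule nat_eqI_less) (simp add: transpose_word_count that)
  qed
  from this[of w q] this[of "transpose_word w" "transpose_word q"] show ?thesis
    using assms transpose_word_ballot transpose_word_idem by metis
qed

text \<open>The letters of the transposed word are the indices of the nonempty columns, which are
  exactly the numbers below the length of row 0.\<close>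

lemma transpose_word_letters:
  assumes "ballot w"
  shows "set (transpose_word w) \<subseteq> {..<d} \<longleftrightarrow> count_list w 0 \<le> d"
proof -
  have "j \<in> set (transpose_word w) \<longleftrightarrow> j < count_list w 0" for j
    using transpose_word_count[OF assms, of 0 j] by (simp add: count_list_0_iff flip: neq0_conv)
  then have "set (transpose_word w) = {..<count_list w 0}" by auto
  then show ?thesis by simp
qed

section \<open>Permutations without long decreasing subsequences as pairs of tableaux\<close>

definition partitions :: "nat \<Rightarrow> nat \<Rightarrow> (nat \<Rightarrow> nat) set" where
  "partitions d n = {c. is_part c \<and> (\<forall>i\<ge>d. c i = 0) \<and> (\<Sum>i<d. c i) = n}"

definition ballot_words :: "(nat \<Rightarrow> nat) \<Rightarrow> nat list set" where
  "ballot_words c = {w. ballot w \<and> count_list w = c}"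

lemma length_eq_sum_count_list:
  fixes w :: "nat list"
  assumes "set w \<subseteq> {..<d}"
  shows "length w = (\<Sum>i<d. count_list w i)"
  using sum_count_set[OF assms finite_lessThan] by simp

lemma finite_partitions [simp]: "finite (partitions d n)"
proof -
  have "partitions d n \<subseteq> {c. \<forall>i. (i \<in> {..<d} \<longrightarrow> c i \<in> {..n}) \<and> (i \<notin> {..<d} \<longrightarrow> c i = 0)}"
  proof
    fix c assume c: "c \<in> partitions d n"
    then have "c i \<le> n" if "i < d" for i
      using member_le_sum[of i "{..<d}" c] that by (simp add: partitions_def)
    then show "c \<in> {c. \<forall>i. (i \<in> {..<d} \<longrightarrow> c i \<in> {..n}) \<and> (i \<notin> {..<d} \<longrightarrow> c i = 0)}"
      using c by (simp add: partitions_def)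
  qed
  then show ?thesis by (rule finite_subset) (rule finite_set_of_finite_funs, simp_all)
qed

lemma finite_ballot_words:
  assumes "c \<in> partitions d n"
  shows "finite (ballot_words c)"
proof -
  have "ballot_words c \<subseteq> {w. set w \<subseteq> {..<d} \<and> length w = n}"
  proof
    fix w assume "w \<in> ballot_words c"
    then have w: "count_list w = c" by (simp add: ballot_words_def)
    then have "set w \<subseteq> {..<d}" using assms unfolding partitions_def mem_Collect_eq
      by (meson count_list_0_iff lessThan_iff not_le subsetI)
    then show "w \<in> {w. set w \<subseteq> {..<d} \<and> length w = n}"
      using length_eq_sum_count_list[of w d] assms w by (simp add: partitions_def)
  qed
  then show ?thesis by (rule finite_subset) (simp add: finite_lists_length_eq)
qed

text \<open>Under the correspondence the condition says that row 0 has at most \<open>d\<close>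
  cells. Transposing both tableaux turns this into at most \<open>d\<close> rows, so that shapes
  have a fixed number of parameters while \<open>n\<close> grows.\<close>

lemma card_no_long_dec:
  "card {p \<in> permutations_of_set {..<n}. \<not> has_dec p (Suc d)} = (\<Sum>c\<in>partitions d n. card (ballot_words c) ^ 2)"
proof -
  obtain \<Phi> where \<Phi>: "bij_betw \<Phi> (permutations_of_set {..<n}) (ballot_pairs n)"
    "\<forall>p\<in>permutations_of_set {..<n}. rsk_related p (fst (\<Phi> p))"
    using rsk_correspondence by blast
  have dec: "has_dec p (Suc d) \<longleftrightarrow> \<not> count_list (fst (\<Phi> p)) 0 \<le> d" if "p \<in> permutations_of_set {..<n}" for p
    using \<Phi>(2)[rule_format, OF that, unfolded rsk_related_def, THEN conjunct2, rule_format, of 0 "Suc d"] by auto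
  have "bij_betw \<Phi> {p \<in> permutations_of_set {..<n}. \<not> has_dec p (Suc d)}
      {wq \<in> ballot_pairs n. count_list (fst wq) 0 \<le> d}"
    unfolding bij_betw_def
  proof
    show "inj_on \<Phi> {p \<in> permutations_of_set {..<n}. \<not> has_dec p (Suc d)}"
      using \<Phi>(1) by (auto simp: bij_betw_def inj_on_def)
    have "ballot_pairs n = \<Phi> ` permutations_of_set {..<n}" using \<Phi>(1) by (simp add: bij_betw_def)
    then show "\<Phi> ` {p \<in> permutations_of_set {..<n}. \<not> has_dec p (Suc d)} =
        {wq \<in> ballot_pairs n. count_list (fst wq) 0 \<le> d}" using dec by auto
  qed
  then have "card {p \<in> permutations_of_set {..<n}. \<not> has_dec p (Suc d)} =
      card {wq \<in> ballot_pairs n. count_list (fst wq) 0 \<le> d}" by (rule bij_betw_same_card)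
  also have "\<dots> = card (\<Union>c\<in>partitions d n. ballot_words c \<times> ballot_words c)"
  proof (rule bij_betw_same_card[of "map_prod transpose_word transpose_word"],
      rule bij_betw_byWitness[where f' = "map_prod transpose_word transpose_word"])
    let ?A = "{wq \<in> ballot_pairs n. count_list (fst wq) 0 \<le> d}"
    let ?B = "\<Union>c\<in>partitions d n. ballot_words c \<times> ballot_words c"
    have B: "(w, q) \<in> ?B \<longleftrightarrow> ballot w \<and> ballot q \<and> count_list w = count_list q \<and> set w \<subseteq> {..<d} \<and> length w = n \<and> length q = n" for w q
    proof
      assume "(w, q) \<in> ?B"
      then have h: "ballot w" "ballot q" "count_list w = count_list q" "\<forall>i\<ge>d. count_list w i = 0" "(\<Sum>i<d. count_list w i) = n"
        by (auto simp: ballot_words_def partitions_def)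
      then have "\<forall>i\<ge>d. count_list q i = 0" by simp
      then have s: "set w \<subseteq> {..<d}" "set q \<subseteq> {..<d}"
        using h(4) by (meson count_list_0_iff lessThan_iff not_le subsetI)+
      then show "ballot w \<and> ballot q \<and> count_list w = count_list q \<and> set w \<subseteq> {..<d} \<and> length w = n \<and> length q = n"
        using h length_eq_sum_count_list[OF s(1)] length_eq_sum_count_list[OF s(2)] by simp
    next
      assume h: "ballot w \<and> ballot q \<and> count_list w = count_list q \<and> set w \<subseteq> {..<d} \<and> length w = n \<and> length q = n"
      then have "\<forall>i\<ge>d. count_list w i = 0" by (meson count_list_0_iff lessThan_iff not_le subsetD)
      then have "count_list w \<in> partitions d n"
        using h length_eq_sum_count_list[of w d] ballot_is_part[of w] by (simp add: partitions_def)
      then show "(w, q) \<in> ?B" using h by (auto simp: ballot_words_def)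
    qed
    show "\<forall>a\<in>?A. map_prod transpose_word transpose_word (map_prod transpose_word transpose_word a) = a"
      by (auto simp: ballot_pairs_def transpose_word_idem)
    show "\<forall>a\<in>?B. map_prod transpose_word transpose_word (map_prod transpose_word transpose_word a) = a"
      by (auto simp: ballot_words_def transpose_word_idem)
    show "map_prod transpose_word transpose_word ` ?A \<subseteq> ?B"
    proof (rule image_subsetI)
      fix a assume a: "a \<in> ?A"
      obtain w q where aw: "a = (w, q)" by force
      have h: "ballot w" "ballot q" "length w = n" "length q = n" "count_list w = count_list q" "count_list w 0 \<le> d"
        using a aw by (auto simp: ballot_pairs_def)
      show "map_prod transpose_word transpose_word a \<in> ?B"
        unfolding aw map_prod_simp B
        using h transpose_word_content[OF h(1,2)] transpose_word_letters[OF h(1), of d]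
        by (simp add: transpose_word_ballot)
    qed
    show "map_prod transpose_word transpose_word ` ?B \<subseteq> ?A"
    proof (rule image_subsetI)
      fix a assume a: "a \<in> ?B"
      obtain w q where aw: "a = (w, q)" by force
      have h: "ballot w" "ballot q" "count_list w = count_list q" "set w \<subseteq> {..<d}" "length w = n" "length q = n"
        using a unfolding aw B by auto
      have "count_list (transpose_word w) 0 \<le> d"
        using transpose_word_letters[OF transpose_word_ballot[OF h(1)], of d] h(4)
        by (simp add: transpose_word_idem h(1))
      then show "map_prod transpose_word transpose_word a \<in> ?A"
        using h transpose_word_content[OF h(1,2)] by (simp add: aw ballot_pairs_def transpose_word_ballot)
    qed
  qed
  also have "\<dots> = (\<Sum>c\<in>partitions d n. card (ballot_words c \<times> ballot_words c))"
  proof (rule card_UN_disjoint)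
    show "\<forall>c\<in>partitions d n. finite (ballot_words c \<times> ballot_words c)"
      using finite_ballot_words by blast
  qed (auto simp: ballot_words_def)
  finally show ?thesis by (simp add: card_cartesian_product power2_eq_square)
qed

section \<open>Counting ballot words\<close>

text \<open>Up to sign, the residue at \<open>t = l i\<close> of the product of all
  \<open>1 - 1 / (t - l j)\<close>; also the factor by which a Vandermonde product changes when
  \<open>l i\<close> is lowered by one.\<close>

definition shifted_weight :: "nat set \<Rightarrow> (nat \<Rightarrow> real) \<Rightarrow> nat \<Rightarrow> real" where
  "shifted_weight I l i = (\<Prod>j\<in>I-{i}. 1 - 1 / (l i - l j))"

lemma shifted_weight_insert:
  assumes "finite I" "a \<notin> I" "i \<in> I"
  shows "shifted_weight (insert a I) l i = shifted_weight I l i * (1 - 1 / (l i - l a))"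
proof -
  have "insert a I - {i} = insert a (I - {i})" using assms by auto
  then show ?thesis using assms by (simp add: shifted_weight_def mult.commute)
qed

lemma shifted_weight_partial_fractions:
  assumes "finite I" "inj_on l I" "t \<notin> l ` I"
  shows "(\<Prod>j\<in>I. 1 - 1 / (t - l j)) = 1 - (\<Sum>i\<in>I. shifted_weight I l i / (t - l i))"
  using assms
proof (induction I arbitrary: t)
  case (insert a I)
  let ?B = "shifted_weight I l"
  have ta: "t \<noteq> l a" "t \<notin> l ` I" and la: "l a \<notin> l ` I" using insert.prems insert.hyps by auto
  note IHt = insert.IH[of t, OF _ ta(2)] and IHa = insert.IH[of "l a", OF _ la]
  have inj: "inj_on l I" using insert.prems by auto
  have "shifted_weight (insert a I) l a = 1 - (\<Sum>i\<in>I. ?B i / (l a - l i))"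
    using IHa[OF inj] insert.hyps by (simp add: shifted_weight_def)
  then have "(\<Sum>i\<in>insert a I. shifted_weight (insert a I) l i / (t - l i))
      = (1 - (\<Sum>i\<in>I. ?B i / (l a - l i))) / (t - l a) + (\<Sum>i\<in>I. ?B i * (1 - 1 / (l i - l a)) / (t - l i))"
    using insert.hyps by (simp add: shifted_weight_insert)
  also have "\<dots> = 1 / (t - l a) + (\<Sum>i\<in>I. ?B i * (1 - 1 / (l i - l a)) / (t - l i) - ?B i / (l a - l i) / (t - l a))"
    by (simp add: diff_divide_distrib sum_subtractf sum_divide_distrib)
  also have "(\<Sum>i\<in>I. ?B i * (1 - 1 / (l i - l a)) / (t - l i) - ?B i / (l a - l i) / (t - l a))
      = (\<Sum>i\<in>I. ?B i / (t - l i) * (1 - 1 / (t - l a)))"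
  proof (rule sum.cong)
    fix i assume "i \<in> I"
    then have "l i \<in> l ` I" by simp
    then have "l i \<noteq> l a" "t \<noteq> l i" using ta la by metis+
    then have nz: "l i - l a \<noteq> 0" "t - l i \<noteq> 0" "t - l a \<noteq> 0" "l a - l i \<noteq> 0" using ta by auto
    define p q s where "p = 1 / (l i - l a)" and "q = 1 / (t - l i)" and "s = 1 / (t - l a)"
    \<comment> \<open>The whole step reduces to splitting a product of two simple poles.\<close>
    have qs: "q * s = p * (q - s)"
      using nz unfolding p_def q_def s_def by (simp add: field_simps)
    have p': "1 / (l a - l i) = - p" unfolding p_def by (metis minus_diff_eq minus_divide_right)
    have "?B i * (1 - 1 / (l i - l a)) / (t - l i) - ?B i / (l a - l i) / (t - l a)
        = ?B i * (1 - p) * q - ?B i * (1 / (l a - l i)) * s"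
      by (simp add: p_def q_def s_def)
    also have "\<dots> = ?B i * q - ?B i * (p * (q - s))" unfolding p' by (simp add: algebra_simps)
    also have "\<dots> = ?B i * q * (1 - s)" unfolding qs[symmetric] by (simp add: algebra_simps)
    finally show "?B i * (1 - 1 / (l i - l a)) / (t - l i) - ?B i / (l a - l i) / (t - l a)
        = ?B i / (t - l i) * (1 - 1 / (t - l a))"
      by (simp add: q_def s_def)
  qed simp
  also have "1 / (t - l a) + \<dots> = 1 - (1 - (\<Sum>i\<in>I. ?B i / (t - l i))) * (1 - 1 / (t - l a))"
  proof -
    have "u + S * (1 - u) = 1 - (1 - S) * (1 - u)" for u S :: real by (simp add: algebra_simps)
    then show ?thesis unfolding sum_distrib_right[symmetric] .
  qed
  also have "\<dots> = 1 - (\<Prod>j\<in>insert a I. 1 - 1 / (t - l j))"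
    using IHt[OF inj] insert.hyps by simp
  finally show ?case by simp
qed simp

text \<open>These are the coefficients of 1/t and 1/t^2 at infinity in the partial fraction
  identity. They are obtained without limits by adding one index at a time; the identity at
  \<open>t = l a\<close> supplies the weight of the new index.\<close>

lemma sum_shifted_weight:
  assumes "finite I" "inj_on l I"
  shows "(\<Sum>i\<in>I. shifted_weight I l i) = card I \<and>
    (\<Sum>i\<in>I. l i * shifted_weight I l i) = (\<Sum>i\<in>I. l i) - card I * (real (card I) - 1) / 2"
  using assms
proof (induction I)
  case (insert a I)
  let ?B = "shifted_weight I l"
  have la: "l a \<notin> l ` I" and inj: "inj_on l I" using insert.prems insert.hyps by auto
  have IH: "(\<Sum>i\<in>I. ?B i) = card I" "(\<Sum>i\<in>I. l i * ?B i) = (\<Sum>i\<in>I. l i) - card I * (real (card I) - 1) / 2"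
    using insert.IH inj by auto
  have a: "shifted_weight (insert a I) l a = 1 - (\<Sum>i\<in>I. ?B i / (l a - l i))"
    using shifted_weight_partial_fractions[OF insert.hyps(1) inj la] insert.hyps by (simp add: shifted_weight_def)
  have fl: "?B i / (l i - l a) = - (?B i / (l a - l i))" for i
    by (metis minus_diff_eq minus_divide_right)
  have "(\<Sum>i\<in>insert a I. shifted_weight (insert a I) l i)
      = 1 - (\<Sum>i\<in>I. ?B i / (l a - l i)) + (\<Sum>i\<in>I. ?B i * (1 - 1 / (l i - l a)))"
    using insert.hyps a by (simp add: shifted_weight_insert)
  also have "\<dots> = 1 + (\<Sum>i\<in>I. ?B i)"
    using fl by (simp add: algebra_simps sum_subtractf sum.distrib sum_negf)
  finally have 1: "(\<Sum>i\<in>insert a I. shifted_weight (insert a I) l i) = 1 + card I" using IH by simp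
  have "(\<Sum>i\<in>insert a I. l i * shifted_weight (insert a I) l i)
      = l a * (1 - (\<Sum>i\<in>I. ?B i / (l a - l i))) + (\<Sum>i\<in>I. l i * (?B i * (1 - 1 / (l i - l a))))"
    using insert.hyps a by (simp add: shifted_weight_insert)
  also have "\<dots> = l a + (\<Sum>i\<in>I. l i * (?B i * (1 - 1 / (l i - l a))) - l a * (?B i / (l a - l i)))"
    by (simp add: algebra_simps sum.distrib sum_subtractf sum_distrib_left)
  also have "(\<Sum>i\<in>I. l i * (?B i * (1 - 1 / (l i - l a))) - l a * (?B i / (l a - l i))) = (\<Sum>i\<in>I. l i * ?B i - ?B i)"
  proof (rule sum.cong)
    fix i assume "i \<in> I"
    then have "l i \<in> l ` I" by simp
    then have "l i \<noteq> l a" using la by metis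
    then have nz: "l i - l a \<noteq> 0" "l a - l i \<noteq> 0" by auto
    show "l i * (?B i * (1 - 1 / (l i - l a))) - l a * (?B i / (l a - l i)) = l i * ?B i - ?B i"
    proof -
      define p where "p = 1 / (l i - l a)"
      have p': "?B i / (l a - l i) = - (?B i * p)"
        unfolding p_def by (metis fl minus_minus mult.right_neutral times_divide_eq_right)
      have "p * (l i - l a) = 1" using nz by (simp add: p_def)
      then have "?B i * (p * (l i - l a)) = ?B i" by simp
      then show ?thesis unfolding p' p_def[symmetric] by (simp add: algebra_simps)
    qed
  qed simp
  also have "l a + \<dots> = l a + (\<Sum>i\<in>I. l i) - card I * (real (card I) - 1) / 2 - card I"
    using IH by (simp add: sum_subtractf)
  finally have 2: "(\<Sum>i\<in>insert a I. l i * shifted_weight (insert a I) l i)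
     = l a + (\<Sum>i\<in>I. l i) - card I * (real (card I) - 1) / 2 - card I" .
  have c: "real (card (insert a I)) = 1 + real (card I)" using insert.hyps by simp
  show ?case
    using 1 2 insert.hyps unfolding c by (simp add: field_simps)
qed simp

definition vandermonde :: "nat \<Rightarrow> (nat \<Rightarrow> real) \<Rightarrow> real" where
  "vandermonde d l = (\<Prod>j<d. \<Prod>i<j. l i - l j)"

lemma vandermonde_shift:
  assumes "inj_on l {..<d}" "y < d"
  shows "vandermonde d (l(y := l y - 1)) = vandermonde d l * shifted_weight {..<d} l y"
  using assms
proof (induction d)
  case (Suc d)
  let ?l = "l(y := l y - 1)"
  have inj: "inj_on l {..<d}" using Suc.prems by (simp add: lessThan_Suc)
  have S: "vandermonde (Suc d) m = vandermonde d m * (\<Prod>i<d. m i - m d)" for m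
    by (simp add: vandermonde_def)
  have ne: "l i \<noteq> l j" if "i < Suc d" "j < Suc d" "i \<noteq> j" for i j
    using Suc.prems(1) that by (auto simp: inj_on_def)
  show ?case
  proof (cases "y = d")
    case True
    have "vandermonde d ?l = vandermonde d l"
      unfolding vandermonde_def using True by (intro prod.cong) auto
    moreover have "(\<Prod>i<d. ?l i - ?l d) = (\<Prod>i<d. (l i - l d) * (1 - 1 / (l d - l i)))"
    proof (rule prod.cong)
      fix i assume "i \<in> {..<d}"
      then have "l d - l i \<noteq> 0" "i \<noteq> d" using ne[of d i] by auto
      then show "?l i - ?l d = (l i - l d) * (1 - 1 / (l d - l i))"
        using True by (simp add: field_simps)
    qed simp
    moreover have "{..<Suc d} - {d} = {..<d}" by auto
    ultimately show ?thesis unfolding S shifted_weight_def True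
      by (simp only: prod.distrib mult.assoc)
  next
    case False
    then have y: "y < d" using Suc.prems by simp
    have 1: "vandermonde d ?l = vandermonde d l * shifted_weight {..<d} l y"
      using Suc.IH[OF inj y] .
    have 2: "(\<Prod>i<d. ?l i - ?l d) = (\<Prod>i<d. l i - l d) * (1 - 1 / (l y - l d))"
    proof -
      have nz: "l y - l d \<noteq> 0" using ne[of y d] y by auto
      have "(\<Prod>i<d. ?l i - ?l d) = (?l y - ?l d) * (\<Prod>i\<in>{..<d}-{y}. ?l i - ?l d)"
        using y by (subst prod.remove[of _ y]) auto
      also have "(\<Prod>i\<in>{..<d}-{y}. ?l i - ?l d) = (\<Prod>i\<in>{..<d}-{y}. l i - l d)"
        using False by (intro prod.cong) auto
      also have "?l y - ?l d = (l y - l d) * (1 - 1 / (l y - l d))"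
        using False nz by (simp add: field_simps)
      also have "(l y - l d) * (1 - 1 / (l y - l d)) * (\<Prod>i\<in>{..<d}-{y}. l i - l d)
         = (\<Prod>i<d. l i - l d) * (1 - 1 / (l y - l d))"
        using y by (subst prod.remove[of "{..<d}" y]) auto
      finally show ?thesis .
    qed
    show ?thesis unfolding S 1 2 lessThan_Suc
      using shifted_weight_insert[of "{..<d}" d y l] y by simp
  qed
qed simp

lemma vandermonde_eq_0:
  assumes "i < j" "j < d" "l i = l j"
  shows "vandermonde d l = 0"
  unfolding vandermonde_def using assms
  by force

text \<open>By \<open>sum_shifted\<close> the scalar on the right is the size of the partition, so
  this is the branching rule for the numerator of the tableau formula.\<close>

lemma vandermonde_recurrence:
  assumes "inj_on l {..<d}"
  shows "(\<Sum>y<d. l y * vandermonde d (l(y := l y - 1))) = ((\<Sum>y<d. l y) - d * (real d - 1) / 2) * vandermonde d l"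
proof -
  have "(\<Sum>y<d. l y * vandermonde d (l(y := l y - 1))) = (\<Sum>y<d. l y * shifted_weight {..<d} l y) * vandermonde d l"
    unfolding sum_distrib_right using assms
    by (intro sum.cong) (auto simp: vandermonde_shift)
  then show ?thesis using sum_shifted_weight[of "{..<d}" l] assms by simp
qed

section \<open>The Frobenius formula for the number of standard tableaux\<close>

definition shifted :: "nat \<Rightarrow> (nat \<Rightarrow> nat) \<Rightarrow> nat \<Rightarrow> nat" where
  "shifted d c i = c i + (d - Suc i)"

lemma sum_shifted:
  "real (\<Sum>i<d. shifted d c i) = real (\<Sum>i<d. c i) + d * (real d - 1) / 2"
proof -
  have "(\<Sum>i<d. d - Suc i) = (\<Sum>i<d. i)" by (rule sum.nat_diff_reindex)
  moreover have "real (\<Sum>i<d. i) = d * (real d - 1) / 2" by (induction d) (auto simp: field_simps)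
  moreover have "(\<Sum>i<d. shifted d c i) = (\<Sum>i<d. c i) + (\<Sum>i<d. d - Suc i)"
    unfolding shifted_def by (rule sum.distrib)
  ultimately show ?thesis by (simp only: of_nat_add)
qed

lemma shifted_strict_antimono:
  assumes "is_part c" "i < j" "j < d"
  shows "shifted d c j < shifted d c i"
  using is_part_antimono[OF assms(1), of i j] assms(2,3) by (simp add: shifted_def)

text \<open>Branching rule: the head of a word is the row of the largest entry, and deleting that
  entry removes a corner of the shape.\<close>

lemma ballot_words_Suc:
  assumes "c \<in> partitions d (Suc n)"
  defines "R \<equiv> {y. y < d \<and> c y > 0 \<and> is_part (c(y := c y - 1))}"
  shows "card (ballot_words c) = (\<Sum>y\<in>R. card (ballot_words (c(y := c y - 1))))"
    and "\<And>y. y \<in> R \<Longrightarrow> c(y := c y - 1) \<in> partitions d n"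
proof -
  show R: "c(y := c y - 1) \<in> partitions d n" if "y \<in> R" for y
  proof -
    have y: "y < d" "c y > 0" "is_part (c(y := c y - 1))" using that by (auto simp: R_def)
    have "(\<Sum>i<d. c i) = c y + (\<Sum>i\<in>{..<d}-{y}. c i)" using y by (subst sum.remove[of _ y]) auto
    moreover have "(\<Sum>i<d. (c(y := c y - 1)) i) = (c y - 1) + (\<Sum>i\<in>{..<d}-{y}. c i)"
      using y by (subst sum.remove[of _ y]) auto
    ultimately have "(\<Sum>i<d. (c(y := c y - 1)) i) = n"
      using assms(1) y by (simp add: partitions_def)
    then show ?thesis using y assms(1) by (simp add: partitions_def)
  qed
  have "ballot_words c = (\<Union>y\<in>R. (#) y ` ballot_words (c(y := c y - 1)))"
  proof (intro equalityI subsetI)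
    fix w assume "w \<in> ballot_words c"
    then have w: "ballot w" "count_list w = c" by (auto simp: ballot_words_def)
    have "w \<noteq> []" using w(2) assms(1) by (auto simp: partitions_def)
    then obtain y ys where ys: "w = y # ys" by (cases w) auto
    have c: "c = (count_list ys)(y := Suc (count_list ys y))" using w(2) ys count_list_Cons by metis
    then have c': "c(y := c y - 1) = count_list ys" by (simp add: fun_eq_iff)
    have "y < d"
    proof (rule ccontr)
      assume "\<not> y < d"
      then have "c y = 0" using assms(1) by (simp add: partitions_def)
      then show False using c by (metis fun_upd_same nat.distinct(1))
    qed
    moreover have "c y > 0" using c by (metis fun_upd_same zero_less_Suc)
    ultimately have "y \<in> R" using c' w ys ballot_is_part by (simp add: R_def)
    moreover have "ys \<in> ballot_words (c(y := c y - 1))" using c' w ys by (simp add: ballot_words_def)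
    ultimately show "w \<in> (\<Union>y\<in>R. (#) y ` ballot_words (c(y := c y - 1)))" using ys by blast
  next
    fix w assume "w \<in> (\<Union>y\<in>R. (#) y ` ballot_words (c(y := c y - 1)))"
    then obtain y ys where y: "y \<in> R" "w = y # ys" "ballot ys" "count_list ys = c(y := c y - 1)"
      by (auto simp: ballot_words_def)
    have "count_list w = c" using y by (auto simp: R_def count_list_Cons fun_eq_iff)
    then show "w \<in> ballot_words c" using y assms(1) by (simp add: ballot_words_def partitions_def)
  qed
  then have "card (ballot_words c) = (\<Sum>y\<in>R. card ((#) y ` ballot_words (c(y := c y - 1))))"
    using finite_ballot_words[OF R] by (simp only:) (intro card_UN_disjoint, auto simp: R_def)
  then show "card (ballot_words c) = (\<Sum>y\<in>R. card (ballot_words (c(y := c y - 1))))"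
    by (simp add: card_image)
qed

lemma prod_fact_shift:
  fixes l :: "nat \<Rightarrow> nat"
  assumes "y < d" "l y > 0"
  shows "(\<Prod>i<d. fact (l i) :: real) = real (l y) * (\<Prod>i<d. fact ((l(y := l y - 1)) i))"
proof -
  have "(\<Prod>i<d. fact (l i) :: real) = fact (l y) * (\<Prod>i\<in>{..<d}-{y}. fact (l i))"
    using assms by (subst prod.remove[of _ y]) auto
  moreover have "(\<Prod>i<d. fact ((l(y := l y - 1)) i) :: real) = fact (l y - 1) * (\<Prod>i\<in>{..<d}-{y}. fact (l i))"
    using assms by (subst prod.remove[of _ y]) auto
  ultimately show ?thesis using assms by (simp add: fact_reduce[of "l y"])
qed

text \<open>Base case of the tableau formula. The empty shape gives the staircase d - 1, ..., 0, for
  which both sides are the product of all j! with j < d.\<close>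

lemma vandermonde_shifted_zero:
  "vandermonde d (\<lambda>i. real (shifted d (\<lambda>_. 0) i)) = (\<Prod>i<d. fact (shifted d (\<lambda>_. 0) i))"
proof -
  have "(\<Prod>i<j. real (shifted d (\<lambda>_. 0) i) - real (shifted d (\<lambda>_. 0) j)) = fact j" if "j < d" for j
  proof -
    have "(\<Prod>i<j. real (shifted d (\<lambda>_. 0) i) - real (shifted d (\<lambda>_. 0) j)) = (\<Prod>i<j. real (Suc (j - Suc i)))"
      using that by (intro prod.cong) (auto simp: shifted_def of_nat_diff)
    also have "\<dots> = (\<Prod>i<j. real (Suc i))" by (rule prod.nat_diff_reindex)
    also have "\<dots> = fact j" by (induction j) (auto simp: algebra_simps)
    finally show ?thesis .
  qed
  then have "vandermonde d (\<lambda>i. real (shifted d (\<lambda>_. 0) i)) = (\<Prod>j<d. fact j)"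
    by (simp add: vandermonde_def)
  also have "\<dots> = (\<Prod>i<d. fact (shifted d (\<lambda>_. 0) i))"
    unfolding shifted_def by (simp add: prod.nat_diff_reindex)
  finally show ?thesis .
qed

theorem card_ballot_words:
  assumes "c \<in> partitions d n"
  shows "real (card (ballot_words c)) =
    fact n * vandermonde d (\<lambda>i. real (shifted d c i)) / (\<Prod>i<d. fact (shifted d c i))"
  using assms
proof (induction n arbitrary: c)
  case 0
  then have c: "c = (\<lambda>_. 0)" by (auto simp: partitions_def fun_eq_iff) (metis lessThan_iff not_le)
  have "ballot_words c = {[]}"
    unfolding c ballot_words_def
  proof (intro equalityI subsetI)
    fix w assume "w \<in> {w. ballot w \<and> count_list w = (\<lambda>_. 0)}"
    then have "set w = {}" by (metis (mono_tags, lifting) count_list_0_iff ex_in_conv mem_Collect_eq)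
    then show "w \<in> {[]}" by simp
  qed auto
  then show ?case using vandermonde_shifted_zero[of d] by (simp add: c)
next
  case (Suc n)
  define R where "R = {y. y < d \<and> c y > 0 \<and> is_part (c(y := c y - 1))}"
  define l where "l = shifted d c"
  define L where "L = (\<lambda>i. real (l i))"
  define F where "F = (\<Prod>i<d. fact (l i) :: real)"
  have F: "F > 0" unfolding F_def by (intro prod_pos) auto
  have pc: "is_part c" using Suc.prems by (simp add: partitions_def)
  have "inj_on L {..<d}"
  proof (rule inj_onI)
    fix i j assume "i \<in> {..<d}" "j \<in> {..<d}" "L i = L j"
    then show "i = j" using shifted_strict_antimono[OF pc, of i j d] shifted_strict_antimono[OF pc, of j i d]
      by (cases i j rule: linorder_cases) (auto simp: L_def l_def)
  qed
  note rec = vandermonde_recurrence[OF this]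
  have sh: "(\<lambda>i. real (shifted d (c(y := c y - 1)) i)) = L(y := L y - 1)" "shifted d (c(y := c y - 1)) = l(y := l y - 1)" "l y > 0"
    if "y \<in> R" for y using that by (auto simp: R_def L_def l_def shifted_def fun_eq_iff)
  have "real (card (ballot_words c)) = (\<Sum>y\<in>R. fact n * (L y * vandermonde d (L(y := L y - 1))) / F)"
  proof -
    have "real (card (ballot_words c)) = (\<Sum>y\<in>R. real (card (ballot_words (c(y := c y - 1)))))"
      using ballot_words_Suc(1)[OF Suc.prems] by (simp add: R_def)
    also have "\<dots> = (\<Sum>y\<in>R. fact n * (L y * vandermonde d (L(y := L y - 1))) / F)"
    proof (rule sum.cong)
      fix y assume y: "y \<in> R"
      have "F = L y * (\<Prod>i<d. fact ((l(y := l y - 1)) i))"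
        unfolding F_def L_def using y sh(3)[OF y] by (intro prod_fact_shift) (auto simp: R_def)
      then have e: "(\<Prod>i<d. fact ((l(y := l y - 1)) i)) = F / L y"
        using sh(3)[OF y] by (simp add: L_def)
      have "real (card (ballot_words (c(y := c y - 1)))) = fact n * vandermonde d (L(y := L y - 1)) / (F / L y)"
        using Suc.IH[OF ballot_words_Suc(2)[OF Suc.prems y[unfolded R_def]]]
        unfolding sh(1)[OF y] unfolding sh(2)[OF y] e .
      then show "real (card (ballot_words (c(y := c y - 1)))) = fact n * (L y * vandermonde d (L(y := L y - 1))) / F"
        by (simp add: mult_ac)
    qed simp
    finally show ?thesis .
  qed
  \<comment> \<open>Rows that do not end in a removable corner contribute 0. If row
    \<open>y + 1\<close> has the same length, lowering \<open>L y\<close> makes two arguments of the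
    Vandermonde product equal; otherwise \<open>y\<close> is the last of the \<open>d\<close> rows
    and empty, and \<open>L y = 0\<close>.\<close>
  also have "\<dots> = (\<Sum>y<d. fact n * (L y * vandermonde d (L(y := L y - 1))) / F)"
  proof (rule sum.mono_neutral_left)
    show "\<forall>y\<in>{..<d} - R. fact n * (L y * vandermonde d (L(y := L y - 1))) / F = 0"
    proof
      fix y assume y: "y \<in> {..<d} - R"
      have "L y = 0 \<or> vandermonde d (L(y := L y - 1)) = 0"
      proof (cases "Suc y < d \<and> c (Suc y) = c y")
        case True
        then have "L y - 1 = L (Suc y)" by (simp add: L_def l_def shifted_def of_nat_diff)
        then show ?thesis using True by (intro disjI2 vandermonde_eq_0[of y "Suc y"]) auto
      next
        case False
        have less: "c (Suc y) < c y" if "c y > 0"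
        proof (cases "Suc y < d")
          case True
          then show ?thesis using False pc by (simp add: is_part_def le_neq_implies_less)
        next
          case False
          then show ?thesis using Suc.prems that by (simp add: partitions_def)
        qed
        have "c y = 0"
        proof (rule ccontr)
          assume "c y \<noteq> 0"
          moreover from this have "is_part (c(y := c y - 1))"
            using less pc by (auto simp: is_part_def intro: le_trans[OF diff_le_self])
          ultimately show False using y by (simp add: R_def)
        qed
        moreover from this have "\<not> Suc y < d" using False pc by (metis is_part_def le_zero_eq)
        ultimately have "L y = 0" using y by (simp add: L_def l_def shifted_def)
        then show ?thesis ..
      qed
      then show "fact n * (L y * vandermonde d (L(y := L y - 1))) / F = 0" by auto
    qed
  qed (auto simp: R_def)
  also have "\<dots> = fact n * (\<Sum>y<d. L y * vandermonde d (L(y := L y - 1))) / F"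
    by (simp add: sum_distrib_left sum_divide_distrib)
  also have "(\<Sum>y<d. L y * vandermonde d (L(y := L y - 1))) = real (Suc n) * vandermonde d L"
    unfolding rec using sum_shifted[of d c] Suc.prems
    by (simp add: L_def l_def partitions_def del: of_nat_sum flip: of_nat_sum)
  finally show ?case by (simp add: F_def L_def l_def mult_ac)
qed

section \<open>A criterion for a power series not to be algebraic\<close>

text \<open>
  Bivariate polynomials are polynomials in the second variable over polynomials in the first:
  \<open>poly (poly Q [:b:]) a\<close> is the value of \<open>Q\<close> at \<open>(a, b)\<close>.
\<close>

lemma poly_poly_const: "poly (poly Q p) (a::'a::comm_ring_1) = poly (poly Q [:poly p a:]) a"
  by (induction Q) auto

text \<open>It has the order n^(-r), but its differences and tail sums are again of this form up to
  a factor, so the exponent can be lowered by one without error terms.\<close>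

definition rising_weight :: "nat \<Rightarrow> nat \<Rightarrow> real" where
  "rising_weight r n = fact n / fact (n + r)"

lemma rising_weight_pos: "rising_weight r n > 0"
  by (simp add: rising_weight_def)

lemma rising_weight_le_1: "rising_weight r n \<le> 1"
  by (simp add: rising_weight_def fact_mono)

lemma rising_weight_diff:
  "rising_weight r n - rising_weight r (Suc n) = r * rising_weight (Suc r) n"
proof -
  have "fact n * real (n + r + 1) - fact (Suc n) = real r * fact n"
    by (simp add: algebra_simps)
  moreover have "fact n / fact (n + r) = (fact n * real (n + r + 1)) / fact (Suc (n + r))"
  proof -
    define x where "x = real (n + r + 1)"
    have "fact (Suc (n + r)) = x * fact (n + r)" "x \<noteq> 0" by (simp_all add: x_def)
    then show ?thesis unfolding x_def[symmetric] by simp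
  qed
  ultimately show ?thesis unfolding rising_weight_def by (simp only: add_Suc add_Suc_right diff_divide_distrib[symmetric] times_divide_eq_right)
qed

lemma rising_weight_Suc_ge: "rising_weight r (Suc n) \<ge> rising_weight r n / (r + 1)"
proof -
  have "rising_weight r (Suc n) = rising_weight r n * (real (n + 1) / real (n + r + 1))"
    by (simp add: rising_weight_def divide_simps)
  moreover have "real (n + 1) / real (n + r + 1) \<ge> 1 / (r + 1)"
    by (simp add: divide_simps algebra_simps)
  ultimately show ?thesis using rising_weight_pos[of r n] mult_left_mono
    by (metis less_imp_le mult.right_neutral times_divide_eq_right)
qed

lemma rising_weight_Suc_le: "rising_weight r (Suc n) \<le> rising_weight r n"
  using rising_weight_diff[of r n] rising_weight_pos[of "Suc r" n]
  by (metis diff_ge_0_iff_ge less_imp_le mult_nonneg_nonneg of_nat_0_le_iff)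

lemma rising_weight_tendsto_0:
  assumes "r \<ge> 1" shows "(\<lambda>n. rising_weight r n) \<longlonglongrightarrow> 0"
proof (rule tendsto_sandwich[of "\<lambda>_. 0" _ _ "\<lambda>n. 1 / real (Suc n)"])
  show "\<forall>\<^sub>F n in sequentially. rising_weight r n \<le> 1 / real (Suc n)"
  proof (rule always_eventually, rule allI)
    fix n
    have "fact (Suc n) \<le> (fact (n + r) :: real)" using assms by (intro fact_mono) auto
    then show "rising_weight r n \<le> 1 / real (Suc n)"
      by (simp add: rising_weight_def field_simps)
  qed
  show "(\<lambda>n. 1 / real (Suc n)) \<longlonglongrightarrow> 0"
    using LIMSEQ_inverse_real_of_nat by (simp add: inverse_eq_divide)
  show "\<forall>\<^sub>F n in sequentially. 0 \<le> rising_weight r n"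
    by (intro always_eventually allI less_imp_le rising_weight_pos)
qed simp

lemma rising_weight_sums:
  assumes "r \<ge> 1"
  shows "(\<lambda>m. rising_weight (Suc r) (m + n)) sums (rising_weight r n / r)"
proof -
  have "(\<lambda>m. rising_weight r (m + n)) \<longlonglongrightarrow> 0"
    using rising_weight_tendsto_0[OF assms] by (rule LIMSEQ_ignore_initial_segment)
  from telescope_sums'[OF this]
  have "(\<lambda>m. (rising_weight r (m + n) - rising_weight r (Suc m + n)) / r) sums ((rising_weight r (0 + n) - 0) / r)"
    by (rule sums_divide)
  moreover have "(rising_weight r (m + n) - rising_weight r (Suc m + n)) / r = rising_weight (Suc r) (m + n)" for m
    using rising_weight_diff[of r "m + n"] assms by simp
  ultimately show ?thesis by simp
qed

text \<open>All coefficients may vanish at the singular point, where their sizes are to be compared.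
  The common factor is divided out repeatedly; the total degree of the coefficients
  decreases.\<close>

lemma exists_nonvanishing_at:
  fixes Q :: "complex poly poly"
  assumes "Q \<noteq> 0"
  shows "\<exists>R. (\<exists>j. poly (coeff R j) a \<noteq> 0) \<and> (\<exists>e. Q = smult ([:-a, 1:] ^ e) R)"
  using assms
proof (induction "\<Sum>j\<le>degree Q. degree (coeff Q j)" arbitrary: Q rule: less_induct)
  case less
  show ?case
  proof (cases "\<exists>j. poly (coeff Q j) a \<noteq> 0")
    case True
    then show ?thesis by (metis power_0 smult_1_left)
  next
    case False
    define R where "R = map_poly (\<lambda>p. p div [:-a, 1:]) Q"
    have QR: "Q = smult [:-a, 1:] R"
    proof (rule poly_eqI)
      fix j
      have "[:-a, 1:] dvd coeff Q j" using False by (simp add: poly_eq_0_iff_dvd)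
      then show "coeff Q j = coeff (smult [:-a, 1:] R) j"
        by (simp add: R_def coeff_map_poly del: mult_pCons_left)
    qed
    have R0: "R \<noteq> 0" using QR less.prems by auto
    have dQ: "degree Q = degree R" unfolding QR by (simp add: degree_smult_eq)
    have dc: "degree (coeff Q j) = (if coeff R j = 0 then 0 else Suc (degree (coeff R j)))" for j
      by (simp add: QR degree_mult_eq del: mult_pCons_left)
    have "(\<Sum>j\<le>degree R. degree (coeff R j)) < (\<Sum>j\<le>degree Q. degree (coeff Q j))"
      unfolding dQ
    proof (rule sum_strict_mono_ex1)
      show "\<exists>j\<in>{..degree R}. degree (coeff R j) < degree (coeff Q j)"
        using R0 by (intro bexI[of _ "degree R"]) (auto simp: dc)
    qed (auto simp: dc)
    then obtain S e where S: "\<exists>j. poly (coeff S j) a \<noteq> 0" "R = smult ([:-a, 1:] ^ e) S"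
      using less.hyps R0 by blast
    have "Q = smult ([:-a, 1:] ^ Suc e) S" unfolding QR S(2) by simp
    then show ?thesis using S(1) by blast
  qed
qed

text \<open>
  Divide by the highest power of \<open>\<phi> y\<close> whose coefficient does not vanish at 1. As \<open>y\<close> tends to 1,
  lower powers vanish because \<open>\<phi>\<close> is unbounded, and in higher ones the factor \<open>1 - y\<close> of the
  coefficient beats every power of the logarithm.
\<close>

lemma log_growth_not_algebraic:
  fixes \<phi> :: "real \<Rightarrow> real" and Q :: "complex poly poly"
  assumes c: "c > 0" and lower: "\<And>y. 0 < y \<Longrightarrow> y < 1 \<Longrightarrow> c * (- ln (1 - y)) \<le> \<phi> y"
    and upper: "\<And>y. 0 < y \<Longrightarrow> y < 1 \<Longrightarrow> \<phi> y \<le> C * (- ln (1 - y)) / y"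
    and "Q \<noteq> 0"
  shows "\<exists>y. 0 < y \<and> y < 1 \<and> poly (poly Q [:of_real (\<phi> y):]) (of_real y) \<noteq> 0"
proof (rule ccontr)
  assume "\<not> ?thesis"
  then have zero: "\<And>y. 0 < y \<Longrightarrow> y < 1 \<Longrightarrow> poly (poly Q [:of_real (\<phi> y):]) (of_real y) = 0" by blast
  obtain R e where R: "\<exists>j. poly (coeff R j) 1 \<noteq> 0" "Q = smult ([:-1, 1:] ^ e) R"
    using exists_nonvanishing_at[OF \<open>Q \<noteq> 0\<close>, of 1] by blast
  define D where "D = degree R"
  define J where "J = Max {j. poly (coeff R j) 1 \<noteq> 0}"
  have sub: "{j. poly (coeff R j) 1 \<noteq> 0} \<subseteq> {..D}"
    by (auto simp: D_def intro!: le_degree)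
  then have fin: "finite {j. poly (coeff R j) 1 \<noteq> 0}" by (rule finite_subset) simp
  have J: "poly (coeff R J) 1 \<noteq> 0" "J \<le> D"
    using Max_in[OF fin] R(1) sub unfolding J_def by blast+
  have J': "poly (coeff R j) 1 = 0" if "j > J" for j
    using Max_ge[OF fin, of j] that by (auto simp: J_def)
  have eq: "(\<Sum>j\<le>D. poly (coeff R j) (of_real y) * of_real (\<phi> y) ^ j) = 0" if "0 < y" "y < 1" for y
  proof -
    have "poly (poly R [:of_real (\<phi> y):]) (of_real y) = (\<Sum>j\<le>D. poly (coeff R j) (of_real y) * of_real (\<phi> y) ^ j)"
      unfolding poly_altdef[of R] by (simp add: poly_sum poly_power D_def)
    moreover have "poly (poly Q [:of_real (\<phi> y):]) (of_real y) = (of_real y - 1) ^ e * poly (poly R [:of_real (\<phi> y):]) (of_real y)"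
      by (simp add: R(2) poly_power)
    moreover have "(of_real y - 1 :: complex) ^ e \<noteq> 0" using that by simp
    ultimately show ?thesis using zero[OF that] that by auto
  qed
  let ?F = "at_left (1::real)"
  have ev: "\<forall>\<^sub>F y in ?F. 0 < y \<and> y < 1"
    using eventually_at_left_real[of 0 1] by simp
  have inf: "filterlim \<phi> at_top ?F"
  proof (rule filterlim_at_top_mono)
    show "filterlim (\<lambda>y. c * (- ln (1 - y))) at_top ?F" using c by real_asymp
    show "\<forall>\<^sub>F y in ?F. c * (- ln (1 - y)) \<le> \<phi> y" using ev lower by (auto elim: eventually_mono)
  qed
  have inv: "((\<lambda>y. inverse (of_real (\<phi> y)) :: complex) \<longlongrightarrow> 0) ?F"
    using tendsto_inverse_0_at_top[OF inf] tendsto_of_real[of "\<lambda>y. inverse (\<phi> y)" 0]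
    by (simp flip: of_real_inverse)
  have small: "((\<lambda>y. (1 - of_real y) * of_real (\<phi> y) ^ m :: complex) \<longlongrightarrow> 0) ?F" for m
  proof -
    have "((\<lambda>y. (1 - y) * \<phi> y ^ m) \<longlongrightarrow> 0) ?F"
    proof (rule tendsto_sandwich[of "\<lambda>_. 0"])
      show "\<forall>\<^sub>F y in ?F. 0 \<le> (1 - y) * \<phi> y ^ m"
      proof (rule eventually_mono[OF ev])
        fix y :: real assume y: "0 < y \<and> y < 1"
        then have "0 \<le> c * (- ln (1 - y))" using c by (intro mult_nonneg_nonneg) auto
        then have "0 \<le> \<phi> y" using lower[of y] y by linarith
        then show "0 \<le> (1 - y) * \<phi> y ^ m" using y by simp
      qed
      show "\<forall>\<^sub>F y in ?F. (1 - y) * \<phi> y ^ m \<le> (1 - y) * (C * (- ln (1 - y)) / y) ^ m"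
      proof (rule eventually_mono[OF ev])
        fix y :: real assume y: "0 < y \<and> y < 1"
        then have "0 \<le> c * (- ln (1 - y))" using c by (intro mult_nonneg_nonneg) auto
        then have "0 \<le> \<phi> y" using lower[of y] y by linarith
        then show "(1 - y) * \<phi> y ^ m \<le> (1 - y) * (C * (- ln (1 - y)) / y) ^ m"
          using y upper by (intro mult_left_mono power_mono) auto
      qed
      \<comment> \<open>With u = - ln (1 - y) one has 1 - y = exp (- u), so the power of the
        logarithm loses against an exponential.\<close>
      have "filterlim (\<lambda>y::real. - ln (1 - y)) at_top ?F" by real_asymp
      from filterlim_compose[OF tendsto_power_div_exp_0[of m] this]
      have l: "((\<lambda>y::real. (- ln (1 - y)) ^ m / exp (- ln (1 - y))) \<longlongrightarrow> 0) ?F" .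
      have "((\<lambda>y. (C / y) ^ m * ((- ln (1 - y)) ^ m / exp (- ln (1 - y)))) \<longlongrightarrow> (C / 1) ^ m * 0) ?F"
        by (intro tendsto_mult l tendsto_power tendsto_divide tendsto_const tendsto_ident_at) simp
      moreover have "\<forall>\<^sub>F y in ?F. (C / y) ^ m * ((- ln (1 - y)) ^ m / exp (- ln (1 - y))) = (1 - y) * (C * (- ln (1 - y)) / y) ^ m"
      proof (rule eventually_mono[OF ev])
        fix y :: real assume "0 < y \<and> y < 1"
        then have "1 / exp (- ln (1 - y)) = 1 - y" by (simp add: exp_minus inverse_eq_divide)
        then have "(- ln (1 - y)) ^ m / exp (- ln (1 - y)) = (- ln (1 - y)) ^ m * (1 - y)"
          by (metis mult.right_neutral times_divide_eq_right)
        moreover have "(C * (- ln (1 - y)) / y) ^ m = (C / y) ^ m * (- ln (1 - y)) ^ m"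
          by (metis power_mult_distrib times_divide_eq_left)
        ultimately show "(C / y) ^ m * ((- ln (1 - y)) ^ m / exp (- ln (1 - y))) = (1 - y) * (C * (- ln (1 - y)) / y) ^ m"
          by (simp only: mult_ac)
      qed
      ultimately show "((\<lambda>y. (1 - y) * (C * (- ln (1 - y)) / y) ^ m) \<longlongrightarrow> 0) ?F"
        by (simp add: tendsto_cong)
    qed simp
    from tendsto_of_real[OF this, where 'a = complex] show ?thesis by simp
  qed
  have pt: "((\<lambda>y. poly p (of_real y :: complex)) \<longlongrightarrow> poly p 1) ?F" for p
  proof -
    have "((\<lambda>y. of_real y :: complex) \<longlongrightarrow> of_real 1) ?F" by (intro tendsto_intros)
    then show ?thesis by (intro tendsto_poly) simp
  qed
  define T where "T = (\<lambda>j y. poly (coeff R j) (of_real y) * of_real (\<phi> y) ^ j / (of_real (\<phi> y) ^ J :: complex))"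
  have T: "(T j \<longlongrightarrow> (if j = J then poly (coeff R J) 1 else 0)) ?F" for j
  proof -
    have nz: "\<forall>\<^sub>F y in ?F. \<phi> y > 0 \<and> 0 < y \<and> y < 1"
      using ev filterlim_at_top_dense[THEN iffD1, OF inf, rule_format, of 0] by eventually_elim auto
    consider "j = J" | "j < J" | "j > J" by linarith
    then show ?thesis
    proof cases
      case 1
      have "\<forall>\<^sub>F y in ?F. poly (coeff R J) (of_real y) = T j y"
        using nz by eventually_elim (auto simp: T_def 1)
      then show ?thesis using 1 pt[of "coeff R J"] by (simp add: tendsto_cong[symmetric])
    next
      case 2
      have "\<forall>\<^sub>F y in ?F. poly (coeff R j) (of_real y) * inverse (of_real (\<phi> y)) ^ (J - j) = T j y"
        using nz
      proof eventually_elim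
        case (elim y)
        have "(of_real (\<phi> y) :: complex) ^ J = of_real (\<phi> y) ^ j * of_real (\<phi> y) ^ (J - j)"
          using 2 by (simp flip: power_add)
        then show ?case using elim by (simp add: T_def power_inverse field_simps)
      qed
      moreover have "((\<lambda>y. poly (coeff R j) (of_real y) * inverse (of_real (\<phi> y)) ^ (J - j)) \<longlongrightarrow> poly (coeff R j) 1 * 0 ^ (J - j)) ?F"
        by (intro tendsto_mult pt tendsto_power inv)
      ultimately show ?thesis using 2 by (simp add: tendsto_cong[symmetric] power_0_left)
    next
      case 3
      then obtain S where S: "coeff R j = [:-1, 1:] * S" using J'[OF 3] by (auto simp: poly_eq_0_iff_dvd elim: dvdE)
      have "\<forall>\<^sub>F y in ?F. - poly S (of_real y) * ((1 - of_real y) * of_real (\<phi> y) ^ (j - J)) = T j y"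
        using nz
      proof eventually_elim
        case (elim y)
        have "(of_real (\<phi> y) :: complex) ^ j = of_real (\<phi> y) ^ J * of_real (\<phi> y) ^ (j - J)"
          using 3 by (simp flip: power_add)
        then show ?case using elim by (simp add: T_def S field_simps)
      qed
      moreover have "((\<lambda>y. - poly S (of_real y) * ((1 - of_real y) * of_real (\<phi> y) ^ (j - J))) \<longlongrightarrow> - poly S 1 * 0) ?F"
        by (intro tendsto_mult tendsto_minus pt small)
      ultimately show ?thesis using 3 by (simp add: tendsto_cong[symmetric])
    qed
  qed
  have "((\<lambda>y. \<Sum>j\<le>D. T j y) \<longlongrightarrow> (\<Sum>j\<le>D. if j = J then poly (coeff R J) 1 else 0)) ?F"
    by (intro tendsto_sum T)
  moreover have "\<forall>\<^sub>F y in ?F. (\<Sum>j\<le>D. T j y) = 0"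
  proof (rule eventually_mono[OF ev])
    fix y :: real assume "0 < y \<and> y < 1"
    then have "(\<Sum>j\<le>D. poly (coeff R j) (of_real y) * of_real (\<phi> y) ^ j) / (of_real (\<phi> y) ^ J :: complex) = 0"
      using eq by simp
    then show "(\<Sum>j\<le>D. T j y) = 0" unfolding T_def sum_divide_distrib .
  qed
  ultimately have "((\<lambda>y. 0 :: complex) \<longlongrightarrow> (\<Sum>j\<le>D. if j = J then poly (coeff R J) 1 else 0)) ?F"
    by (rule Lim_transform_eventually)
  then have "(\<Sum>j\<le>D. if j = J then poly (coeff R J) 1 else 0) = 0"
    using tendsto_unique[OF trivial_limit_at_left_real _ tendsto_const] by blast
  then show False using J by simp
qed

section \<open>Power series with coefficients of order n^(-r)\<close>

lemma summable_powser_bounded: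
  fixes g :: "nat \<Rightarrow> real"
  assumes "\<And>n. \<bar>g n\<bar> \<le> K" "0 \<le> y" "y < 1"
  shows "summable (\<lambda>n. g n * y ^ n)"
proof (rule summable_comparison_test')
  show "summable (\<lambda>n. K * y ^ n)" using assms by (intro summable_mult summable_geometric) auto
  fix n :: nat assume "n \<ge> 0"
  show "norm (g n * y ^ n) \<le> K * y ^ n"
    using assms by (auto simp: abs_mult intro!: mult_right_mono)
qed

text \<open>Abel summation: the tails are the coefficients of (A(1) - A(y)) / (1 - y), where A is
  the series with coefficients \<open>g\<close>.\<close>

lemma powser_tail_sums:
  fixes g :: "nat \<Rightarrow> real"
  assumes sg: "summable g" and g0: "\<And>n. g n \<ge> 0" and y: "0 < y" "y < 1"
  defines "T \<equiv> \<lambda>n. \<Sum>m. g (m + Suc n)"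
  shows "(\<Sum>n. g n * y ^ n) = suminf g - (1 - y) * (\<Sum>n. T n * y ^ n)"
proof -
  have shift: "summable (\<lambda>m. g (m + k))" for k using sg by (rule summable_ignore_initial_segment)
  have T_step: "T n = g (Suc n) + T (Suc n)" for n
    using suminf_split_head[OF shift[of "Suc n"]] by (simp add: T_def)
  have T0: "suminf g = g 0 + T 0"
    using suminf_split_head[OF sg] by (simp add: T_def)
  have Tnn: "T n \<ge> 0" for n unfolding T_def using shift g0 by (intro suminf_nonneg)
  have anti: "T (Suc n) \<le> T n" for n using T_step[of n] g0[of "Suc n"] by simp
  have Tb: "\<bar>T n\<bar> \<le> T 0" for n
    using lift_Suc_antimono_le[of T 0 n, OF anti] Tnn[of n] by simp
  have gb: "\<bar>g n\<bar> \<le> suminf g" for n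
    using sum_le_suminf[OF sg, of "{n}"] g0 by auto
  have sT: "summable (\<lambda>n. T n * y ^ n)" using summable_powser_bounded[of T "T 0" y] Tb y by simp
  have sG: "summable (\<lambda>n. g n * y ^ n)" using summable_powser_bounded[of g "suminf g" y] gb y by simp
  have sT1: "summable (\<lambda>n. T (Suc n) * y ^ n)"
    using summable_powser_bounded[of "\<lambda>n. T (Suc n)" "T 0" y] Tb y by simp
  have sG1: "summable (\<lambda>n. g (Suc n) * y ^ n)"
    using summable_powser_bounded[of "\<lambda>n. g (Suc n)" "suminf g" y] gb y by simp
  have hT: "(\<Sum>n. T n * y ^ n) = T 0 + y * (\<Sum>n. T (Suc n) * y ^ n)"
    using suminf_split_head[OF sT] suminf_mult[OF sT1, of y] by (simp add: mult_ac)
  have hG: "(\<Sum>n. g n * y ^ n) = g 0 + y * (\<Sum>n. g (Suc n) * y ^ n)"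
    using suminf_split_head[OF sG] suminf_mult[OF sG1, of y] by (simp add: mult_ac)
  have "(\<Sum>n. T n * y ^ n) = (\<Sum>n. g (Suc n) * y ^ n) + (\<Sum>n. T (Suc n) * y ^ n)"
    unfolding suminf_add[OF sG1 sT1] by (simp add: T_step[symmetric] flip: distrib_right)
  then have "y * (\<Sum>n. T n * y ^ n) = y * (\<Sum>n. g (Suc n) * y ^ n) + y * (\<Sum>n. T (Suc n) * y ^ n)"
    by (simp add: distrib_left)
  then show ?thesis using hT hG T0 by (simp add: algebra_simps)
qed

lemma ln_powser_sums:
  assumes "0 < y" "y < (1::real)"
  shows "(\<lambda>n. y ^ Suc n / real (Suc n)) sums (- ln (1 - y))"
proof -
  have "(\<lambda>n. - ((- (- y)) ^ n) / real n) sums ln (1 + - y)"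
    using assms by (intro ln_series') auto
  then have "(\<lambda>n. y ^ n / real n) sums (- ln (1 - y))"
    using sums_minus by fastforce
  then show ?thesis by (subst sums_Suc_iff) simp
qed

text \<open>The claim covers all nonzero \<open>Q\<close> and all coefficients with two-sided
  bounds. Both classes are preserved when the series is replaced by that of its tails, so the
  induction on \<open>r\<close> closes.\<close>

lemma powser_no_polynomial_relation:
  fixes Q :: "complex poly poly"
  assumes "r \<ge> 1" "c > 0" "\<And>n. c * rising_weight r n \<le> g n" "\<And>n. g n \<le> C * rising_weight r n" "Q \<noteq> 0"
  shows "\<exists>y. 0 < y \<and> y < 1 \<and> poly (poly Q [:of_real (\<Sum>n. g n * y ^ n):]) (of_real y) \<noteq> 0"
  using assms
proof (induction r arbitrary: c C g Q rule: nat_induct_at_least)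
  case base
  have w: "rising_weight 1 n = 1 / real (Suc n)" for n
    by (simp add: rising_weight_def)
  have gpos: "g n \<ge> 0" for n
    using base(2)[of n] base(1) rising_weight_pos[of 1 n] by (smt (verit) mult_nonneg_nonneg)
  have C: "C \<ge> 0" using order_trans[OF gpos[of 0] base(3)[of 0]] rising_weight_pos[of 1 0]
    by (auto simp: zero_le_mult_iff)
  have gb: "\<bar>g n\<bar> \<le> C" for n
    using base(3)[of n] gpos[of n] mult_left_mono[OF rising_weight_le_1[of 1 n] C] by simp
  show ?case
  proof (rule log_growth_not_algebraic[OF base(1) _ _ base(4)])
    fix y :: real assume y: "0 < y" "y < 1"
    have sg: "summable (\<lambda>n. g n * y ^ n)" using summable_powser_bounded[OF gb] y by simp
    have s: "(\<lambda>n. y ^ Suc n / real (Suc n)) sums (- ln (1 - y))" using ln_powser_sums y .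
    show "c * (- ln (1 - y)) \<le> (\<Sum>n. g n * y ^ n)"
    proof (rule sums_le[OF _ sums_mult[OF s] summable_sums[OF sg]])
      fix n
      have "c * (y ^ Suc n / real (Suc n)) = (c * rising_weight 1 n) * y ^ Suc n" unfolding w by simp
      also have "\<dots> \<le> g n * y ^ Suc n" using base(2)[of n] y by (intro mult_right_mono) auto
      also have "\<dots> \<le> g n * y ^ n" using y gpos by (intro mult_left_mono power_decreasing) auto
      finally show "c * (y ^ Suc n / real (Suc n)) \<le> g n * y ^ n" .
    qed
    \<comment> \<open>The logarithm series starts with y, while the coefficient of y^n is compared
      with 1 / (n + 1); this shift is the origin of the division by \<open>y\<close>.\<close>
    have u: "(\<lambda>n. C * (y ^ Suc n / real (Suc n)) / y) sums (C * (- ln (1 - y)) / y)"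
      by (intro sums_divide sums_mult s)
    show "(\<Sum>n. g n * y ^ n) \<le> C * (- ln (1 - y)) / y"
    proof (rule sums_le[OF _ summable_sums[OF sg] u])
      fix n
      have "g n * y ^ n \<le> (C * rising_weight 1 n) * y ^ n" using base(3)[of n] y by (intro mult_right_mono) auto
      also have "\<dots> = C * (y ^ Suc n / real (Suc n)) / y" unfolding w using y by simp
      finally show "g n * y ^ n \<le> C * (y ^ Suc n / real (Suc n)) / y" .
    qed
  qed
next
  case (Suc r)
  have gpos: "g n \<ge> 0" for n
    using Suc.prems(2)[of n] Suc.prems(1) rising_weight_pos[of "Suc r" n] by (smt (verit) mult_nonneg_nonneg)
  have ws: "(\<lambda>m. rising_weight (Suc r) (m + n)) sums (rising_weight r n / r)" for n
    using rising_weight_sums Suc.hyps .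
  have sw: "summable (\<lambda>m. C * rising_weight (Suc r) m)"
    using sums_summable[OF sums_mult[OF ws[of 0]]] by simp
  have sg: "summable g"
    by (rule summable_comparison_test'[OF sw, of 0]) (use Suc.prems(3) gpos in auto)
  define T where "T = (\<lambda>n. \<Sum>m. g (m + Suc n))"
  define s where "s = suminf g"
  have shift: "summable (\<lambda>m. g (m + k))" for k using sg by (rule summable_ignore_initial_segment)
  have r0: "real r > 0" using Suc.hyps by simp
  \<comment> \<open>The factor 1 / r comes from summing the tail, and 1 / (r + 1) from moving the
    index from n + 1 back to n.\<close>
  have lower: "c / (r * (r + 1)) * rising_weight r n \<le> T n" for n
  proof -
    have "c / (r * (r + 1)) * rising_weight r n = c / r * (rising_weight r n / (r + 1))" by (simp add: algebra_simps)
    also have "\<dots> \<le> c / r * rising_weight r (Suc n)"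
      using Suc.prems(1) r0 by (intro mult_left_mono rising_weight_Suc_ge) auto
    also have "\<dots> = c * (rising_weight r (Suc n) / r)" by simp
    also have "\<dots> \<le> T n"
      unfolding T_def
      by (rule sums_le[OF _ sums_mult[OF ws[of "Suc n"]] summable_sums[OF shift]]) (rule Suc.prems(2))
    finally show ?thesis .
  qed
  have upper: "T n \<le> C / r * rising_weight r n" for n
  proof -
    have C: "C \<ge> 0" using order_trans[OF gpos[of 0] Suc.prems(3)[of 0]] rising_weight_pos[of "Suc r" 0]
      by (auto simp: zero_le_mult_iff)
    have "T n \<le> C * (rising_weight r (Suc n) / r)"
      unfolding T_def
      by (rule sums_le[OF _ summable_sums[OF shift] sums_mult[OF ws[of "Suc n"]]]) (rule Suc.prems(3))
    also have "\<dots> = C / r * rising_weight r (Suc n)" by simp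
    also have "\<dots> \<le> C / r * rising_weight r n"
      using C r0 by (intro mult_left_mono rising_weight_Suc_le) auto
    finally show ?thesis .
  qed
  \<comment> \<open>The old series expressed through the new one, v, as s - (1 - y) v. This has
    degree one in v, so the substitution cannot annihilate \<open>Q\<close>.\<close>
  define R :: "complex poly poly" where "R = [:[:of_real s:], [:-1, 1:]:]"
  have cpos: "c / (r * (r + 1)) > 0" using Suc.prems(1) Suc.hyps by (simp add: add_pos_nonneg)
  have "pcompose Q R \<noteq> 0" using Suc.prems(4) by (simp add: R_def pcompose_eq_0_iff)
  then obtain y where y: "0 < y" "y < 1"
      "poly (poly (pcompose Q R) [:of_real (\<Sum>n. T n * y ^ n):]) (of_real y) \<noteq> 0"
    using Suc.IH[OF cpos lower upper, of "pcompose Q R"] by blast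
  have "poly (poly (pcompose Q R) [:of_real (\<Sum>n. T n * y ^ n):]) (of_real y)
      = poly (poly Q (poly R [:of_real (\<Sum>n. T n * y ^ n):])) (of_real y)"
    by (simp add: poly_pcompose)
  also have "\<dots> = poly (poly Q [:poly (poly R [:of_real (\<Sum>n. T n * y ^ n):]) (of_real y):]) (of_real y)"
    by (rule poly_poly_const)
  also have "poly (poly R [:of_real (\<Sum>n. T n * y ^ n):]) (of_real y) = of_real (s - (1 - y) * (\<Sum>n. T n * y ^ n))"
    by (simp add: R_def algebra_simps)
  also have "s - (1 - y) * (\<Sum>n. T n * y ^ n) = (\<Sum>n. g n * y ^ n)"
    unfolding s_def T_def by (rule powser_tail_sums[symmetric, OF sg gpos y(1,2)])
  finally show ?case using y by (intro exI[of _ y]) simp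
qed

lemma eval_fps_polynomial_relation:
  fixes A :: "complex fps"
  assumes "norm z < fps_conv_radius A"
  shows "norm z < fps_conv_radius (\<Sum>j\<le>d. fps_of_poly (P j) * A ^ j) \<and>
    eval_fps (\<Sum>j\<le>d. fps_of_poly (P j) * A ^ j) z = (\<Sum>j\<le>d. poly (P j) z * eval_fps A z ^ j)"
proof -
  have t: "norm z < fps_conv_radius (fps_of_poly (P j) * A ^ j) \<and>
      eval_fps (fps_of_poly (P j) * A ^ j) z = poly (P j) z * eval_fps A z ^ j" for j
  proof -
    have p: "norm z < fps_conv_radius (A ^ j)"
      using assms fps_conv_radius_power[of A j] by (rule less_le_trans)
    then show ?thesis
      using fps_conv_radius_mult[of "fps_of_poly (P j)" "A ^ j"] assms
      by (auto simp: eval_fps_mult eval_fps_power min_def split: if_splits)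
  qed
  show ?thesis
  proof (induction d)
    case 0
    show ?case using t[of 0] by simp
  next
    case (Suc d)
    then show ?case
      using t[of "Suc d"] fps_conv_radius_add[of "\<Sum>j\<le>d. fps_of_poly (P j) * A ^ j" "fps_of_poly (P (Suc d)) * A ^ Suc d"]
      by (auto simp: eval_fps_add min_def simp del: power_Suc split: if_splits)
  qed
qed

theorem not_algebraic_fps_if_integral_exponent:
  fixes f :: "nat \<Rightarrow> real"
  assumes "r \<ge> 1" "\<gamma> > 0" "c > 0"
    and lower: "\<And>n. c * \<gamma> ^ n * rising_weight r n \<le> f n"
    and upper: "\<And>n. f n \<le> C * \<gamma> ^ n * rising_weight r n"
  shows "\<not> algebraic_fps (Abs_fps (\<lambda>n. of_real (f n)) :: complex fps)"
proof
  define A :: "complex fps" where "A = Abs_fps (\<lambda>n. of_real (f n))"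
  assume "algebraic_fps (Abs_fps (\<lambda>n. of_real (f n)) :: complex fps)"
  then obtain d P where P: "\<exists>j\<le>d. P j \<noteq> 0" "(\<Sum>j\<le>d. fps_of_poly (P j) * A ^ j) = 0"
    by (auto simp: algebraic_fps_def A_def)
  define g where "g = (\<lambda>n. f n / \<gamma> ^ n)"
  have gl: "c * rising_weight r n \<le> g n" and gu: "g n \<le> C * rising_weight r n" for n
    using lower[of n] upper[of n] assms(2) by (simp_all add: g_def field_simps)
  have gpos: "g n \<ge> 0" for n
    using gl[of n] assms(3) rising_weight_pos[of r n] by (smt (verit) mult_nonneg_nonneg)
  have C: "C \<ge> 0" using order_trans[OF gpos[of 0] gu[of 0]] rising_weight_pos[of r 0]
    by (auto simp: zero_le_mult_iff)
  have gb: "\<bar>g n\<bar> \<le> C" for n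
    using gu[of n] gpos[of n] mult_left_mono[OF rising_weight_le_1[of r n] C] by simp
  have A_eval: "eval_fps A (of_real (y / \<gamma>)) = of_real (\<Sum>n. g n * y ^ n)"
    and A_rad: "norm (of_real (y / \<gamma>) :: complex) < fps_conv_radius A" if y: "0 < y" "y < 1" for y
  proof -
    have e: "fps_nth A n * of_real (z / \<gamma>) ^ n = of_real (g n * z ^ n)" for n z
      by (simp add: A_def g_def power_divide)
    have s: "summable (\<lambda>n. fps_nth A n * of_real (z / \<gamma>) ^ n)" if "0 < z" "z < 1" for z
      unfolding e using summable_powser_bounded[OF gb] that by (intro summable_of_real) simp
    show "eval_fps A (of_real (y / \<gamma>)) = of_real (\<Sum>n. g n * y ^ n)"
      unfolding eval_fps_def e using summable_powser_bounded[OF gb] y by (intro suminf_of_real[symmetric]) simp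
    \<comment> \<open>Convergence at a point strictly between \<open>y\<close> and 1 yields the
      strict inequality for the radius that \<open>eval_fps_polynomial_relation\<close> asks
      for.\<close>
    define z where "z = (1 + y) / 2"
    have z: "0 < z" "z < 1" "y < z" using y by (auto simp: z_def)
    have "norm (of_real (y / \<gamma>) :: complex) < norm (of_real (z / \<gamma>) :: complex)"
      unfolding norm_of_real using z y assms(2) by (simp add: divide_strict_right_mono)
    also have "ereal (norm (of_real (z / \<gamma>) :: complex)) \<le> fps_conv_radius A"
      unfolding fps_conv_radius_def using s[OF z(1,2)] by (rule conv_radius_geI)
    finally show "norm (of_real (y / \<gamma>) :: complex) < fps_conv_radius A" by simp
  qed
  define Q where "Q = (\<Sum>j\<le>d. monom (pcompose (P j) [:0, of_real (1 / \<gamma>):]) j)"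
  have cQ: "coeff Q j = pcompose (P j) [:0, of_real (1 / \<gamma>):]" if "j \<le> d" for j
    using that by (simp add: Q_def coeff_sum)
  have "Q \<noteq> 0"
  proof -
    obtain j where j: "j \<le> d" "P j \<noteq> 0" using P(1) by blast
    then have "coeff Q j \<noteq> 0" using assms(2) by (simp add: cQ pcompose_eq_0_iff)
    then show ?thesis by auto
  qed
  then obtain y where y: "0 < y" "y < 1" "poly (poly Q [:of_real (\<Sum>n. g n * y ^ n):]) (of_real y) \<noteq> 0"
    using powser_no_polynomial_relation[OF assms(1,3) gl gu] by blast
  have "poly (poly Q [:of_real (\<Sum>n. g n * y ^ n):]) (of_real y)
      = (\<Sum>j\<le>d. poly (P j) (of_real (y / \<gamma>)) * eval_fps A (of_real (y / \<gamma>)) ^ j)"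
    unfolding A_eval[OF y(1,2)] Q_def
    by (simp add: poly_sum poly_monom poly_power poly_pcompose del: of_real_divide) (simp add: divide_inverse)
  also have "\<dots> = eval_fps 0 (of_real (y / \<gamma>))"
    using eval_fps_polynomial_relation[OF A_rad[OF y(1,2)], where d = d and P = P] unfolding P(2) by simp
  finally show False using y by simp
qed

section \<open>Multinomial coefficients\<close>

lemma fact_add_ge: "fact q * (real q + 1) ^ k \<le> fact (q + k)"
proof (induction k)
  case (Suc k)
  have "fact q * (real q + 1) ^ Suc k = (fact q * (real q + 1) ^ k) * (real q + 1)" by simp
  also have "\<dots> \<le> fact (q + k) * real (Suc (q + k))" using Suc by (intro mult_mono) auto
  also have "\<dots> = fact (q + Suc k)" by (simp add: algebra_simps)
  finally show ?case .
qed simp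

lemma fact_add_le: "fact (q + k) \<le> fact q * real (q + k) ^ k"
proof (induction k)
  case (Suc k)
  have "fact (q + Suc k) = fact (q + k) * real (q + Suc k)" by (simp add: algebra_simps)
  also have "\<dots> \<le> (fact q * real (q + k) ^ k) * real (q + Suc k)" using Suc by (intro mult_right_mono) auto
  also have "\<dots> \<le> (fact q * real (q + Suc k) ^ k) * real (q + Suc k)"
    by (intro mult_right_mono mult_left_mono power_mono) auto
  also have "\<dots> = fact q * real (q + Suc k) ^ Suc k" by simp
  finally show ?case .
qed simp

text \<open>Subtraction-free form of \<open>l! / q! \<ge> (q + 1)\<^sup>l\<^sup>-\<^sup>q\<close>.\<close>

lemma fact_tangent: "fact q * (real q + 1) ^ l \<le> fact l * (real q + 1) ^ q"
proof (cases "q \<le> l")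
  case True
  then obtain k where k: "l = q + k" using le_Suc_ex by blast
  have "fact q * (real q + 1) ^ l = (fact q * (real q + 1) ^ k) * (real q + 1) ^ q"
    by (simp add: k power_add)
  also have "\<dots> \<le> fact l * (real q + 1) ^ q" unfolding k by (intro mult_right_mono fact_add_ge) auto
  finally show ?thesis .
next
  case False
  then obtain k where k: "q = l + k" by (metis le_Suc_ex nat_le_linear)
  have "fact q \<le> fact l * real q ^ k" unfolding k by (rule fact_add_le)
  also have "\<dots> \<le> fact l * (real q + 1) ^ k" by (intro mult_left_mono power_mono) auto
  finally have "fact q * (real q + 1) ^ l \<le> fact l * (real q + 1) ^ k * (real q + 1) ^ l"
    by (rule mult_right_mono) simp
  also have "\<dots> = fact l * (real q + 1) ^ q" by (simp add: k power_add)
  finally show ?thesis .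
qed

definition central_multinomial :: "nat \<Rightarrow> nat \<Rightarrow> real" where
  "central_multinomial d q = fact (q * d) / fact q ^ d"

lemma central_multinomial_pos: "central_multinomial d q > 0"
  by (simp add: central_multinomial_def)

lemma fact_add_eq_prod: "fact (n + k) = fact n * (\<Prod>i<k. real (n + k) - real i)"
proof (induction k)
  case (Suc k)
  have "(\<Prod>i<Suc k. real (n + Suc k) - real i) = real (n + Suc k) * (\<Prod>i<k. real (n + k) - real i)"
    by (simp add: prod.lessThan_Suc_shift del: prod.lessThan_Suc)
  then show ?case using Suc by simp
qed simp

text \<open>Index j is paired with 2 s + 1 - j, which leaves only 0 alone; this is the pairing
  available for odd \<open>d\<close>.\<close>

lemma prod_pair_up:
  fixes f :: "nat \<Rightarrow> real"
  shows "(\<Prod>i<Suc (2 * s). f i) = f 0 * (\<Prod>i<s. f (i + 1) * f (2 * s - i))"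
proof -
  have "(\<Prod>i<(s+s). f (Suc i)) = (\<Prod>i<s. f (Suc i)) * (\<Prod>i<s. f (Suc (s + i)))"
  proof -
    have "(\<Prod>i<(s+k). f (Suc i)) = (\<Prod>i<s. f (Suc i)) * (\<Prod>i<k. f (Suc (s + i)))" for k
      by (induction k) (auto simp: mult_ac)
    then show ?thesis .
  qed
  also have "(\<Prod>i<s. f (Suc (s + i))) = (\<Prod>i<s. f (Suc (s + (s - Suc i))))"
    by (rule prod.nat_diff_reindex[symmetric])
  also have "\<dots> = (\<Prod>i<s. f (2 * s - i))"
  proof (rule prod.cong)
    fix i assume "i \<in> {..<s}"
    then have "Suc (s + (s - Suc i)) = 2 * s - i" by auto
    then show "f (Suc (s + (s - Suc i))) = f (2 * s - i)" by (rule arg_cong)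
  qed simp
  finally have "(\<Prod>i<(2 * s). f (Suc i)) = (\<Prod>i<s. f (i + 1) * f (2 * s - i))"
    by (simp add: mult_2 prod.distrib)
  then show ?thesis by (simp add: prod.lessThan_Suc_shift del: prod.lessThan_Suc)
qed

text \<open>
  For odd \<open>d\<close> the factors with indices \<open>i\<close> and \<open>d - i\<close> of the ratio of consecutive central
  multinomial coefficients combine to a rational function comparable with \<open>1 - 1 / m\<close>.
\<close>

lemma central_multinomial_Suc:
  fixes q :: nat
  assumes d: "d = 2 * s + 1"
  defines "m \<equiv> real (Suc q)"
  shows "central_multinomial d (Suc q) =
    central_multinomial d q * (d * m * (\<Prod>i<s. (d * m - real (i + 1)) * (d * m - d + real (i + 1)))) / m ^ d"
proof -
  have X: "real (q * d + d) = d * m" by (simp add: m_def algebra_simps)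
  have "fact (Suc q * d) = fact (q * d) * (\<Prod>i<d. d * m - real i)"
    using fact_add_eq_prod[of "q * d" d] X by (simp add: add.commute)
  also have "(\<Prod>i<d. d * m - real i) = d * m * (\<Prod>i<s. (d * m - real (i + 1)) * (d * m - real (2 * s - i)))"
    using prod_pair_up[of "\<lambda>i. d * m - real i" s] d by simp
  also have "(\<Prod>i<s. (d * m - real (i + 1)) * (d * m - real (2 * s - i)))
      = (\<Prod>i<s. (d * m - real (i + 1)) * (d * m - d + real (i + 1)))"
    by (intro prod.cong refl arg_cong2[where f = "(*)"]) (auto simp: d)
  finally show ?thesis
    by (simp add: central_multinomial_def m_def power_mult_distrib mult_ac)
qed

text \<open>As a function of \<open>x\<close> the product is a downward parabola on [0, d], smallest
  at the ends and largest at x = d / 2.\<close>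

lemma central_pair_bounds:
  fixes x m :: real
  assumes "0 \<le> x" "x \<le> d"
  shows "d\<^sup>2 * (m * (m - 1)) \<le> (d * m - x) * (d * m - d + x)"
    and "(d * m - x) * (d * m - d + x) \<le> d\<^sup>2 * (m - 1 / 2)\<^sup>2"
proof -
  have e: "(d * m - x) * (d * m - d + x) = d\<^sup>2 * (m * (m - 1)) + x * (d - x)"
    by (simp add: algebra_simps power2_eq_square)
  show "d\<^sup>2 * (m * (m - 1)) \<le> (d * m - x) * (d * m - d + x)" unfolding e using assms by simp
  have "d\<^sup>2 * (m - 1 / 2)\<^sup>2 - (d * m - x) * (d * m - d + x) = (x - d / 2)\<^sup>2"
    by (simp add: algebra_simps power2_eq_square)
  then show "(d * m - x) * (d * m - d + x) \<le> d\<^sup>2 * (m - 1 / 2)\<^sup>2"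
    by (metis diff_ge_0_iff_ge zero_le_power2)
qed

text \<open>The factor \<open>(2 * real q + 1) ^ s\<close>, instead of a power of \<open>q\<close>,
  lets the induction close without any loss: with m = q + 1 it needs (m - 1/2)^2 (2 m + 1) to be at
  most m^2 (2 m - 1), and the difference is (2 m - 1) / 4.\<close>

lemma central_multinomial_upper:
  assumes d: "d = 2 * s + 1"
  shows "central_multinomial d q * (2 * real q + 1) ^ s \<le> real d ^ (q * d)"
proof (induction q)
  case (Suc q)
  define m where "m = real (Suc q)"
  have m: "m \<ge> 1" by (simp add: m_def)
  define P where "P = (\<Prod>i<s. (d * m - real (i + 1)) * (d * m - d + real (i + 1)))"
  have dm: "real d * m \<ge> real d" using m by (simp add: d)
  have "P \<le> (\<Prod>i<s. (real d)\<^sup>2 * (m - 1 / 2)\<^sup>2)"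
    unfolding P_def
  proof (rule prod_mono)
    fix i assume "i \<in> {..<s}"
    then have x: "0 \<le> real (i + 1)" "real (i + 1) \<le> real d" by (auto simp: d)
    then show "0 \<le> (d * m - real (i + 1)) * (d * m - d + real (i + 1)) \<and>
        (d * m - real (i + 1)) * (d * m - d + real (i + 1)) \<le> (real d)\<^sup>2 * (m - 1 / 2)\<^sup>2"
      using x dm by (intro conjI central_pair_bounds(2) mult_nonneg_nonneg) linarith+
  qed
  then have P: "P \<le> ((real d)\<^sup>2 * (m - 1 / 2)\<^sup>2) ^ s" by simp
  have "(m - 1 / 2)\<^sup>2 * (2 * m + 1) \<le> m\<^sup>2 * (2 * m - 1)"
  proof -
    have "m\<^sup>2 * (2 * m - 1) - (m - 1 / 2)\<^sup>2 * (2 * m + 1) = (2 * m - 1) / 4"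
      by (simp add: algebra_simps power2_eq_square)
    then show ?thesis using m by (smt (verit) divide_nonneg_pos)
  qed
  then have A: "((m - 1 / 2)\<^sup>2 * (2 * m + 1)) ^ s \<le> (m\<^sup>2 * (2 * m - 1)) ^ s"
    using m by (intro power_mono mult_nonneg_nonneg) auto
  have "central_multinomial d (Suc q) * (2 * m + 1) ^ s
      = central_multinomial d q * (d * m) / m ^ d * (P * (2 * m + 1) ^ s)"
    unfolding central_multinomial_Suc[OF d, of q] m_def[symmetric] P_def[symmetric] by simp
  also have "\<dots> \<le> central_multinomial d q * (d * m) / m ^ d * (((real d)\<^sup>2 * (m - 1 / 2)\<^sup>2) ^ s * (2 * m + 1) ^ s)"
    using P m central_multinomial_pos[of d q] by (intro mult_left_mono mult_right_mono) auto
  also have "\<dots> = central_multinomial d q * (d * m) / m ^ d * ((real d)\<^sup>2) ^ s * ((m - 1 / 2)\<^sup>2 * (2 * m + 1)) ^ s"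
    by (simp add: power_mult_distrib)
  also have "\<dots> \<le> central_multinomial d q * (d * m) / m ^ d * ((real d)\<^sup>2) ^ s * (m\<^sup>2 * (2 * m - 1)) ^ s"
    using A m central_multinomial_pos[of d q] by (intro mult_left_mono) auto
  also have "\<dots> = central_multinomial d q * (2 * real q + 1) ^ s * real d ^ d"
  proof -
    have "m ^ d = m * (m\<^sup>2) ^ s" "real d ^ d = real d * ((real d)\<^sup>2) ^ s"
      unfolding d by (simp_all flip: power_mult)
    moreover have "2 * m - 1 = 2 * real q + 1" by (simp add: m_def)
    ultimately show ?thesis using m by (simp only: power_mult_distrib) simp
  qed
  also have "\<dots> \<le> real d ^ (q * d) * real d ^ d" using Suc by (intro mult_right_mono) auto
  also have "\<dots> = real d ^ (Suc q * d)" by (simp add: power_add mult.commute)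
  finally show ?case by (simp add: m_def)
qed (simp add: central_multinomial_def)

text \<open>Each step multiplies by at least d^d ((m - 1) / m)^s, which telescopes. This is void at
  m = 1, so the induction starts at \<open>q = 1\<close>, and the extra \<open>real d ^ d\<close>
  pays for the start.\<close>

lemma central_multinomial_lower:
  assumes d: "d = 2 * s + 1" and "q \<ge> 1"
  shows "real d ^ (q * d) \<le> central_multinomial d q * real q ^ s * real d ^ d"
  using \<open>q \<ge> 1\<close>
proof (induction q rule: nat_induct_at_least)
  case base
  then show ?case
    using mult_right_mono[of 1 "fact d" "real d ^ d"] by (simp add: central_multinomial_def fact_ge_1)
next
  case (Suc q)
  define m where "m = real (Suc q)"
  have m: "m \<ge> 1" by (simp add: m_def)
  define P where "P = (\<Prod>i<s. (d * m - real (i + 1)) * (d * m - d + real (i + 1)))"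
  have "(\<Prod>i<s. (real d)\<^sup>2 * (m * (m - 1))) \<le> P"
    unfolding P_def
  proof (rule prod_mono)
    fix i assume "i \<in> {..<s}"
    then have x: "0 \<le> real (i + 1)" "real (i + 1) \<le> real d" by (auto simp: d)
    then show "0 \<le> (real d)\<^sup>2 * (m * (m - 1)) \<and>
        (real d)\<^sup>2 * (m * (m - 1)) \<le> (d * m - real (i + 1)) * (d * m - d + real (i + 1))"
      using central_pair_bounds(1)[OF x, of m] m by auto
  qed
  then have P: "((real d)\<^sup>2 * (m * (m - 1))) ^ s \<le> P" by simp
  have "central_multinomial d q * real q ^ s * real d ^ d
      = central_multinomial d q * (d * m) / m ^ d * ((real d)\<^sup>2 * (m * (m - 1))) ^ s * m ^ s"
  proof -
    have "m ^ d = m * m ^ s * m ^ s"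
      unfolding d mult_2 Suc_eq_plus1[symmetric] by (simp only: power_Suc power_add mult.assoc)
    moreover have "real d ^ d = real d * ((real d)\<^sup>2) ^ s" unfolding d by (simp flip: power_mult)
    moreover have "m - 1 = real q" by (simp add: m_def)
    ultimately show ?thesis using m by (simp only: power_mult_distrib) simp
  qed
  also have "\<dots> \<le> central_multinomial d q * (d * m) / m ^ d * P * m ^ s"
    using P m central_multinomial_pos[of d q] by (intro mult_left_mono mult_right_mono) auto
  also have "\<dots> = central_multinomial d (Suc q) * real (Suc q) ^ s"
    unfolding central_multinomial_Suc[OF d, of q] m_def[symmetric] P_def[symmetric] by simp
  finally have *: "central_multinomial d q * real q ^ s * real d ^ d \<le> central_multinomial d (Suc q) * real (Suc q) ^ s" .
  have "real d ^ (Suc q * d) = real d ^ (q * d) * real d ^ d" by (simp add: power_add mult.commute)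
  also have "\<dots> \<le> (central_multinomial d q * real q ^ s * real d ^ d) * real d ^ d"
    using Suc by (intro mult_right_mono) auto
  also have "\<dots> \<le> (central_multinomial d (Suc q) * real (Suc q) ^ s) * real d ^ d"
    using * by (intro mult_right_mono) auto
  finally show ?case .
qed

text \<open>The factorial is log-convex: multiplying the tangent inequalities at
  \<open>q = M div d\<close> over all parts bounds the denominator below by its balanced value. The
  remainder \<open>t\<close> costs only \<open>d ^ t\<close>, which is part of
  \<open>d ^ M\<close>.\<close>

lemma multinomial_upper:
  fixes l :: "nat \<Rightarrow> nat"
  assumes d: "d = 2 * s + 1" and M: "(\<Sum>i<d. l i) = M"
  shows "fact M / (\<Prod>i<d. fact (l i)) * (real M + 1) ^ s \<le> real d ^ s * real d ^ M"
proof -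
  define q t where "q = M div d" and "t = M mod d"
  have d0: "d > 0" by (simp add: d)
  have qt: "M = q * d + t" "t < d" using d0 by (simp_all add: q_def t_def)
  define x where "x = real q + 1"
  have x: "x > 0" by (simp add: x_def)
  have "(\<Prod>i<d. fact q * x ^ l i) \<le> (\<Prod>i<d. fact (l i) * x ^ q)"
    unfolding x_def by (intro prod_mono conjI fact_tangent) auto
  moreover have "(\<Prod>i<d. fact q * x ^ l i) = fact q ^ d * x ^ M"
    by (simp add: prod.distrib flip: M power_sum)
  moreover have "(\<Prod>i<d. fact (l i) * x ^ q) = (\<Prod>i<d. fact (l i)) * x ^ (q * d)"
    by (simp add: prod.distrib power_mult)
  ultimately have "fact q ^ d * x ^ t * x ^ (q * d) \<le> (\<Prod>i<d. fact (l i)) * x ^ (q * d)"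
    using qt(1) by (simp add: power_add mult_ac)
  then have L: "fact q ^ d * x ^ t \<le> (\<Prod>i<d. fact (l i))" using x by simp
  have Md: "real M + 1 \<le> d * x" 
  proof -
    have "M + 1 \<le> q * d + d" using qt by linarith
    then have "real (M + 1) \<le> real (q * d + d)" by (rule of_nat_mono)
    then show ?thesis by (simp add: x_def algebra_simps)
  qed
  have F: "fact M \<le> fact (q * d) * (d * x) ^ t"
  proof -
    have "fact M \<le> fact (q * d) * real M ^ t" unfolding qt(1) by (rule fact_add_le)
    also have "\<dots> \<le> fact (q * d) * (d * x) ^ t" using Md by (intro mult_left_mono power_mono) auto
    finally show ?thesis .
  qed
  have "fact M / (\<Prod>i<d. fact (l i)) \<le> (fact (q * d) * (d * x) ^ t) / (fact q ^ d * x ^ t)"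
    using L F x by (intro frac_le) auto
  also have "\<dots> = central_multinomial d q * d ^ t"
    using x by (simp add: central_multinomial_def power_mult_distrib)
  finally have "fact M / (\<Prod>i<d. fact (l i)) * (real M + 1) ^ s \<le> central_multinomial d q * d ^ t * (d * (2 * real q + 1)) ^ s"
  proof (rule mult_mono)
    have "real M + 1 \<le> d * (2 * real q + 1)"
      by (rule order_trans[OF Md]) (intro mult_left_mono, auto simp: x_def)
    then show "(real M + 1) ^ s \<le> (d * (2 * real q + 1)) ^ s" by (intro power_mono) auto
  qed (use central_multinomial_pos[of d q] in auto)
  also have "\<dots> = (central_multinomial d q * (2 * real q + 1) ^ s) * (real d ^ s * real d ^ t)"
    by (simp add: power_mult_distrib)
  also have "\<dots> \<le> real d ^ (q * d) * (real d ^ s * real d ^ t)"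
    using central_multinomial_upper[OF d] by (intro mult_right_mono) auto
  also have "\<dots> = real d ^ s * real d ^ M" by (simp add: qt(1) power_add)
  finally show ?thesis .
qed

text \<open>Compared with all parts equal to \<open>b\<close>, there are
  \<open>k \<le> d * e\<close> further units, each costing at most a factor
  \<open>1 + e / b\<close>. In total this is at most \<open>exp (d * \<kappa>)\<close>, so a window
  whose width is of order sqrt b loses only a constant.\<close>

lemma multinomial_lower:
  fixes l :: "nat \<Rightarrow> nat"
  assumes d: "d = 2 * s + 1" and M: "(\<Sum>i<d. l i) = M" and b: "b \<ge> 1"
    and l: "\<And>i. i < d \<Longrightarrow> b \<le> l i \<and> l i \<le> b + e" and e: "real e ^ 2 \<le> \<kappa> * real b"
  shows "exp (- (d * \<kappa>)) / real d ^ d * (real d ^ M / real M ^ s) \<le> fact M / (\<Prod>i<d. fact (l i))"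
proof -
  define k where "k = (\<Sum>i<d. l i - b)"
  have Mk: "M = b * d + k"
  proof -
    have "(\<Sum>i<d. l i) = (\<Sum>i<d. b + (l i - b))" using l by (intro sum.cong) auto
    then show ?thesis using M by (simp add: sum.distrib k_def)
  qed
  have ke: "k \<le> d * e"
  proof -
    have "k \<le> (\<Sum>i<d. e)" unfolding k_def using l by (intro sum_mono) force
    then show ?thesis by simp
  qed
  have "fact (l i) \<le> fact b * real (b + e) ^ (l i - b)" if "i < d" for i
  proof -
    have "fact (l i) \<le> fact b * real (l i) ^ (l i - b)"
      using fact_add_le[of b "l i - b"] l[OF that] by simp
    also have "\<dots> \<le> fact b * real (b + e) ^ (l i - b)"
      using l[OF that] by (intro mult_left_mono power_mono) auto
    finally show ?thesis .
  qed
  then have "(\<Prod>i<d. fact (l i)) \<le> (\<Prod>i<d. fact b * real (b + e) ^ (l i - b))"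
    by (intro prod_mono) auto
  also have "\<dots> = fact b ^ d * real (b + e) ^ k"
    by (simp add: prod.distrib k_def flip: power_sum)
  finally have L: "(\<Prod>i<d. fact (l i)) \<le> fact b ^ d * real (b + e) ^ k" .
  have F: "fact (b * d) * (real b * d) ^ k \<le> fact M"
  proof -
    have "fact (b * d) * (real b * d) ^ k \<le> fact (b * d) * (real (b * d) + 1) ^ k"
      by (intro mult_left_mono power_mono) auto
    also have "\<dots> \<le> fact M" unfolding Mk by (rule fact_add_ge)
    finally show ?thesis .
  qed
  have b0: "real b > 0" using b by simp
  have "(1 + real e / b) ^ k \<le> exp (real e / b) ^ k"
    by (intro power_mono exp_ge_add_one_self) (auto intro: add_nonneg_nonneg)
  also have "\<dots> = exp (k * (real e / b))" by (rule exp_of_nat_mult[symmetric])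
  also have "\<dots> \<le> exp (d * \<kappa>)"
  proof -
    have "k * (real e / b) \<le> (d * e) * (real e / b)"
      using ke by (intro mult_right_mono of_nat_mono) auto
    also have "\<dots> = d * (real e ^ 2 / b)" by (simp add: power2_eq_square)
    also have "\<dots> \<le> d * \<kappa>" using e b0 by (intro mult_left_mono) (auto simp: field_simps)
    finally show ?thesis by simp
  qed
  finally have E: "(1 + real e / b) ^ k \<le> exp (d * \<kappa>)" .
  have be: "real (b + e) ^ k = real b ^ k * (1 + real e / b) ^ k"
    using b0 by (simp add: field_simps flip: power_mult_distrib)
  have "exp (- (d * \<kappa>)) / real d ^ d * (real d ^ M / real M ^ s)
      \<le> exp (- (d * \<kappa>)) / real d ^ d * (real d ^ M / real b ^ s)"
  proof -
    have "b \<le> M" using Mk d by simp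
    then show ?thesis using b0 by (intro mult_left_mono divide_left_mono power_mono) (auto simp: d)
  qed
  also have "\<dots> = exp (- (d * \<kappa>)) * real d ^ k * (real d ^ (b * d) / (real b ^ s * real d ^ d))"
    by (simp add: Mk power_add mult_ac)
  also have "\<dots> \<le> exp (- (d * \<kappa>)) * real d ^ k * central_multinomial d b"
  proof (intro mult_left_mono)
    have "real d > 0" by (simp add: d)
    then show "real d ^ (b * d) / (real b ^ s * real d ^ d) \<le> central_multinomial d b"
      using central_multinomial_lower[OF d b] b0 by (simp add: pos_divide_le_eq mult.assoc)
  qed auto
  also have "\<dots> = central_multinomial d b * real d ^ k / exp (d * \<kappa>)" by (simp add: exp_minus divide_inverse)
  also have "\<dots> \<le> central_multinomial d b * real d ^ k / (1 + real e / b) ^ k"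
    using E b0 central_multinomial_pos[of d b]
    by (intro divide_left_mono) (auto intro!: mult_pos_pos zero_less_power add_pos_nonneg)
  also have "\<dots> = (fact (b * d) * (real b * d) ^ k) / (fact b ^ d * real (b + e) ^ k)"
    unfolding be using b0 by (simp add: central_multinomial_def power_mult_distrib)
  also have "\<dots> \<le> fact M / (\<Prod>i<d. fact (l i))"
    using L F by (intro frac_le) (auto intro: prod_pos)
  finally show ?thesis .
qed

section \<open>Moments of random words\<close>

definition words :: "nat \<Rightarrow> nat \<Rightarrow> nat list set" where
  "words d M = {x. set x \<subseteq> {..<d} \<and> length x = M}"

lemma finite_words [simp]: "finite (words d M)"
  by (simp add: words_def finite_lists_length_eq)

lemma sum_words_Suc: "(\<Sum>x\<in>words d (Suc M). F x) = (\<Sum>y<d. \<Sum>x\<in>words d M. F (y # x))"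
proof -
  have "words d (Suc M) = (\<lambda>(y, x). y # x) ` ({..<d} \<times> words d M)"
    by (auto simp: words_def length_Suc_conv image_iff)
  moreover have "inj_on (\<lambda>(y, x). y # x) ({..<d} \<times> words d M)" by (auto simp: inj_on_def)
  ultimately have "(\<Sum>x\<in>words d (Suc M). F x) = (\<Sum>(y, x)\<in>{..<d} \<times> words d M. F (y # x))"
    by (simp add: sum.reindex case_prod_unfold)
  then show ?thesis by (simp add: sum.cartesian_product)
qed

text \<open>A moment generating function: each letter contributes independently
  \<open>exp t\<close>, \<open>exp (- t)\<close> or, in d - 2 cases, 1.\<close>

lemma sum_words_exp:
  assumes "i < d" "j < d" "i \<noteq> j"
  shows "(\<Sum>x\<in>words d M. exp (t * (real (count_list x i) - real (count_list x j))))
    = (real d - 2 + exp t + exp (- t)) ^ M"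
proof (induction M)
  case 0
  have "words d 0 = {[]}" by (auto simp: words_def)
  then show ?case by simp
next
  case (Suc M)
  define h where "h = (\<lambda>y. if y = i then exp t else if y = j then exp (- t) else 1)"
  have h: "exp (t * (real (count_list (y # x) i) - real (count_list (y # x) j)))
      = h y * exp (t * (real (count_list x i) - real (count_list x j)))" for y x
    using assms by (auto simp: h_def algebra_simps simp flip: exp_add)
  have "(\<Sum>y<d. h y) = h i + (\<Sum>y\<in>{..<d}-{i}. h y)" using assms by (subst sum.remove[of _ i]) auto
  also have "(\<Sum>y\<in>{..<d}-{i}. h y) = h j + (\<Sum>y\<in>{..<d}-{i}-{j}. h y)"
    using assms by (subst sum.remove[of _ j]) auto
  also have "(\<Sum>y\<in>{..<d}-{i}-{j}. h y) = (\<Sum>y\<in>{..<d}-{i}-{j}. 1)"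
    by (intro sum.cong) (auto simp: h_def)
  also have "\<dots> = real d - 2" using assms by (simp add: of_nat_diff)
  finally have H: "(\<Sum>y<d. h y) = real d - 2 + exp t + exp (- t)" using assms by (simp add: h_def)
  have "(\<Sum>x\<in>words d (Suc M). exp (t * (real (count_list x i) - real (count_list x j))))
      = (\<Sum>y<d. h y * (\<Sum>x\<in>words d M. exp (t * (real (count_list x i) - real (count_list x j)))))"
    unfolding sum_words_Suc h by (simp add: sum_distrib_left)
  also have "\<dots> = (real d - 2 + exp t + exp (- t)) * (real d - 2 + exp t + exp (- t)) ^ M"
    unfolding Suc sum_distrib_right[symmetric] H ..
  finally show ?case by simp
qed

lemma power_le_fact_exp:
  assumes "(x::real) \<ge> 0" shows "x ^ n \<le> fact n * exp x"
proof -
  have "(\<Sum>k\<in>{n}. x ^ k /\<^sub>R fact k) \<le> (\<Sum>k. x ^ k /\<^sub>R fact k)"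
    using assms by (intro sum_le_suminf summable_exp_generic) auto
  then have "x ^ n / fact n \<le> exp x" by (simp add: exp_def divide_inverse mult.commute)
  then show ?thesis by (simp add: divide_le_eq mult.commute)
qed

lemma exp_add_exp_minus_le:
  assumes "0 \<le> t" "t \<le> (1::real)" shows "exp t + exp (- t) \<le> 2 + 2 * t\<^sup>2"
proof -
  have "exp t \<le> 1 + t + t\<^sup>2" using assms by (rule exp_bound)
  moreover have "exp (- t) \<le> 1 - t + t\<^sup>2"
  proof -
    have "(1 - t + t\<^sup>2) * (1 + t) \<ge> 1"
    proof -
      have "(1 - t + t\<^sup>2) * (1 + t) = 1 + t ^ 3" by (simp add: algebra_simps power2_eq_square power3_eq_cube)
      then show ?thesis using assms by simp
    qed
    moreover have "1 + t \<le> exp t" by (rule exp_ge_add_one_self)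
    moreover have "1 - t + t\<^sup>2 \<ge> 0" using assms by simp
    ultimately have "1 \<le> (1 - t + t\<^sup>2) * exp t" by (meson mult_left_mono order_trans)
    then have "1 / exp t \<le> 1 - t + t\<^sup>2" by (simp add: divide_le_eq)
    then show ?thesis by (simp add: exp_minus inverse_eq_divide)
  qed
  ultimately show ?thesis by simp
qed

text \<open>Exponential moments at the scale of the standard deviation: for t = 1 / sqrt M the
  generating function is at most \<open>exp 2 * real d ^ M\<close>, and an even power is dominated
  by a factorial times exponentials.\<close>

lemma words_moment_bound:
  assumes "i < d" "j < d" "i \<noteq> j" "M \<ge> 1"
  shows "(\<Sum>x\<in>words d M. (real (count_list x i) - real (count_list x j)) ^ (2 * m))
    \<le> 2 * exp 2 * fact (2 * m) * real M ^ m * real d ^ M"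
proof -
  define t where "t = 1 / sqrt (real M)"
  have M0: "real M > 0" using assms by simp
  have t: "0 < t" "t \<le> 1" "t\<^sup>2 = 1 / M" using assms(4) by (auto simp: t_def power_divide)
  have d2: "d \<ge> 2" using assms by linarith
  have E: "(\<Sum>x\<in>words d M. exp (u * (real (count_list x i) - real (count_list x j)))) \<le> exp 2 * real d ^ M"
    if "u = t \<or> u = - t" for u
  proof -
    have "(\<Sum>x\<in>words d M. exp (u * (real (count_list x i) - real (count_list x j))))
        = (real d - 2 + exp t + exp (- t)) ^ M"
      using that sum_words_exp[OF assms(1-3), where M = M and t = t]
        sum_words_exp[OF assms(1-3), where M = M and t = "- t"]
      by (auto simp: algebra_simps)
    also have "\<dots> \<le> (real d * exp (2 / M)) ^ M"
    proof (rule power_mono)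
      have "real d - 2 + exp t + exp (- t) \<le> real d + 2 * t\<^sup>2"
        using exp_add_exp_minus_le[of t] t by simp
      also have "\<dots> \<le> real d + real d * (2 / M)" using d2 M0 by (simp add: t(3) field_simps)
      also have "\<dots> = real d * (1 + 2 / M)" by (simp add: algebra_simps)
      also have "\<dots> \<le> real d * exp (2 / M)" by (intro mult_left_mono exp_ge_add_one_self) auto
      finally show "real d - 2 + exp t + exp (- t) \<le> real d * exp (2 / M)" .
      show "0 \<le> real d - 2 + exp t + exp (- t)" using d2 by (simp add: add_nonneg_nonneg)
    qed
    also have "\<dots> = exp 2 * real d ^ M"
      using M0 by (simp add: power_mult_distrib flip: exp_of_nat_mult)
    finally show ?thesis .
  qed
  have "z ^ (2 * m) \<le> fact (2 * m) * real M ^ m * (exp (t * z) + exp (- t * z))" for z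
  proof -
    have "(t * \<bar>z\<bar>) ^ (2 * m) \<le> fact (2 * m) * exp (t * \<bar>z\<bar>)"
      using t by (intro power_le_fact_exp) auto
    also have "\<dots> \<le> fact (2 * m) * (exp (t * z) + exp (- t * z))"
      by (intro mult_left_mono) (auto simp: abs_if)
    also have "(t * \<bar>z\<bar>) ^ (2 * m) = z ^ (2 * m) / real M ^ m"
      using t(3) by (simp add: power_mult_distrib power_mult power_divide)
    finally show ?thesis using M0 by (simp add: divide_le_eq mult_ac)
  qed
  then have "(\<Sum>x\<in>words d M. (real (count_list x i) - real (count_list x j)) ^ (2 * m))
    \<le> (\<Sum>x\<in>words d M. fact (2 * m) * real M ^ m *
        (exp (t * (real (count_list x i) - real (count_list x j))) + exp (- t * (real (count_list x i) - real (count_list x j)))))"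
    by (intro sum_mono)
  also have "\<dots> = fact (2 * m) * real M ^ m *
      ((\<Sum>x\<in>words d M. exp (t * (real (count_list x i) - real (count_list x j)))) +
       (\<Sum>x\<in>words d M. exp (- t * (real (count_list x i) - real (count_list x j)))))"
    unfolding sum_distrib_left[symmetric] sum.distrib ..
  also have "\<dots> \<le> fact (2 * m) * real M ^ m * (exp 2 * real d ^ M + exp 2 * real d ^ M)"
    by (intro mult_left_mono add_mono E) auto
  finally show ?thesis by (simp add: algebra_simps)
qed

text \<open>Every factor is at most the largest one. This crude bound separates the differences in a
  Vandermonde product, which are not independent.\<close>

lemma prod_le_sum_power:
  fixes u :: "'a \<Rightarrow> real"
  assumes "finite P" "P \<noteq> {}" "\<And>p. p \<in> P \<Longrightarrow> u p \<ge> 0"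
  shows "(\<Prod>p\<in>P. u p) \<le> (\<Sum>p\<in>P. u p ^ card P)"
proof -
  obtain p where p: "p \<in> P" "\<And>q. q \<in> P \<Longrightarrow> u q \<le> u p"
  proof -
    have "Max (u ` P) \<in> u ` P" using assms by (intro Max_in) auto
    then obtain p where "p \<in> P" "u p = Max (u ` P)" by auto
    then show ?thesis using that[of p] assms Max_ge[of "u ` P"] by auto
  qed
  have "(\<Prod>p\<in>P. u p) \<le> (\<Prod>q\<in>P. u p)" using p assms by (intro prod_mono) auto
  also have "\<dots> = u p ^ card P" by simp
  also have "\<dots> \<le> (\<Sum>p\<in>P. u p ^ card P)" using p assms by (intro member_le_sum) auto
  finally show ?thesis .
qed

lemma card_index_pairs: "card (SIGMA j:{..<d}. {..<j}) = d * (d - 1) div 2"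
  by (simp add: Sum_Ico_nat lessThan_atLeast0)

text \<open>There are \<open>B\<close> pairs of letters, so the squared product reduces to powers
  \<open>2 * B\<close> of single differences of letter counts. These have order sqrt M, hence
  \<open>M ^ B\<close>.\<close>

lemma vandermonde_moment_bound:
  assumes "d \<ge> 2" "M \<ge> 1"
  defines "B \<equiv> d * (d - 1) div 2"
  shows "(\<Sum>x\<in>words d M. (vandermonde d (\<lambda>i. real (count_list x i)))\<^sup>2)
    \<le> real B * (2 * exp 2 * fact (2 * B)) * real M ^ B * real d ^ M"
proof -
  define P where "P = (SIGMA j:{..<d}. {..<j})"
  have "(1, 0) \<in> P" using assms(1) by (simp add: P_def)
  then have P: "finite P" "card P = B" "P \<noteq> {}"
    unfolding P_def B_def card_index_pairs by auto
  define D where "D = (\<lambda>x (p::nat\<times>nat). real (count_list x (snd p)) - real (count_list x (fst p)))"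
  have "(vandermonde d (\<lambda>i. real (count_list x i)))\<^sup>2 = (\<Prod>p\<in>P. (D x p)\<^sup>2)" for x
    unfolding vandermonde_def P_def D_def
    by (subst prod.Sigma) (auto simp: case_prod_unfold prod_power_distrib)
  also have "\<dots> x \<le> (\<Sum>p\<in>P. (D x p) ^ (2 * B))" for x
    using prod_le_sum_power[OF P(1,3), of "\<lambda>p. (D x p)\<^sup>2"] P(2) by (simp add: power_mult)
  finally have "(\<Sum>x\<in>words d M. (vandermonde d (\<lambda>i. real (count_list x i)))\<^sup>2)
      \<le> (\<Sum>x\<in>words d M. \<Sum>p\<in>P. (D x p) ^ (2 * B))" by (intro sum_mono)
  also have "\<dots> = (\<Sum>p\<in>P. \<Sum>x\<in>words d M. (D x p) ^ (2 * B))" by (rule sum.swap)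
  also have "\<dots> \<le> (\<Sum>p\<in>P. 2 * exp 2 * fact (2 * B) * real M ^ B * real d ^ M)"
  proof (rule sum_mono)
    fix p assume "p \<in> P"
    then show "(\<Sum>x\<in>words d M. (D x p) ^ (2 * B)) \<le> 2 * exp 2 * fact (2 * B) * real M ^ B * real d ^ M"
      unfolding D_def using assms(2) by (intro words_moment_bound) (auto simp: P_def)
  qed
  also have "\<dots> = real B * (2 * exp 2 * fact (2 * B)) * real M ^ B * real d ^ M"
    using P(2) by simp
  finally show ?thesis .
qed

lemma card_words_content:
  fixes l :: "nat \<Rightarrow> nat"
  assumes "(\<Sum>i<d. l i) = M"
  shows "real (card {x \<in> words d M. \<forall>i<d. count_list x i = l i}) = fact M / (\<Prod>i<d. fact (l i))"
proof -
  define A where "A = (\<Sum>i<d. replicate_mset (l i) i)"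
  have cA: "count A i = (if i < d then l i else 0)" for i
    unfolding A_def count_sum by (auto simp: if_distrib sum.delta cong: if_cong)
  have sA: "size A = M" unfolding A_def assms[symmetric] by (induction d) auto
  have W: "{x \<in> words d M. \<forall>i<d. count_list x i = l i} = permutations_of_multiset A"
  proof (intro equalityI subsetI)
    fix x assume x: "x \<in> {x \<in> words d M. \<forall>i<d. count_list x i = l i}"
    have "mset x = A"
    proof (rule multiset_eqI)
      fix i show "count (mset x) i = count A i"
        using x by (cases "i < d") (auto simp: cA words_def count_mset count_list_0_iff)
    qed
    then show "x \<in> permutations_of_multiset A" by (rule permutations_of_multisetI)
  next
    fix x assume "x \<in> permutations_of_multiset A"
    then have m: "mset x = A" by (rule permutations_of_multisetD)
    have c: "count_list x i = count A i" for i unfolding m[symmetric] by (simp add: count_mset)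
    have "set x \<subseteq> {..<d}"
    proof
      fix i assume "i \<in> set x"
      then have "count_list x i \<noteq> 0" by (simp add: count_list_0_iff)
      then show "i \<in> {..<d}" using c cA by (auto split: if_splits)
    qed
    moreover have "length x = M" using m sA size_mset by metis
    ultimately show "x \<in> {x \<in> words d M. \<forall>i<d. count_list x i = l i}"
      using c cA by (simp add: words_def)
  qed
  have "card (permutations_of_multiset A) * (\<Prod>i<d. fact (l i)) = fact M"
  proof -
    have "(\<Prod>i<d. fact (l i)) = (\<Prod>i<d. fact (count A i) :: nat)" by (simp add: cA)
    also have "\<dots> = (\<Prod>i\<in>set_mset A. fact (count A i))"
    proof (rule prod.mono_neutral_right)
      show "set_mset A \<subseteq> {..<d}" using cA by (metis count_eq_zero_iff lessThan_iff subsetI)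
      show "\<forall>i\<in>{..<d} - set_mset A. fact (count A i) = (1::nat)" by (auto simp: not_in_iff)
    qed simp
    finally show ?thesis
      using card_permutations_of_multiset[of A] sA by simp
  qed
  then have e: "real (card (permutations_of_multiset A)) * (\<Prod>i<d. fact (l i)) = fact M"
    unfolding of_nat_eq_iff[where 'a = real, symmetric] of_nat_fact of_nat_mult of_nat_prod .
  have nz: "(\<Prod>i<d. fact (l i) :: real) \<noteq> 0" by simp
  show ?thesis unfolding W by (rule nonzero_eq_divide_eq[THEN iffD2, OF nz e])
qed

section \<open>The order of growth of the number of pairs of ballot words\<close>

lemma rising_weight_upper: "rising_weight r n \<le> 1 / (real n + 1) ^ r"
proof -
  have "fact n * (real n + 1) ^ r \<le> fact (n + r)" by (rule fact_add_ge)
  then show ?thesis by (simp add: rising_weight_def divide_le_eq mult.commute field_simps)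
qed

lemma rising_weight_lower: "1 / (real n + 1) ^ r \<le> (real r + 1) ^ r * rising_weight r n"
proof -
  have "fact (n + r) \<le> fact n * real (n + r) ^ r" by (rule fact_add_le)
  also have "\<dots> \<le> fact n * ((real r + 1) * (real n + 1)) ^ r"
    by (intro mult_left_mono power_mono) (auto simp: algebra_simps)
  finally have "fact (n + r) \<le> fact n * ((real r + 1) ^ r * (real n + 1) ^ r)"
    by (simp add: power_mult_distrib)
  then show ?thesis by (simp add: rising_weight_def divide_simps mult_ac)
qed

lemma rising_weight_add: "rising_weight (p + q) n = rising_weight p n * rising_weight q (n + p)"
  by (simp add: rising_weight_def add.assoc)

definition ballot_pair_count :: "nat \<Rightarrow> nat \<Rightarrow> real" where
  "ballot_pair_count d n = (\<Sum>c\<in>partitions d n. real (card (ballot_words c)) ^ 2)"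

context
  fixes d s B :: nat
  assumes d: "d = 2 * s + 1" and s: "s \<ge> 1" and B: "B = d * s"
begin

lemma B_eq: "B = d * (d - 1) div 2"
  by (simp add: B d)

lemma sum_shifted_nat:
  assumes "c \<in> partitions d n"
  shows "(\<Sum>i<d. shifted d c i) = n + B"
proof -
  have "real (\<Sum>i<d. shifted d c i) = real n + real d * (real d - 1) / 2"
    using sum_shifted[of d c] assms by (simp add: partitions_def del: of_nat_sum)
  also have "real d * (real d - 1) / 2 = real B" by (simp add: B d algebra_simps)
  finally show ?thesis by (metis of_nat_add of_nat_eq_iff)
qed

text \<open>Writing n! as \<open>rising_weight B n\<close> times (n + B)! exposes the multinomial
  coefficient of the shifted parts, whose sum is n + B.\<close>

lemma card_ballot_words_multinomial:
  assumes "c \<in> partitions d n"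
  shows "real (card (ballot_words c)) = rising_weight B n *
    (fact (n + B) / (\<Prod>i<d. fact (shifted d c i))) * vandermonde d (\<lambda>i. real (shifted d c i))"
  using card_ballot_words[OF assms] by (simp add: rising_weight_def)

text \<open>In the squared count one multinomial coefficient is replaced by its maximal order d^M /
  M^s. The other one is the number of words whose letter counts are the shifted parts, so what
  remains is part of the second moment of the Vandermonde product over all words.\<close>

lemma ballot_pair_count_upper:
  "\<exists>C. \<forall>n. ballot_pair_count d n \<le> C * (real d ^ 2) ^ n * rising_weight (B + s) n"
proof (rule exI, rule allI)
  fix n
  define M where "M = n + B"
  define K where "K = real B * (2 * exp 2 * fact (2 * B))"
  define mu where "mu = (\<lambda>c. fact M / (\<Prod>i<d. fact (shifted d c i)) :: real)"
  define V where "V = (\<lambda>c. vandermonde d (\<lambda>i. real (shifted d c i)))"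
  define W where "W = (\<lambda>c. {x \<in> words d M. \<forall>i<d. count_list x i = shifted d c i})"
  define w where "w = rising_weight B n"
  have B1: "B \<ge> 1" using s by (simp add: B d)
  then have M1: "M \<ge> 1" by (simp add: M_def)
  have mu0: "mu c \<ge> 0" for c unfolding mu_def by (intro divide_nonneg_nonneg prod_nonneg) auto
  have mu_le: "mu c \<le> real d ^ s * real d ^ M / (real M + 1) ^ s" if "c \<in> partitions d n" for c
    using multinomial_upper[OF d sum_shifted_nat[OF that]] by (simp add: mu_def M_def pos_le_divide_eq)
  have "(\<Sum>c\<in>partitions d n. mu c * (V c)\<^sup>2) = (\<Sum>c\<in>partitions d n. \<Sum>x\<in>W c. (vandermonde d (\<lambda>i. real (count_list x i)))\<^sup>2)"
  proof (rule sum.cong)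
    fix c assume c: "c \<in> partitions d n"
    have "(\<Sum>x\<in>W c. (vandermonde d (\<lambda>i. real (count_list x i)))\<^sup>2) = (\<Sum>x\<in>W c. (V c)\<^sup>2)"
    proof (rule sum.cong)
      fix x assume "x \<in> W c"
      then show "(vandermonde d (\<lambda>i. real (count_list x i)))\<^sup>2 = (V c)\<^sup>2"
        unfolding V_def vandermonde_def W_def
        by (intro arg_cong[where f = "\<lambda>x. x\<^sup>2"] prod.cong) auto
    qed simp
    also have "\<dots> = mu c * (V c)\<^sup>2"
      using card_words_content[OF sum_shifted_nat[OF c]] by (simp add: W_def mu_def M_def)
    finally show "mu c * (V c)\<^sup>2 = (\<Sum>x\<in>W c. (vandermonde d (\<lambda>i. real (count_list x i)))\<^sup>2)" ..
  qed simp
  also have "\<dots> = (\<Sum>x\<in>(\<Union>c\<in>partitions d n. W c). (vandermonde d (\<lambda>i. real (count_list x i)))\<^sup>2)"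
  proof (rule sum.UNION_disjoint[symmetric])
    show "\<forall>c\<in>partitions d n. \<forall>c'\<in>partitions d n. c \<noteq> c' \<longrightarrow> W c \<inter> W c' = {}"
    proof (intro ballI impI)
      fix c c' assume c: "c \<in> partitions d n" "c' \<in> partitions d n" "c \<noteq> c'"
      then obtain i where i: "c i \<noteq> c' i" by auto
      then have "i < d" using c by (metis (mono_tags, lifting) mem_Collect_eq not_le partitions_def)
      moreover have "shifted d c i \<noteq> shifted d c' i" using i by (simp add: shifted_def)
      ultimately show "W c \<inter> W c' = {}" by (auto simp: W_def)
    qed
  qed (auto simp: W_def)
  also have "\<dots> \<le> (\<Sum>x\<in>words d M. (vandermonde d (\<lambda>i. real (count_list x i)))\<^sup>2)"
    by (intro sum_mono2) (auto simp: W_def)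
  also have "\<dots> \<le> K * real M ^ B * real d ^ M"
    using vandermonde_moment_bound[of d M] s M1 unfolding B_eq[symmetric] K_def by (simp add: d)
  finally have S: "(\<Sum>c\<in>partitions d n. mu c * (V c)\<^sup>2) \<le> K * real M ^ B * real d ^ M" .
  have "ballot_pair_count d n = (\<Sum>c\<in>partitions d n. w\<^sup>2 * (mu c * (mu c * (V c)\<^sup>2)))"
    unfolding ballot_pair_count_def
    by (intro sum.cong refl)
      (simp add: card_ballot_words_multinomial mu_def V_def w_def M_def power_mult_distrib power2_eq_square mult_ac)
  also have "\<dots> \<le> (\<Sum>c\<in>partitions d n. w\<^sup>2 * (real d ^ s * real d ^ M / (real M + 1) ^ s * (mu c * (V c)\<^sup>2)))"
    using mu_le mu0 by (intro sum_mono mult_left_mono mult_right_mono) auto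
  also have "\<dots> = w\<^sup>2 * (real d ^ s * real d ^ M / (real M + 1) ^ s) * (\<Sum>c\<in>partitions d n. mu c * (V c)\<^sup>2)"
    unfolding sum_distrib_left by (simp only: mult.assoc)
  also have "\<dots> \<le> w\<^sup>2 * (real d ^ s * real d ^ M / (real M + 1) ^ s) * (K * real M ^ B * real d ^ M)"
    using S by (intro mult_left_mono) auto
  also have "\<dots> = (K * real d ^ s) * real d ^ M * real d ^ M * (w * (w * real M ^ B)) * (1 / (real M + 1) ^ s)"
    by (simp add: power2_eq_square)
  also have "\<dots> \<le> (K * real d ^ s) * real d ^ M * real d ^ M * (w * (real B + 1) ^ B) * ((real s + 1) ^ s * rising_weight s M)"
  proof (intro mult_mono rising_weight_lower order_refl)
    have "w * real M ^ B \<le> 1 / (real n + 1) ^ B * ((real B + 1) * (real n + 1)) ^ B"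
      unfolding w_def by (intro mult_mono rising_weight_upper power_mono) (auto simp: M_def algebra_simps)
    also have "\<dots> = (real B + 1) ^ B"
    proof -
      have "(real n + 1) ^ B \<noteq> 0" by simp
      then show ?thesis by (simp add: power_mult_distrib)
    qed
    finally show "w * real M ^ B \<le> (real B + 1) ^ B" .
  qed (auto simp: K_def w_def less_imp_le[OF rising_weight_pos])
  also have "\<dots> = (K * real d ^ s * real d ^ B * real d ^ B * (real B + 1) ^ B * (real s + 1) ^ s)
      * (real d ^ 2) ^ n * rising_weight (B + s) n"
    by (simp add: rising_weight_add w_def M_def power_add power2_eq_square power_mult_distrib mult_ac)
  finally show "ballot_pair_count d n \<le> (real B * (2 * exp 2 * fact (2 * B)) * real d ^ s * real d ^ B * real d ^ B * (real B + 1) ^ B * (real s + 1) ^ s)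
      * (real d ^ 2) ^ n * rising_weight (B + s) n" unfolding K_def .
qed

lemma ex_nat_sqrt: "\<exists>h::nat. h * h \<le> M \<and> M < Suc h * Suc h"
proof (induction M)
  case (Suc M)
  then obtain h where h: "h * h \<le> M" "M < Suc h * Suc h" by blast
  show ?case
  proof (cases "Suc M < Suc h * Suc h")
    case True
    then show ?thesis using h by (intro exI[of _ h]) auto
  next
    case False
    then have "Suc M = Suc h * Suc h" using h by linarith
    then show ?thesis by (intro exI[of _ "Suc h"]) auto
  qed
qed (auto intro: exI[of _ 0])

text \<open>
  The lower bound comes from shapes whose shifted parts lie in disjoint windows of width about
  \<open>\<surd>M\<close> around \<open>M / d\<close>: all but the last part are free in their windows.
\<close>

lemma ballot_words_near_balanced:
  fixes M h :: nat
  assumes M: "M = n + B" and h: "h * h \<le> M" "M < Suc h * Suc h" "7 * d ^ 3 \<le> h"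
  defines "k1 \<equiv> exp (- (d * (144 * real d ^ 5))) / real d ^ d"
  shows "\<exists>S. S \<subseteq> partitions d n \<and> card S = Suc h ^ (2 * s) \<and>
    (\<forall>c\<in>S. rising_weight B n * (k1 * (real d ^ M / real M ^ s)) * real h ^ B \<le> real (card (ballot_words c)))"
proof -
  define q where "q = M div d"
  define X where "X = PiE {..<2 * s} (\<lambda>_. {..h})"
  define E where "E = (\<lambda>x. \<Sum>i<2 * s. 2 * h * (d - i) + x i)"
  \<comment> \<open>Window \<open>i\<close> starts at \<open>q + 2 * h * (d - i)\<close> and has
    width \<open>h\<close>, so consecutive windows are at least \<open>h\<close> apart. The last
    part takes what is missing from \<open>M\<close> and falls below \<open>q\<close> by at most
    \<open>E x\<close>.\<close>
  define L where "L = (\<lambda>x i. if i < 2 * s then q + 2 * h * (d - i) + x i else M - (2 * s * q + E x))"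
  define C where "C = (\<lambda>x i. if i < d then L x i - (d - Suc i) else 0)"
  \<comment> \<open>The subtracted amount bounds \<open>E x\<close>, so no part is smaller than
    \<open>b\<close>; all of them lie between \<open>b\<close> and b + 6 d^2 h.\<close>
  define b where "b = q - 3 * d\<^sup>2 * h"
  have d3: "d \<ge> 3" using s by (simp add: d)
  have h_d: "d \<le> h" 
  proof -
    have "d \<le> d ^ 3" using d3 by (intro self_le_power) auto
    then show ?thesis using h(3) by linarith
  qed
  \<comment> \<open>The threshold on \<open>h\<close> is chosen for this: it keeps \<open>b\<close>
    positive and comparable with \<open>q\<close>, although the windows spread over a multiple of
    \<open>h\<close>.\<close>
  have q_big: "7 * d\<^sup>2 * h \<le> q"
  proof -
    have "7 * d\<^sup>2 * h * d = 7 * d ^ 3 * h" by (simp add: power3_eq_cube power2_eq_square)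
    also have "\<dots> \<le> M" using mult_le_mono1[OF h(3), of h] h(1) by linarith
    finally show ?thesis unfolding q_def using d3 by (simp add: less_eq_div_iff_mult_less_eq)
  qed
  have dh: "d\<^sup>2 * h \<ge> d * h" "d\<^sup>2 * h \<ge> h" "d * h \<ge> h" using d3 by (simp_all add: power2_eq_square)
  have b: "b + 3 * d\<^sup>2 * h = q" "b \<ge> 4 * d\<^sup>2 * h" using q_big by (auto simp: b_def)
  define t where "t = M mod d"
  have t: "M = 2 * s * q + q + t" "t < d"
  proof -
    have "M = d * q + t" by (simp add: q_def t_def)
    then show "M = 2 * s * q + q + t" by (simp add: d)
    show "t < d" using d3 by (simp add: t_def)
  qed
  have x_le: "x i \<le> h" if "x \<in> X" "i < 2 * s" for x i using that by (auto simp: X_def PiE_iff)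
  have E_upper: "E x \<le> 3 * d\<^sup>2 * h" if "x \<in> X" for x
  proof -
    have "E x \<le> (\<Sum>i<2 * s. 2 * h * d + h)"
      unfolding E_def using x_le[OF that] by (intro sum_mono add_mono mult_left_mono) auto
    also have "\<dots> = 2 * s * (2 * d + 1) * h" by (simp add: algebra_simps)
    also have "\<dots> \<le> 3 * d\<^sup>2 * h"
      unfolding d by (intro mult_right_mono) (simp_all add: power2_eq_square algebra_simps)
    finally show ?thesis .
  qed
  have E_lower: "4 * h \<le> E x" for x
  proof -
    have "2 * h * (d - 0) + x 0 \<le> E x"
      unfolding E_def by (rule member_le_sum[of 0 _ "\<lambda>i. 2 * h * (d - i) + x i"]) (use s in auto)
    moreover have "2 * h * 2 \<le> 2 * h * (d - 0)" using d3 by (intro mult_left_mono) auto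
    ultimately show ?thesis by linarith
  qed
  have L_low: "b \<le> L x i" if "x \<in> X" for x i
    using E_upper[OF that] b t by (auto simp: L_def)
  have L_high: "L x i \<le> b + 6 * d\<^sup>2 * h" if "x \<in> X" "i < d" for x i
  proof (cases "i < 2 * s")
    case True
    have "2 * h * (d - i) + x i \<le> 2 * h * d + h" using x_le[OF that(1) True] by (intro add_mono mult_left_mono) auto
    also have "\<dots> \<le> 3 * d\<^sup>2 * h"
    proof -
      have "2 * h * d = 2 * (d * h)" "3 * d\<^sup>2 * h = 3 * (d\<^sup>2 * h)" by simp_all
      then show ?thesis using dh by linarith
    qed
    finally show ?thesis using True b by (simp add: L_def)
  next
    case False
    then have "L x i \<le> q" using E_lower[of x] t h_d by (simp add: L_def)
    then show ?thesis using b by simp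
  qed
  have gap: "L x (Suc i) + h \<le> L x i" if x: "x \<in> X" and "Suc i < d" for x i
  proof (cases "Suc i < 2 * s")
    case True
    have "d - i = Suc (d - Suc i)" using that(2) by simp
    then have "2 * h * (d - i) = 2 * h * (d - Suc i) + 2 * h" by simp
    then show ?thesis using True x_le[OF x True] by (simp add: L_def)
  next
    case False
    then have i: "i < 2 * s" "\<not> Suc i < 2 * s" using that(2) by (auto simp: d)
    have "7 * (d\<^sup>2 * h) \<le> q" using q_big by (simp only: mult.assoc)
    then have "h \<le> q" using dh by linarith
    then have "L x (Suc i) + h \<le> q" using i E_lower[of x] t h_d by (simp add: L_def)
    also have "q \<le> L x i" using i by (simp add: L_def)
    finally show ?thesis .
  qed
  have gap': "L x j + h \<le> L x i" if x: "x \<in> X" and "i < j" "j < d" for x i j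
    using \<open>i < j\<close> \<open>j < d\<close>
  proof (induction j)
    case (Suc j)
    show ?case
    proof (cases "i = j")
      case True
      then show ?thesis using gap[OF x] Suc.prems by simp
    next
      case False
      then show ?thesis using gap[OF x, of j] Suc by simp
    qed
  qed simp
  \<comment> \<open>This makes the truncated subtraction in \<open>C\<close> exact.\<close>
  have bd: "d \<le> b"
    using b(2) dh h_d by linarith
  have shC: "shifted d (C x) i = L x i" if "x \<in> X" "i < d" for x i
    using L_low[OF that(1), of i] bd that(2) by (simp add: shifted_def C_def)
  have sumL: "(\<Sum>i<d. L x i) = M" if "x \<in> X" for x
  proof -
    have "(\<Sum>i<d. L x i) = (\<Sum>i<2 * s. L x i) + L x (2 * s)" by (simp add: d)
    also have "(\<Sum>i<2 * s. L x i) = (\<Sum>i<2 * s. q + (2 * h * (d - i) + x i))"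
      by (intro sum.cong) (auto simp: L_def)
    also have "\<dots> = 2 * s * q + E x" by (simp add: sum.distrib E_def)
    also have "L x (2 * s) = M - (2 * s * q + E x)" by (simp add: L_def)
    finally show ?thesis using E_upper[OF that] b t by simp
  qed
  have part: "C x \<in> partitions d n" if x: "x \<in> X" for x
  proof -
    have "is_part (C x)"
      unfolding is_part_def
    proof
      fix i
      show "C x (Suc i) \<le> C x i"
        using gap[OF x, of i] h_d d3 L_low[OF x, of i] bd by (auto simp: C_def)
    qed
    moreover have "(\<Sum>i<d. C x i) = n"
    proof -
      have "(\<Sum>i<d. shifted d (C x) i) = M" using sumL[OF x] shC[OF x] by simp
      moreover have "real (\<Sum>i<d. shifted d (C x) i) = real (\<Sum>i<d. C x i) + real B"
        unfolding sum_shifted by (simp add: B d algebra_simps)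
      ultimately have "real M = real (\<Sum>i<d. C x i) + real B" by (simp only:)
      then have "real (\<Sum>i<d. C x i) = real n" unfolding M by (simp only: of_nat_add add_right_cancel)
      then show ?thesis by (simp only: of_nat_eq_iff)
    qed
    ultimately show ?thesis by (simp add: partitions_def C_def)
  qed
  have inj: "inj_on C X"
  proof (rule inj_onI)
    fix x y assume x: "x \<in> X" "y \<in> X" "C x = C y"
    show "x = y"
    proof (rule PiE_ext[OF x(1,2)[unfolded X_def]])
      fix i assume i: "i \<in> {..<2 * s}"
      then have "i < d" by (simp add: d)
      then have "L x i = L y i" using shC x by metis
      then show "x i = y i" using i by (simp add: L_def)
    qed
  qed
  have k1: "k1 \<ge> 0" by (simp add: k1_def)
  have bound: "rising_weight B n * (k1 * (real d ^ M / real M ^ s)) * real h ^ B \<le> real (card (ballot_words (C x)))"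
    if x: "x \<in> X" for x
  proof -
    have b1: "b \<ge> 1" using bd d3 by simp
    \<comment> \<open>Origin of the constant 144 d^5: the square is 36 d^4 h^2, and h^2 is at most
      M, which is at most 4 b d.\<close>
    have "real (6 * d\<^sup>2 * h) ^ 2 \<le> 144 * real d ^ 5 * real b"
    proof -
      have "2 * q \<le> 4 * b" using b dh by simp
      moreover have "M \<le> 2 * q * d"
      proof -
        have "M = q * d + t" using t by (simp add: d algebra_simps)
        moreover have "t \<le> q * d"
          using t(2) d3 b bd by (metis le_add1 le_trans less_imp_le mult.commute mult_le_mono1 nat_mult_1 b1)
        ultimately have "M \<le> 2 * (q * d)" by linarith
        then show ?thesis by (simp only: mult.assoc)
      qed
      ultimately have "M \<le> 4 * b * d" by (meson le_trans mult_le_mono1)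
      then have "h * h \<le> 4 * b * d" using h(1) by simp
      then have "36 * d ^ 4 * (h * h) \<le> 36 * d ^ 4 * (4 * b * d)" by (rule mult_le_mono2)
      then have "(6 * d\<^sup>2 * h) ^ 2 \<le> 144 * d ^ 5 * b"
      proof -
        have "(6 * d\<^sup>2 * h) ^ 2 = 36 * (d\<^sup>2 * d\<^sup>2) * (h * h)" by (simp add: power2_eq_square)
        moreover have "d\<^sup>2 * d\<^sup>2 = d ^ 4" by (simp flip: power_add)
        moreover have "d ^ 5 = d ^ 4 * d" by (simp add: eval_nat_numeral)
        ultimately show ?thesis using \<open>36 * d ^ 4 * (h * h) \<le> _\<close> by (simp add: mult_ac)
      qed
      then have "real ((6 * d\<^sup>2 * h) ^ 2) \<le> real (144 * d ^ 5 * b)" by (simp only: of_nat_le_iff)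
      then show ?thesis by simp
    qed
    from multinomial_lower[OF d sumL[OF x] b1 _ this] L_low[OF x] L_high[OF x]
    have m: "k1 * (real d ^ M / real M ^ s) \<le> fact M / (\<Prod>i<d. fact (L x i))" by (simp add: k1_def)
    have v: "real h ^ B \<le> vandermonde d (\<lambda>i. real (L x i))"
    proof -
      have "(\<Sum>j<d. j) = B" unfolding B_eq by (simp add: lessThan_atLeast0 Sum_Ico_nat)
      then have "real h ^ B = (\<Prod>j<d. \<Prod>i<j. real h)" by (simp flip: power_sum)
      also have "\<dots> \<le> vandermonde d (\<lambda>i. real (L x i))"
        unfolding vandermonde_def
      proof (intro prod_mono conjI)
        fix j i assume "j \<in> {..<d}" "i \<in> {..<j}"
        then have "L x j + h \<le> L x i" using gap'[OF x, of i j] by simp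
        then have "real (L x j + h) \<le> real (L x i)" by (simp only: of_nat_le_iff)
        then show "real h \<le> real (L x i) - real (L x j)" by simp
      qed (auto intro: prod_nonneg)
      finally show ?thesis .
    qed
    have e: "(\<Prod>i<d. fact (shifted d (C x) i)) = (\<Prod>i<d. fact (L x i) :: real)"
      using shC[OF x] by simp
    have e': "vandermonde d (\<lambda>i. real (shifted d (C x) i)) = vandermonde d (\<lambda>i. real (L x i))"
      unfolding vandermonde_def by (intro prod.cong refl) (simp add: shC[OF x])
    have "rising_weight B n * (k1 * (real d ^ M / real M ^ s)) * real h ^ B
        \<le> rising_weight B n * (fact M / (\<Prod>i<d. fact (L x i))) * vandermonde d (\<lambda>i. real (L x i))"
      using m v less_imp_le[OF rising_weight_pos] k1
      by (intro mult_mono) (auto intro!: mult_nonneg_nonneg divide_nonneg_nonneg prod_nonneg)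
    then show ?thesis unfolding card_ballot_words_multinomial[OF part[OF x]] e e' M[symmetric] .
  qed
  show ?thesis
  proof (intro exI[of _ "C ` X"] conjI)
    show "C ` X \<subseteq> partitions d n" using part by blast
    show "card (C ` X) = Suc h ^ (2 * s)" unfolding card_image[OF inj] by (simp add: X_def card_PiE)
    show "\<forall>c\<in>C ` X. rising_weight B n * (k1 * (real d ^ M / real M ^ s)) * real h ^ B \<le> real (card (ballot_words c))"
      using bound by blast
  qed
qed

text \<open>There are (h + 1)^(2 s) > M^s shapes, each with multinomial coefficient of order d^M /
  M^s and Vandermonde product at least h^B, where h has order sqrt M. The squares therefore add up
  to order d^(2 M) n^(-2 B) M^(B - s), which matches the upper bound.\<close>

lemma ballot_pair_count_lower:
  "\<exists>c>0. \<exists>n0. \<forall>n\<ge>n0. c * (real d ^ 2) ^ n * rising_weight (B + s) n \<le> ballot_pair_count d n"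
proof -
  define k1 where "k1 = exp (- (d * (144 * real d ^ 5))) / real d ^ d"
  have d0: "real d > 0" by (simp add: d)
  have k1: "k1 > 0" using d0 by (simp add: k1_def)
  \<comment> \<open>\<open>4 ^ B\<close> comes from M being at most 4 h^2, and
    \<open>(real B + 1) ^ B\<close> from \<open>rising_weight_lower\<close>.\<close>
  define c where "c = k1\<^sup>2 * (real d ^ 2) ^ B / (4 ^ B * (real B + 1) ^ B)"
  have "c * (real d ^ 2) ^ n * rising_weight (B + s) n \<le> ballot_pair_count d n"
    if n: "n \<ge> (7 * d ^ 3 + 1) * (7 * d ^ 3 + 1)" for n
  proof -
    define M where "M = n + B"
    define w where "w = rising_weight B n"
    have w0: "w > 0" by (simp add: w_def rising_weight_pos)
    obtain h where h: "h * h \<le> M" "M < Suc h * Suc h" using ex_nat_sqrt by blast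
    have h_big: "7 * d ^ 3 \<le> h"
    proof (rule ccontr)
      assume "\<not> 7 * d ^ 3 \<le> h"
      then have "Suc h \<le> 7 * d ^ 3" by simp
      then have "Suc h * Suc h \<le> 7 * d ^ 3 * (7 * d ^ 3)" by (rule mult_le_mono[OF _ ]) (use \<open>Suc h \<le> 7 * d ^ 3\<close> in simp)
      then show False using h n by (simp add: M_def)
    qed
    then have h1: "h \<ge> 1" using d0 by (metis One_nat_def Suc_leI bot_nat_0.not_eq_extremum le_zero_eq mult_eq_0_iff of_nat_0_less_iff power_not_zero zero_neq_numeral)
    have B1: "B \<ge> 1" using s by (simp add: B d)
    have M0: "real M > 0" using B1 by (simp add: M_def)
    obtain S where S: "S \<subseteq> partitions d n" "card S = Suc h ^ (2 * s)"
      "\<forall>c\<in>S. w * (k1 * (real d ^ M / real M ^ s)) * real h ^ B \<le> real (card (ballot_words c))"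
      using ballot_words_near_balanced[OF M_def h h_big] unfolding k1_def w_def by blast
    define z where "z = w * (k1 * (real d ^ M / real M ^ s)) * real h ^ B"
    have z0: "z \<ge> 0" unfolding z_def using w0 k1 by simp
    have H: "real M \<le> (real (Suc h))\<^sup>2" "real M \<le> 4 * (real h)\<^sup>2"
    proof -
      have "real M \<le> real (Suc h * Suc h)" using h(2) by (intro of_nat_mono) simp
      then show A: "real M \<le> (real (Suc h))\<^sup>2" by (simp only: of_nat_mult power2_eq_square)
      have "real (Suc h) \<le> 2 * real h" using h1 by simp
      then have "(real (Suc h))\<^sup>2 \<le> (2 * real h)\<^sup>2" by (intro power_mono) auto
      then show "real M \<le> 4 * (real h)\<^sup>2" using A by (simp add: power_mult_distrib)
    qed
    have "c * (real d ^ 2) ^ n * rising_weight (B + s) n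
        = w * (1 / (real B + 1) ^ B) * (k1\<^sup>2 * (real d ^ M)\<^sup>2) / 4 ^ B * rising_weight s M"
      by (simp add: c_def rising_weight_add w_def M_def power_add power_mult_distrib power_mult[symmetric] mult_ac power2_eq_square flip: power_even_eq)
    also have "\<dots> \<le> w * (w * real M ^ B) * (k1\<^sup>2 * (real d ^ M)\<^sup>2) / 4 ^ B * (1 / real M ^ s)"
    proof (intro mult_mono divide_right_mono)
      have "1 = 1 / (real n + 1) ^ B * (real n + 1) ^ B" by simp
      also have "\<dots> \<le> ((real B + 1) ^ B * w) * real M ^ B"
        unfolding w_def using B1 less_imp_le[OF rising_weight_pos]
        by (intro mult_mono rising_weight_lower power_mono) (auto simp: M_def)
      finally show "1 / (real B + 1) ^ B \<le> w * real M ^ B"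
        by (simp add: divide_le_eq mult_ac add_pos_pos)
      have "rising_weight s M \<le> 1 / (real M + 1) ^ s" by (rule rising_weight_upper)
      also have "\<dots> \<le> 1 / real M ^ s" using M0 by (intro divide_left_mono power_mono) auto
      finally show "rising_weight s M \<le> 1 / real M ^ s" .
    qed (use w0 less_imp_le[OF rising_weight_pos] in auto)
    also have "\<dots> = real M ^ s * (w\<^sup>2 * (k1\<^sup>2 * ((real d ^ M)\<^sup>2 / (real M ^ s)\<^sup>2)) * (real M ^ B / 4 ^ B))"
      using M0 by (simp add: power2_eq_square mult_ac)
    also have "\<dots> \<le> ((real (Suc h))\<^sup>2) ^ s * (w\<^sup>2 * (k1\<^sup>2 * ((real d ^ M)\<^sup>2 / (real M ^ s)\<^sup>2)) * ((4 * (real h)\<^sup>2) ^ B / 4 ^ B))"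
      using H w0 k1 by (intro mult_mono power_mono divide_right_mono) auto
    also have "\<dots> = real (Suc h) ^ (2 * s) * z\<^sup>2"
      by (simp add: z_def power_mult_distrib power_divide power_even_eq mult_ac flip: power_mult)
    also have "\<dots> = (\<Sum>c\<in>S. z\<^sup>2)" using S(2) by simp
    also have "\<dots> \<le> (\<Sum>c\<in>S. real (card (ballot_words c)) ^ 2)"
      using S(3) z0 by (intro sum_mono power_mono) (auto simp: z_def)
    also have "\<dots> \<le> ballot_pair_count d n"
      unfolding ballot_pair_count_def using S(1) by (intro sum_mono2) auto
    finally show ?thesis .
  qed
  moreover have "c > 0" unfolding c_def using k1 d0 by (intro divide_pos_pos mult_pos_pos zero_less_power) auto
  ultimately show ?thesis by blast
qed

end

section \<open>Splitting permutations\<close>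

definition has_inc :: "nat list \<Rightarrow> nat \<Rightarrow> bool" where
  "has_inc p l \<longleftrightarrow> (\<exists>xs. subseq xs p \<and> sorted_wrt (<) xs \<and> length xs = l)"

lemma sorted_wrt_subseq: "subseq xs ys \<Longrightarrow> sorted_wrt P ys \<Longrightarrow> sorted_wrt P xs"
proof (induction rule: list_emb.induct)
  case (list_emb_Cons2 x y xs ys)
  then show ?case by (auto elim: list_emb_set)
qed auto

lemma subseq_rev_iff: "subseq (rev xs) (rev ys) \<longleftrightarrow> subseq xs ys"
proof -
  have "subseq (rev xs) (rev ys)" if "subseq xs ys" for xs ys :: "'a list"
    using that by (induction rule: list_emb.induct) (auto intro: list_emb_append_mono subseq_rev_drop_many)
  from this[of xs ys] this[of "rev xs" "rev ys"] show ?thesis by auto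
qed

lemma has_inc_iff_has_dec: "has_inc p l \<longleftrightarrow> has_dec (rev p) l"
proof
  assume "has_inc p l"
  then obtain xs where "subseq xs p" "sorted_wrt (<) xs" "length xs = l" by (auto simp: has_inc_def)
  then show "has_dec (rev p) l"
    unfolding has_dec_def by (intro exI[of _ "rev xs"]) (auto simp: subseq_rev_iff sorted_wrt_rev)
next
  assume "has_dec (rev p) l"
  then obtain xs where "subseq xs (rev p)" "sorted_wrt (>) xs" "length xs = l" by (auto simp: has_dec_def)
  then show "has_inc p l"
    unfolding has_inc_def using subseq_rev_iff[of "rev xs" p]
    by (intro exI[of _ "rev xs"]) (auto simp: sorted_wrt_rev)
qed

lemma has_dec_map:
  assumes "strict_mono_on A f" "set p \<subseteq> A"
  shows "has_dec (map f p) l \<longleftrightarrow> has_dec p l"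
proof -
  have s: "sorted_wrt (>) (map f ys) \<longleftrightarrow> sorted_wrt (>) ys" if "subseq ys p" for ys
  proof -
    have "set ys \<subseteq> A" using set_subseq[OF that] assms(2) by blast
    then have "f y < f x \<longleftrightarrow> y < x" if "x \<in> set ys" "y \<in> set ys" for x y
      using strict_mono_on_less[OF assms(1)] that by blast
    then show ?thesis unfolding sorted_wrt_map sorted_wrt_iff_nth_less by auto
  qed
  have t: "subseq xs (map f p) \<longleftrightarrow> (\<exists>ys. subseq ys p \<and> xs = map f ys)" for xs
    unfolding subseq_conv_nths nths_map by auto
  show ?thesis
  proof
    assume "has_dec (map f p) l"
    then obtain xs where xs: "subseq xs (map f p)" "sorted_wrt (>) xs" "length xs = l" by (auto simp: has_dec_def)
    then obtain ys where "subseq ys p" "xs = map f ys" using t by blast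
    then show "has_dec p l" using xs s[of ys] by (auto simp: has_dec_def)
  next
    assume "has_dec p l"
    then obtain ys where "subseq ys p" "sorted_wrt (>) ys" "length ys = l" by (auto simp: has_dec_def)
    then show "has_dec (map f p) l"
      unfolding has_dec_def using s[of ys] t[of "map f ys"] by (intro exI[of _ "map f ys"]) auto
  qed
qed

definition avoid_inc :: "nat \<Rightarrow> nat set \<Rightarrow> nat list set" where
  "avoid_inc d S = {p \<in> permutations_of_set S. \<not> has_inc p (Suc d)}"

text \<open>Reversal exchanges increasing and decreasing subsequences, and order-preserving
  relabelling replaces \<open>S\<close> by an initial segment.\<close>

lemma card_avoid_inc:
  assumes "finite S"
  shows "real (card (avoid_inc d S)) = ballot_pair_count d (card S)"
proof -
  define n where "n = card S"
  define f where "f = (!) (sorted_list_of_set S)"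
  have len: "length (sorted_list_of_set S) = n" by (simp add: n_def)
  have mono: "strict_mono_on {..<n} f"
    using strict_sorted_list_of_set[of S] len
    by (auto simp: f_def sorted_wrt_iff_nth_less intro!: strict_mono_onI)
  have im: "f ` {..<n} = S"
  proof -
    have "f ` {..<n} = set (sorted_list_of_set S)"
      unfolding f_def set_conv_nth len by auto
    then show ?thesis using assms by simp
  qed
  have inj: "inj_on f {..<n}" using mono by (rule strict_mono_on_imp_inj_on)
  let ?A = "{p \<in> permutations_of_set {..<n}. \<not> has_dec p (Suc d)}"
  have dec: "has_dec (map f p) l \<longleftrightarrow> has_dec p l" if "p \<in> permutations_of_set {..<n}" for p l
    using has_dec_map[OF mono] that by (simp add: permutations_of_set_def)
  have "avoid_inc d S = (rev \<circ> map f) ` ?A"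
  proof (intro equalityI subsetI)
    fix p assume "p \<in> avoid_inc d S"
    then have p: "rev p \<in> permutations_of_set (f ` {..<n})" "\<not> has_dec (rev p) (Suc d)"
      by (auto simp: avoid_inc_def permutations_of_set_def im has_inc_iff_has_dec)
    then obtain r where r: "r \<in> permutations_of_set {..<n}" "rev p = map f r"
      unfolding permutations_of_set_image_inj[OF inj] by blast
    then have "p = rev (map f r)" by (metis rev_rev_ident)
    then show "p \<in> (rev \<circ> map f) ` ?A" using r p dec[OF r(1)] by auto
  next
    fix p assume "p \<in> (rev \<circ> map f) ` ?A"
    then obtain r where r: "r \<in> permutations_of_set {..<n}" "\<not> has_dec r (Suc d)" "p = rev (map f r)" by auto
    have "map f r \<in> permutations_of_set S"
      using r(1) permutations_of_set_image_inj[OF inj] im by blast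
    then show "p \<in> avoid_inc d S"
      using r dec[OF r(1)] by (simp add: avoid_inc_def has_inc_iff_has_dec permutations_of_set_def)
  qed
  moreover have "inj_on (rev \<circ> map f) ?A"
  proof (rule inj_onI)
    fix x y assume x: "x \<in> ?A" "y \<in> ?A" "(rev \<circ> map f) x = (rev \<circ> map f) y"
    then have "map f x = map f y" by simp
    moreover have "set x = {..<n}" "set y = {..<n}" using x by (simp_all add: permutations_of_set_def)
    ultimately show "x = y" using inj inj_on_map_eq_map[of f x y] by simp
  qed
  ultimately have "card (avoid_inc d S) = card ?A" by (simp only: card_image)
  then show ?thesis using card_no_long_dec[of n d] by (simp add: ballot_pair_count_def n_def)
qed

text \<open>The decreasing permutation is a witness. Positivity later extends an eventual lower
  bound to all \<open>n\<close>.\<close>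

lemma ballot_pair_count_pos:
  assumes "d \<ge> 1" shows "ballot_pair_count d n > 0"
proof -
  have "rev [0..<n] \<in> avoid_inc d {..<n}"
  proof -
    have "\<not> has_inc (rev [0..<n]) (Suc d)"
    proof
      assume "has_inc (rev [0..<n]) (Suc d)"
      then obtain xs where xs: "subseq xs (rev [0..<n])" "sorted_wrt (<) xs" "length xs = Suc d"
        by (auto simp: has_inc_def)
      have "sorted_wrt (>) (rev [0..<n])" by (simp add: sorted_wrt_rev)
      then have "sorted_wrt (>) xs" using xs(1) sorted_wrt_subseq by blast
      moreover obtain a b ys where "xs = a # b # ys" using xs(3) assms by (cases xs; cases "tl xs") auto
      ultimately show False using xs(2) by auto
    qed
    then show ?thesis by (auto simp: avoid_inc_def permutations_of_set_def)
  qed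
  moreover have "finite (avoid_inc d {..<n})" by (simp add: avoid_inc_def)
  ultimately have "card (avoid_inc d {..<n}) > 0" by (auto simp: card_gt_0_iff)
  then show ?thesis using card_avoid_inc[of "{..<n}" d] by simp
qed

definition splits :: "nat \<Rightarrow> nat list \<Rightarrow> nat set" where
  "splits d p = {m. m \<le> length p \<and> \<not> has_inc (take m p) (Suc d) \<and> sorted_wrt (<) (drop m p)}"

text \<open>The value set \<open>S\<close> of the prefix and an admissible arrangement of
  \<open>S\<close> determine the permutation, because the suffix lists the remaining values in
  order.\<close>

lemma card_split_at:
  assumes "m \<le> n"
  shows "real (card {p \<in> permutations_of_set {1..n}. m \<in> splits d p}) = real (n choose m) * ballot_pair_count d m"
proof -
  define T where "T = {S. S \<subseteq> {1..n} \<and> card S = m}"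
  define g where "g = (\<lambda>S u. u @ sorted_list_of_set ({1..n} - S))"
  have finS: "finite S" if "S \<in> T" for S using that finite_subset by (auto simp: T_def)
  have take_g: "take m (g S u) = u" "drop m (g S u) = sorted_list_of_set ({1..n} - S)"
    if "S \<in> T" "u \<in> avoid_inc d S" for S u
  proof -
    have "length u = m" using that by (auto simp: avoid_inc_def T_def dest: length_finite_permutations_of_set)
    then show "take m (g S u) = u" "drop m (g S u) = sorted_list_of_set ({1..n} - S)" by (simp_all add: g_def)
  qed
  have "{p \<in> permutations_of_set {1..n}. m \<in> splits d p} = (\<Union>S\<in>T. g S ` avoid_inc d S)"
  proof (intro equalityI subsetI)
    fix p assume "p \<in> {p \<in> permutations_of_set {1..n}. m \<in> splits d p}"
    then have p: "set p = {1..n}" "distinct p" "\<not> has_inc (take m p) (Suc d)" "sorted_wrt (<) (drop m p)"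
      by (simp_all add: splits_def permutations_of_set_def)
    have len: "length p = n" using distinct_card[OF p(2)] p(1) by simp
    define S where "S = set (take m p)"
    have "S \<subseteq> {1..n}" using set_take_subset[of m p] unfolding S_def p(1) .
    moreover have "card S = m" using p(2) len assms unfolding S_def by (subst distinct_card) auto
    ultimately have "S \<in> T" by (simp add: T_def)
    moreover have "take m p \<in> avoid_inc d S" using p by (simp add: avoid_inc_def S_def permutations_of_set_def)
    moreover have "p = g S (take m p)"
    proof -
      have "set (drop m p) = {1..n} - S"
      proof -
        have "set p = set (take m p) \<union> set (drop m p)" by (metis append_take_drop_id set_append)
        moreover have "set (take m p) \<inter> set (drop m p) = {}"
          using set_take_disj_set_drop_if_distinct[OF p(2)] by simp
        ultimately show ?thesis unfolding S_def p(1)[symmetric] by blast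
      qed
      then have "drop m p = sorted_list_of_set ({1..n} - S)"
        using p(4) by (intro sorted_distinct_set_unique) (auto simp: strict_sorted_iff)
      then show ?thesis by (metis append_take_drop_id g_def)
    qed
    ultimately show "p \<in> (\<Union>S\<in>T. g S ` avoid_inc d S)" by blast
  next
    fix p assume "p \<in> (\<Union>S\<in>T. g S ` avoid_inc d S)"
    then obtain S u where S: "S \<in> T" "u \<in> avoid_inc d S" "p = g S u" by blast
    have "set p = {1..n}" "distinct p"
      using S finS[OF S(1)] by (auto simp: g_def avoid_inc_def permutations_of_set_def T_def)
    moreover from this have "length p = n" using distinct_card[of p] by simp
    ultimately show "p \<in> {p \<in> permutations_of_set {1..n}. m \<in> splits d p}"
      using take_g[OF S(1,2)] S assms by (simp add: splits_def permutations_of_set_def avoid_inc_def)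
  qed
  then have "card {p \<in> permutations_of_set {1..n}. m \<in> splits d p} = (\<Sum>S\<in>T. card (g S ` avoid_inc d S))"
  proof (simp only:, intro card_UN_disjoint ballI impI)
    show "finite T" by (simp add: T_def)
    show "finite (g S ` avoid_inc d S)" for S by (simp add: avoid_inc_def)
    fix S S' assume S: "S \<in> T" "S' \<in> T" "S \<noteq> S'"
    show "g S ` avoid_inc d S \<inter> g S' ` avoid_inc d S' = {}"
    proof (rule ccontr)
      assume "g S ` avoid_inc d S \<inter> g S' ` avoid_inc d S' \<noteq> {}"
      then obtain u u' where u: "u \<in> avoid_inc d S" "u' \<in> avoid_inc d S'" "g S u = g S' u'" by blast
      then have "u = u'" using take_g S by metis
      then show False using u S by (auto simp: avoid_inc_def permutations_of_set_def)
    qed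
  qed
  also have "\<dots> = (\<Sum>S\<in>T. card (avoid_inc d S))"
    by (intro sum.cong refl card_image) (auto simp: inj_on_def g_def)
  finally have "real (card {p \<in> permutations_of_set {1..n}. m \<in> splits d p}) = (\<Sum>S\<in>T. real (card (avoid_inc d S)))" by simp
  also have "\<dots> = (\<Sum>S\<in>T. ballot_pair_count d m)"
    using finS by (intro sum.cong) (auto simp: card_avoid_inc T_def)
  also have "\<dots> = real (n choose m) * ballot_pair_count d m"
    using n_subsets[of "{1..n}" m] by (simp add: T_def)
  finally show ?thesis .
qed

text \<open>From the least splitting \<open>m0\<close> on, the entries increase, so a prefix
  reaching \<open>d + 1\<close> entries further contains a forbidden increasing subsequence.\<close>

lemma splits_subset: "\<exists>m0. splits d p \<subseteq> {m0..m0 + d}"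
proof (cases "splits d p = {}")
  case False
  define m0 where "m0 = (LEAST m. m \<in> splits d p)"
  have m0: "m0 \<in> splits d p" unfolding m0_def using False by (metis LeastI ex_in_conv)
  have "m \<le> m0 + d" if m: "m \<in> splits d p" for m
  proof (rule ccontr)
    assume "\<not> m \<le> m0 + d"
    then have gt: "m0 + Suc d \<le> m" by simp
    have len: "m \<le> length p" using m by (simp add: splits_def)
    define xs where "xs = take (Suc d) (drop m0 p)"
    have "sorted_wrt (<) xs" using m0 by (simp add: xs_def splits_def sorted_wrt_take)
    moreover have "length xs = Suc d" using gt len by (simp add: xs_def)
    moreover have "subseq xs (take m p)"
    proof -
      have "take m p = take m0 p @ xs @ drop (m0 + Suc d) (take m p)"
      proof -
        have "take m p = take (m0 + Suc d) (take m p) @ drop (m0 + Suc d) (take m p)"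
          by (rule append_take_drop_id[symmetric])
        also have "take (m0 + Suc d) (take m p) = take m0 p @ xs"
          using gt unfolding xs_def take_add[symmetric] by (simp add: min_absorb1)
        finally show ?thesis by simp
      qed
      then show ?thesis by (metis subseq_drop_many subseq_rev_drop_many subseq_order.order_refl)
    qed
    ultimately show False using m by (auto simp: splits_def has_inc_def)
  qed
  moreover have "m0 \<le> m" if "m \<in> splits d p" for m unfolding m0_def using that by (rule Least_le)
  ultimately show ?thesis by (intro exI[of _ m0]) auto
qed auto

text \<open>Double counting of pairs of a permutation and one of its splittings.\<close>

lemma card_splittable_bounds:
  fixes d n :: nat
  defines "G \<equiv> {p \<in> permutations_of_set {1..n}. splits d p \<noteq> {}}"
  shows "real (card G) \<le> (\<Sum>m\<le>n. real (n choose m) * ballot_pair_count d m)"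
    and "(\<Sum>m\<le>n. real (n choose m) * ballot_pair_count d m) \<le> (real d + 1) * real (card G)"
proof -
  have finG: "finite G" by (simp add: G_def)
  have le: "splits d p \<subseteq> {..n}" if "p \<in> permutations_of_set {1..n}" for p
    using length_finite_permutations_of_set[OF that] by (auto simp: splits_def)
  have fin: "finite (splits d p)" if "p \<in> G" for p
    using le[of p] that finite_subset by (auto simp: G_def)
  have "(\<Sum>m\<le>n. real (n choose m) * ballot_pair_count d m) = (\<Sum>m\<le>n. real (card {p \<in> permutations_of_set {1..n}. m \<in> splits d p}))"
    by (intro sum.cong refl card_split_at[symmetric]) simp
  also have "\<dots> = (\<Sum>m\<le>n. \<Sum>p\<in>G. if m \<in> splits d p then 1 else 0)"
  proof (intro sum.cong refl)
    fix m
    have "{p \<in> permutations_of_set {1..n}. m \<in> splits d p} = {p \<in> G. m \<in> splits d p}" by (auto simp: G_def)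
    then show "real (card {p \<in> permutations_of_set {1..n}. m \<in> splits d p}) = (\<Sum>p\<in>G. if m \<in> splits d p then 1 else 0)"
      using finG by (simp add: sum.If_cases Int_def)
  qed
  also have "\<dots> = (\<Sum>p\<in>G. \<Sum>m\<le>n. if m \<in> splits d p then 1 else 0)" by (rule sum.swap)
  also have "\<dots> = (\<Sum>p\<in>G. real (card (splits d p)))"
  proof (intro sum.cong refl)
    fix p assume "p \<in> G"
    then have "{..n} \<inter> {m. m \<in> splits d p} = splits d p" using le[of p] by (auto simp: G_def)
    then show "(\<Sum>m\<le>n. if m \<in> splits d p then 1 else 0) = real (card (splits d p))"
      by (simp add: sum.If_cases)
  qed
  finally have S: "(\<Sum>m\<le>n. real (n choose m) * ballot_pair_count d m) = (\<Sum>p\<in>G. real (card (splits d p)))" .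
  have "(\<Sum>p\<in>G. 1) \<le> (\<Sum>p\<in>G. real (card (splits d p)))"
  proof (rule sum_mono)
    fix p assume "p \<in> G"
    then have "card (splits d p) > 0" using fin by (auto simp: card_gt_0_iff G_def)
    then show "1 \<le> real (card (splits d p))" by simp
  qed
  then show "real (card G) \<le> (\<Sum>m\<le>n. real (n choose m) * ballot_pair_count d m)" unfolding S by simp
  have "(\<Sum>p\<in>G. real (card (splits d p))) \<le> (\<Sum>p\<in>G. real d + 1)"
  proof (rule sum_mono)
    fix p
    obtain m0 where "splits d p \<subseteq> {m0..m0 + d}" using splits_subset by blast
    then have "card (splits d p) \<le> card {m0..m0 + d}" by (intro card_mono) auto
    then show "real (card (splits d p)) \<le> real d + 1" by simp
  qed
  then show "(\<Sum>m\<le>n. real (n choose m) * ballot_pair_count d m) \<le> (real d + 1) * real (card G)"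
    unfolding S by (simp add: mult.commute)
qed

section \<open>Patterns and the generating function\<close>

text \<open>The prefix \<open>take n p\<close> serves the induction, which cuts at the last index,
  and later keeps the increasing part of a pattern in front of its final entry.\<close>

lemma subseq_map_nth:
  assumes "strict_mono_on {..<l} f" "\<forall>r<l. f r < n" "n \<le> length p"
  shows "subseq (map (\<lambda>r. p ! f r) [0..<l]) (take n p)"
  using assms
proof (induction l arbitrary: n)
  case (Suc l)
  have fl: "f l < n" "f l < length p" using Suc.prems by auto
  have "subseq (map (\<lambda>r. p ! f r) [0..<l]) (take (f l) p)"
  proof (rule Suc.IH)
    show "strict_mono_on {..<l} f" using Suc.prems(1) by (rule monotone_on_subset) auto
    show "\<forall>r<l. f r < f l" using Suc.prems(1) by (auto intro: strict_mono_onD)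
    show "f l \<le> length p" using fl by simp
  qed
  moreover have "subseq [p ! f l] (drop (f l) (take n p))"
  proof -
    have "p ! f l = take n p ! f l" using fl by simp
    then have "drop (f l) (take n p) = p ! f l # drop (Suc (f l)) (take n p)"
      using fl by (metis Cons_nth_drop_Suc length_take min_less_iff_conj)
    then show ?thesis by simp
  qed
  ultimately have "subseq (map (\<lambda>r. p ! f r) [0..<l] @ [p ! f l]) (take (f l) p @ drop (f l) (take n p))"
    by (rule list_emb_append_mono)
  moreover have "take n p = take (f l) p @ drop (f l) (take n p)"
    using fl by (metis append_take_drop_id less_imp_le min_absorb1 take_take)
  ultimately show ?case by simp
qed simp

lemma subseq_imp_embedding:
  "subseq xs p \<Longrightarrow> \<exists>f. strict_mono_on {..<length xs} f \<and> (\<forall>r<length xs. f r < length p \<and> xs ! r = p ! f r)"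
proof (induction rule: list_emb.induct)
  case (list_emb_Nil ys)
  then show ?case by (auto simp: strict_mono_on_def)
next
  case (list_emb_Cons xs ys y)
  then obtain f where f: "strict_mono_on {..<length xs} f" "\<forall>r<length xs. f r < length ys \<and> xs ! r = ys ! f r" by blast
  then show ?case by (intro exI[of _ "Suc \<circ> f"]) (auto simp: strict_mono_on_def)
next
  case (list_emb_Cons2 x y xs ys)
  then obtain f where f: "strict_mono_on {..<length xs} f" "\<forall>r<length xs. f r < length ys \<and> xs ! r = ys ! f r" by blast
  define g where "g = (\<lambda>r. case r of 0 \<Rightarrow> 0 | Suc r \<Rightarrow> Suc (f r))"
  have "strict_mono_on {..<length (x # xs)} g"
    using f(1) by (auto simp: strict_mono_on_def g_def split: nat.splits)
  moreover have "\<forall>r<length (x # xs). g r < length (y # ys) \<and> (x # xs) ! r = (y # ys) ! g r"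
    using f(2) list_emb_Cons2(1) by (auto simp: g_def nth_Cons split: nat.splits)
  ultimately show ?case by blast
qed

lemma standardization:
  fixes zs :: "nat list"
  assumes "distinct zs"
  defines "q \<equiv> map (\<lambda>z. card {w \<in> set zs. w \<le> z}) zs"
  shows "q \<in> permutations_of_set {1..length zs}"
    and "\<And>r s. r < length zs \<Longrightarrow> s < length zs \<Longrightarrow> q ! r < q ! s \<longleftrightarrow> zs ! r < zs ! s"
proof -
  define rk where "rk = (\<lambda>z. card {w \<in> set zs. w \<le> z})"
  have mono: "rk z < rk z'" if "z < z'" "z' \<in> set zs" for z z'
  proof -
    have "{w \<in> set zs. w \<le> z} \<subseteq> {w \<in> set zs. w \<le> z'}" using that by auto
    moreover have "z' \<in> {w \<in> set zs. w \<le> z'}" "z' \<notin> {w \<in> set zs. w \<le> z}" using that by auto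
    ultimately have "{w \<in> set zs. w \<le> z} \<subset> {w \<in> set zs. w \<le> z'}" by blast
    then show ?thesis unfolding rk_def by (intro psubset_card_mono) auto
  qed
  have less: "rk z < rk z' \<longleftrightarrow> z < z'" if "z \<in> set zs" "z' \<in> set zs" for z z'
    using mono[of z z'] mono[of z' z] that by (cases z z' rule: linorder_cases) auto
  then show "q ! r < q ! s \<longleftrightarrow> zs ! r < zs ! s" if "r < length zs" "s < length zs" for r s
    using that by (simp add: q_def rk_def)
  have inj: "inj_on rk (set zs)" using less by (auto simp: inj_on_def) (metis linorder_neqE_nat order_less_irrefl)
  have sub: "rk ` set zs \<subseteq> {1..length zs}"
  proof
    fix x assume "x \<in> rk ` set zs"
    then obtain z where z: "z \<in> set zs" "x = rk z" by blast
    then have "rk z > 0" by (auto simp: rk_def card_gt_0_iff)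
    moreover have "rk z \<le> card (set zs)" unfolding rk_def by (rule card_mono) auto
    ultimately show "x \<in> {1..length zs}" using z assms(1) by (simp add: distinct_card)
  qed
  have "card (rk ` set zs) = card {1..length zs}"
    using assms(1) by (simp add: card_image[OF inj] distinct_card)
  then have "rk ` set zs = {1..length zs}" using sub by (intro card_subset_eq) auto
  moreover have "distinct (map rk zs)" using assms(1) inj by (simp add: distinct_map)
  ultimately show "q \<in> permutations_of_set {1..length zs}"
    by (simp add: permutations_of_set_def q_def rk_def)
qed

definition inc_then_drop :: "nat \<Rightarrow> nat list \<Rightarrow> bool" where
  "inc_then_drop l p \<longleftrightarrow> (\<exists>j<length p. \<exists>xs. subseq xs (take j p) \<and> sorted_wrt (<) xs \<and>
     length xs = l \<and> xs \<noteq> [] \<and> p ! j < last xs)"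

text \<open>In a pattern of the set the maximum \<open>k\<close> is not last, so it ends the
  increasing part. The last entry is then merely smaller than its predecessor, and since all such
  values occur, nothing else is required; \<open>standardization\<close> turns any such
  configuration back into a pattern.\<close>

lemma contains_A_pattern_iff:
  assumes "distinct p" "k \<ge> 2"
  shows "(\<exists>q\<in>A_patterns k. contains_pattern p q) \<longleftrightarrow> inc_then_drop (k - 1) p"
proof
  assume "\<exists>q\<in>A_patterns k. contains_pattern p q"
  then obtain q f where q: "q \<in> permutations_of_set {1..k}" "sorted_wrt (<) (butlast q)" "last q < k"
    and f: "strict_mono_on {..<length q} f" "\<forall>r<length q. f r < length p"
      "\<And>r s. r < length q \<Longrightarrow> s < length q \<Longrightarrow> p ! f r < p ! f s \<longleftrightarrow> q ! r < q ! s"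
    by (auto simp: A_patterns_def contains_pattern_def)
  have len: "length q = k" using length_finite_permutations_of_set[OF q(1)] by simp
  have sq: "set q = {1..k}" using q(1) by (simp add: permutations_of_set_def)
  have ne: "q \<noteq> []" using len assms(2) by auto
  have lastq: "last q = q ! (k - 1)" using ne len by (simp add: last_conv_nth)
  have inc: "q ! r < q ! s" if "r < s" "s < k - 1" for r s
    using q(2) that len by (auto simp: sorted_wrt_iff_nth_less nth_butlast)
  have max: "q ! (k - 2) = k"
  proof -
    have "k \<in> set q" using sq assms(2) by simp
    then obtain r where r: "r < k" "q ! r = k" using len by (auto simp: in_set_conv_nth)
    have "r \<noteq> k - 1" using r q(3) lastq by auto
    then have "r < k - 1" using r by simp
    show ?thesis
    proof (cases "r = k - 2")
      case False
      then have "k < q ! (k - 2)" using inc[of r "k - 2"] r \<open>r < k - 1\<close> by auto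
      moreover have "q ! (k - 2) \<in> {1..k}" using sq len assms(2) by (metis diff_less less_le_trans nth_mem zero_less_numeral order_less_le_trans)
      ultimately show ?thesis by simp
    qed (use r in simp)
  qed
  define xs where "xs = map (\<lambda>r. p ! f r) [0..<k - 1]"
  have "f (k - 1) < length p" using f(2) len assms(2) by simp
  moreover have "subseq xs (take (f (k - 1)) p)"
    unfolding xs_def
  proof (rule subseq_map_nth)
    show "strict_mono_on {..<k - 1} f" using f(1) by (rule monotone_on_subset) (auto simp: len)
    show "\<forall>r<k - 1. f r < f (k - 1)" using f(1) len by (auto intro: strict_mono_onD)
  qed (use \<open>f (k - 1) < length p\<close> in simp)
  moreover have "sorted_wrt (<) xs"
    using inc f(3) len by (auto simp: xs_def sorted_wrt_iff_nth_less)
  moreover have "length xs = k - 1" by (simp add: xs_def)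
  moreover have "xs \<noteq> []" using assms(2) by (simp add: xs_def)
  moreover have "p ! f (k - 1) < last xs"
  proof -
    have "last xs = p ! f (k - 2)"
    proof -
      have "k - 1 = Suc (k - 2)" using assms(2) by simp
      then show ?thesis unfolding xs_def by (simp only: upt_Suc_append zero_le map_append list.map last_snoc)
    qed
    moreover have "q ! (k - 1) < q ! (k - 2)" using q(3) lastq max by simp
    ultimately show ?thesis using f(3)[of "k - 1" "k - 2"] len assms(2) by simp
  qed
  ultimately show "inc_then_drop (k - 1) p" unfolding inc_then_drop_def by blast
next
  assume "inc_then_drop (k - 1) p"
  then obtain j xs where j: "j < length p" "subseq xs (take j p)" "sorted_wrt (<) xs"
    "length xs = k - 1" "xs \<noteq> []" "p ! j < last xs" by (auto simp: inc_then_drop_def)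
  define zs where "zs = xs @ [p ! j]"
  have len: "length zs = k" using j assms(2) by (simp add: zs_def)
  have sub: "subseq zs p"
  proof -
    have "p = take j p @ p ! j # drop (Suc j) p" using j(1) by (rule id_take_nth_drop)
    moreover have "subseq zs (take j p @ p ! j # drop (Suc j) p)"
      unfolding zs_def using j(2) by (intro list_emb_append_mono) auto
    ultimately show ?thesis by simp
  qed
  have dist: "distinct zs" using sub assms(1) by (metis subseq_conv_nths distinct_nthsI)
  define q where "q = map (\<lambda>z. card {w \<in> set zs. w \<le> z}) zs"
  note st = standardization[OF dist, folded q_def]
  have lq: "length q = k" by (simp add: q_def len)
  have qin: "q \<in> A_patterns k"
    unfolding A_patterns_def
  proof (intro CollectI conjI)
    show "q \<in> permutations_of_set {1..k}" using st(1) len by simp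
    have zx: "zs ! r = xs ! r" if "r < k - 1" for r using that j(4) by (simp add: zs_def nth_append)
    show "sorted_wrt (<) (butlast q)"
      unfolding sorted_wrt_iff_nth_less
    proof (intro allI impI)
      fix r s assume rs: "r < s" "s < length (butlast q)"
      then have rs': "r < k - 1" "s < k - 1" using lq by auto
      then have "zs ! r < zs ! s" using j(3,4) rs zx by (simp add: sorted_wrt_iff_nth_less)
      then show "butlast q ! r < butlast q ! s" using st(2)[of r s] rs rs' len lq by (simp add: nth_butlast)
    qed
    have "zs ! (k - 1) < zs ! (k - 2)"
    proof -
      have "zs ! (k - 1) = p ! j" using j(4) by (simp add: zs_def nth_append)
      moreover have "zs ! (k - 2) = last xs" using zx[of "k - 2"] j(4,5) assms(2) by (simp add: last_conv_nth numeral_2_eq_2)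
      ultimately show ?thesis using j(6) by simp
    qed
    then have "q ! (k - 1) < q ! (k - 2)" using st(2)[of "k - 1" "k - 2"] len assms(2) by simp
    moreover have "q ! (k - 2) \<le> k"
      using st(1) lq len assms(2) nth_mem[of "k - 2" q] by (simp add: permutations_of_set_def)
    moreover have "last q = q ! (k - 1)" using lq assms(2) by (subst last_conv_nth) auto
    ultimately show "last q < k" by simp
  qed
  obtain f where f: "strict_mono_on {..<length zs} f" "\<forall>r<length zs. f r < length p \<and> zs ! r = p ! f r"
    using subseq_imp_embedding[OF sub] by blast
  have "contains_pattern p q"
    unfolding contains_pattern_def
    using f st(2) lq len by (intro exI[of _ f]) auto
  then show "\<exists>q\<in>A_patterns k. contains_pattern p q" using qin by blast
qed

text \<open>A bad configuration defeats every \<open>m\<close>: either \<open>xs\<close> fits into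
  the prefix, or \<open>last xs\<close> and the smaller \<open>p ! j\<close> both lie in the
  increasing suffix. Conversely, the longest prefix without an increasing subsequence of length
  \<open>d + 1\<close> gives a splitting unless there is a bad configuration.\<close>

lemma inc_then_drop_iff_no_split:
  assumes "distinct p"
  shows "inc_then_drop (Suc d) p \<longleftrightarrow> splits d p = {}"
proof
  assume "inc_then_drop (Suc d) p"
  then obtain j xs where j: "j < length p" "subseq xs (take j p)" "sorted_wrt (<) xs"
    "length xs = Suc d" "xs \<noteq> []" "p ! j < last xs" by (auto simp: inc_then_drop_def)
  have False if m: "m \<in> splits d p" for m
  proof (cases "j \<le> m")
    case True
    then have "subseq (take j p) (take m p)"
      by (metis le_add_diff_inverse subseq_rev_drop_many subseq_order.order_refl take_add)
    then have "has_inc (take m p) (Suc d)" using j unfolding has_inc_def using subseq_order.trans by blast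
    then show False using m by (simp add: splits_def)
  next
    case False
    have "take j p = take m p @ take (j - m) (drop m p)"
      using False by (metis le_add_diff_inverse nat_le_linear take_add)
    then obtain a b where ab: "xs = a @ b" "subseq a (take m p)" "subseq b (take (j - m) (drop m p))"
      using j(2) by (auto simp: subseq_append_iff)
    have "b \<noteq> []"
    proof
      assume "b = []"
      then have "has_inc (take m p) (Suc d)" using ab j unfolding has_inc_def by auto
      then show False using m by (simp add: splits_def)
    qed
    then have "last xs \<in> set (take (j - m) (drop m p))" using ab set_subseq[OF ab(3)] by auto
    then obtain i where i: "i < j - m" "last xs = drop m p ! i" using j(1) by (auto simp: in_set_conv_nth)
    have "drop m p ! i < drop m p ! (j - m)"
      using m i(1) j(1) by (intro sorted_wrt_nth_less[of "(<)"]) (auto simp: splits_def)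
    also have "drop m p ! (j - m) = p ! j" using False j(1) by simp
    finally show False using i j(6) by simp
  qed
  then show "splits d p = {}" by blast
next
  assume no: "splits d p = {}"
  show "inc_then_drop (Suc d) p"
  proof (rule ccontr)
    assume nb: "\<not> inc_then_drop (Suc d) p"
    have key: "p ! i < p ! j" if "subseq xs (take (Suc i) p)" "sorted_wrt (<) xs" "length xs = Suc d" "last xs = p ! i"
      "i < j" "j < length p" for xs i j
    proof -
      have "subseq (take (Suc i) p) (take j p)"
        using that(5) by (metis Suc_leI le_add_diff_inverse subseq_rev_drop_many subseq_order.order_refl take_add)
      then have "subseq xs (take j p)" using that(1) subseq_order.trans by blast
      moreover have "xs \<noteq> []" using that(3) by auto
      ultimately have "\<not> p ! j < last xs" using nb that unfolding inc_then_drop_def by blast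
      moreover have "p ! j \<noteq> p ! i" using assms that by (simp add: nth_eq_iff_index_eq)
      ultimately show ?thesis using that(4) by simp
    qed
    have "length p \<notin> splits d p" using no by simp
    then have "has_inc (take (length p) p) (Suc d)" by (simp add: splits_def)
    moreover have "\<not> has_inc (take 0 p) (Suc d)" by (auto simp: has_inc_def)
    ultimately obtain m where m: "m < length p" "\<not> has_inc (take m p) (Suc d)" "has_inc (take (Suc m) p) (Suc d)"
      using ex_least_nat_less[of "\<lambda>m. has_inc (take m p) (Suc d)" "length p"] by auto
    then obtain xs where xs: "subseq xs (take (Suc m) p)" "sorted_wrt (<) xs" "length xs = Suc d"
      by (auto simp: has_inc_def)
    have t: "take (Suc m) p = take m p @ [p ! m]" using m(1) by (rule take_Suc_conv_app_nth)
    then obtain a b where ab: "xs = a @ b" "subseq a (take m p)" "subseq b [p ! m]"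
      using xs(1) by (auto simp: subseq_append_iff)
    have "b \<noteq> []"
      using ab xs m(2) by (auto simp: has_inc_def)
    then have b: "b = [p ! m]" using ab(3) by (cases b) (auto split: if_splits)
    have first: "p ! m < p ! j" if "m < j" "j < length p" for j
      using key[OF xs(1-3) _ that] ab(1) b by simp
    have "p ! i < p ! j" if "m \<le> i" "i < j" "j < length p" for i j
    proof (cases "i = m")
      case True
      then show ?thesis using first that by simp
    next
      case False
      \<comment> \<open>Replacing the final \<open>p ! m\<close> by the larger \<open>p ! i\<close>
        gives an increasing subsequence of the same length ending at \<open>i\<close>, so
        \<open>key\<close> also applies there.\<close>
      have "subseq (a @ [p ! i]) (take i p @ [p ! i])"
      proof (rule list_emb_append_mono)
        have "subseq (take m p) (take i p)"
          using that(1) by (metis le_add_diff_inverse subseq_rev_drop_many subseq_order.order_refl take_add)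
        then show "subseq a (take i p)" using ab(2) subseq_order.trans by blast
      qed simp
      then have "subseq (a @ [p ! i]) (take (Suc i) p)" using that by (simp add: take_Suc_conv_app_nth)
      moreover have "sorted_wrt (<) (a @ [p ! i])"
        using xs(2) ab(1) b first[of i] False that by (auto simp: sorted_wrt_append)
      moreover have "length (a @ [p ! i]) = Suc d" using xs(3) ab(1) b by simp
      ultimately show ?thesis using key[of "a @ [p ! i]" i j] that by simp
    qed
    then have "sorted_wrt (<) (drop m p)" using m(1) by (auto simp: sorted_wrt_iff_nth_less)
    then have "m \<in> splits d p" using m by (simp add: splits_def)
    then show False using no by simp
  qed
qed

lemma Av_A_patterns:
  assumes "k \<ge> 2"
  shows "Av n (A_patterns k) = {p \<in> permutations_of_set {1..n}. splits (k - 2) p \<noteq> {}}"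
proof -
  have "k - 1 = Suc (k - 2)" using assms by simp
  then have "(\<exists>q\<in>A_patterns k. contains_pattern p q) \<longleftrightarrow> splits (k - 2) p = {}"
    if "p \<in> permutations_of_set {1..n}" for p
    using contains_A_pattern_iff[OF permutations_of_setD(2)[OF that] assms]
      inc_then_drop_iff_no_split[OF permutations_of_setD(2)[OF that]] by simp
  then show ?thesis unfolding Av_def by blast
qed

section \<open>Binomial transforms and the growth of the class\<close>

lemma rising_weight_antimono: "m \<le> n \<Longrightarrow> rising_weight r n \<le> rising_weight r m"
  using lift_Suc_antimono_le[of "rising_weight r" m n, OF rising_weight_Suc_le] .

lemma binomial_rising_weight:
  assumes "m \<le> n"
  shows "real (n choose m) * rising_weight r m = rising_weight r n * real ((n + r) choose (m + r))"
  using assms by (simp add: binomial_fact rising_weight_def)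

text \<open>After the exchange in \<open>binomial_rising_weight\<close> the sum is a part of the
  binomial expansion of (D + 1)^(n + r). The indices are shifted by \<open>r\<close>, hence the
  factor \<open>D ^ r\<close>.\<close>

lemma binomial_transform_upper:
  assumes "D \<ge> 0"
  shows "D ^ r * (\<Sum>m\<le>n. real (n choose m) * (D ^ m * rising_weight r m)) \<le> (D + 1) ^ r * (D + 1) ^ n * rising_weight r n"
proof -
  have "D ^ r * (\<Sum>m\<le>n. real (n choose m) * (D ^ m * rising_weight r m))
      = rising_weight r n * (\<Sum>m\<le>n. real ((n + r) choose (m + r)) * D ^ (m + r))"
    unfolding sum_distrib_left
  proof (rule sum.cong)
    fix m assume "m \<in> {..n}"
    then have "real (n choose m) * rising_weight r m * D ^ (m + r) = rising_weight r n * real ((n + r) choose (m + r)) * D ^ (m + r)"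
      using binomial_rising_weight[of m n r] by simp
    then show "D ^ r * (real (n choose m) * (D ^ m * rising_weight r m)) = rising_weight r n * (real ((n + r) choose (m + r)) * D ^ (m + r))"
      by (simp add: power_add mult_ac)
  qed simp
  also have "\<dots> \<le> rising_weight r n * (D + 1) ^ (n + r)"
  proof (rule mult_left_mono)
    have "(\<Sum>m\<le>n. real ((n + r) choose (m + r)) * D ^ (m + r)) = (\<Sum>j\<in>(\<lambda>m. m + r) ` {..n}. real ((n + r) choose j) * D ^ j)"
      by (subst sum.reindex) (auto simp: inj_on_def)
    also have "\<dots> \<le> (\<Sum>j\<le>n + r. real ((n + r) choose j) * D ^ j)"
      using assms by (intro sum_mono2) auto
    also have "\<dots> = (D + 1) ^ (n + r)" by (simp add: binomial_ring)
    finally show "(\<Sum>m\<le>n. real ((n + r) choose (m + r)) * D ^ (m + r)) \<le> (D + 1) ^ (n + r)" .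
  qed (rule less_imp_le[OF rising_weight_pos])
  finally show ?thesis by (simp add: power_add mult_ac)
qed

lemma binomial_transform_lower:
  assumes "D \<ge> 0"
  shows "(D + 1) ^ n * rising_weight r n \<le> (\<Sum>m\<le>n. real (n choose m) * (D ^ m * rising_weight r m))"
proof -
  have "(D + 1) ^ n * rising_weight r n = (\<Sum>m\<le>n. real (n choose m) * (D ^ m * rising_weight r n))"
    by (simp add: binomial_ring sum_distrib_right mult.assoc)
  also have "\<dots> \<le> (\<Sum>m\<le>n. real (n choose m) * (D ^ m * rising_weight r m))"
    using assms by (intro sum_mono mult_left_mono rising_weight_antimono) auto
  finally show ?thesis .
qed

text \<open>The threshold is lowered one index at a time, shrinking the constant to the quotient at
  that index if necessary.\<close>

lemma eventual_lower_bound_global: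
  fixes a w :: "nat \<Rightarrow> real"
  assumes "\<And>n. a n > 0" "\<And>n. w n > 0" "c > 0" "\<And>n. n \<ge> n0 \<Longrightarrow> c * w n \<le> a n"
  shows "\<exists>c>0. \<forall>n. c * w n \<le> a n"
  using assms(3,4)
proof (induction n0 arbitrary: c)
  case (Suc n0)
  define c' where "c' = min c (a n0 / w n0)"
  have "c' > 0" using Suc.prems(1) assms by (simp add: c'_def)
  moreover have "c' * w n \<le> a n" if "n \<ge> n0" for n
  proof (cases "n = n0")
    case True
    have "c' * w n0 \<le> a n0 / w n0 * w n0"
      using assms(2)[of n0] by (intro mult_right_mono) (auto simp: c'_def)
    then show ?thesis using assms(2)[of n0] True by simp
  next
    case False
    then have "c * w n \<le> a n" using Suc.prems(2) that by simp
    moreover have "c' * w n \<le> c * w n" using assms(2)[of n] by (intro mult_right_mono) (auto simp: c'_def)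
    ultimately show ?thesis by linarith
  qed
  ultimately show ?case by (rule Suc.IH)
qed auto

theorem theorem12:
  fixes k :: nat
  assumes "odd k" and "k > 3"
  shows "\<not> algebraic_fps (Abs_fps (\<lambda>n. of_nat (card (Av n (A_patterns k)))) :: complex fps)"
proof -
  define d where "d = k - 2"
  have "odd d" using assms by (simp add: d_def)
  then obtain s where d: "d = 2 * s + 1" by (elim oddE)
  have s: "s \<ge> 1" using assms(2) d by (simp add: d_def)
  \<comment> \<open>This is B + s for B = d s, that is, (d^2 - 1) / 2.\<close>
  define r where "r = d * s + s"
  define D where "D = real d ^ 2"
  have D: "D > 0" by (simp add: D_def d)
  have r: "r \<ge> 1" using s by (simp add: r_def)
  define a where "a = ballot_pair_count d"
  define F where "F = (\<lambda>n. \<Sum>m\<le>n. real (n choose m) * a m)"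
  define f where "f = (\<lambda>n. real (card (Av n (A_patterns k))))"
  have f: "f n \<le> F n" "F n \<le> (real d + 1) * f n" for n
    unfolding f_def F_def a_def Av_A_patterns[OF less_imp_le_nat[OF less_trans[OF _ assms(2)], of 2, simplified]] d_def[symmetric]
    by (rule card_splittable_bounds)+
  obtain C where C: "a n \<le> C * D ^ n * rising_weight r n" for n
    using ballot_pair_count_upper[OF d s refl] by (auto simp: a_def D_def r_def)
  obtain c0 n0 where "c0 > 0" "\<And>n. n \<ge> n0 \<Longrightarrow> c0 * (D ^ n * rising_weight r n) \<le> a n"
    using ballot_pair_count_lower[OF d s refl] by (auto simp: a_def D_def r_def mult.assoc)
  then obtain c where c: "c > 0" "c * (D ^ n * rising_weight r n) \<le> a n" for n
    using eventual_lower_bound_global[of a "\<lambda>n. D ^ n * rising_weight r n" c0 n0]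
      ballot_pair_count_pos[of d] D rising_weight_pos by (auto simp: a_def d)
  have a0: "a n \<ge> 0" for n using c D rising_weight_pos[of r n] by (smt (verit) mult_pos_pos zero_less_power)
  have C0: "C \<ge> 0" using order_trans[OF a0 C[of 0]] rising_weight_pos[of r 0] by (auto simp: zero_le_mult_iff)
  have F_lower: "c * ((D + 1) ^ n * rising_weight r n) \<le> F n" for n
  proof -
    have "c * ((D + 1) ^ n * rising_weight r n) \<le> c * (\<Sum>m\<le>n. real (n choose m) * (D ^ m * rising_weight r m))"
      using c(1) D by (intro mult_left_mono binomial_transform_lower) auto
    also have "\<dots> = (\<Sum>m\<le>n. real (n choose m) * (c * (D ^ m * rising_weight r m)))"
      by (simp add: sum_distrib_left mult_ac)
    also have "\<dots> \<le> F n" unfolding F_def using c(2) by (intro sum_mono mult_left_mono) auto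
    finally show ?thesis .
  qed
  have F_upper: "F n \<le> C * (D + 1) ^ r / D ^ r * (D + 1) ^ n * rising_weight r n" for n
  proof -
    have "F n \<le> (\<Sum>m\<le>n. real (n choose m) * (C * D ^ m * rising_weight r m))"
      unfolding F_def using C by (intro sum_mono mult_left_mono) auto
    also have "\<dots> = C / D ^ r * (D ^ r * (\<Sum>m\<le>n. real (n choose m) * (D ^ m * rising_weight r m)))"
      using D by (simp add: sum_distrib_left mult_ac)
    also have "\<dots> \<le> C / D ^ r * ((D + 1) ^ r * (D + 1) ^ n * rising_weight r n)"
      using C0 D by (intro mult_left_mono binomial_transform_upper) auto
    finally show ?thesis by (simp add: mult_ac)
  qed
  have "\<not> algebraic_fps (Abs_fps (\<lambda>n. of_real (f n)) :: complex fps)"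
  proof (rule not_algebraic_fps_if_integral_exponent[OF r])
    show "D + 1 > 0" using D by simp
    show "c / (real d + 1) > 0" using c(1) by simp
    \<comment> \<open>The divisor \<open>real d + 1\<close> bounds the number of splittings of one
      permutation.\<close>
    show "c / (real d + 1) * (D + 1) ^ n * rising_weight r n \<le> f n" for n
      using order_trans[OF F_lower f(2), of n] by (simp add: field_simps)
    show "f n \<le> C * (D + 1) ^ r / D ^ r * (D + 1) ^ n * rising_weight r n" for n
      using order_trans[OF f(1) F_upper] .
  qed
  then show ?thesis by (simp add: f_def)
qed

end
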